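(* For $n\ge 4$, there is a short exact sequence $$1\longrightarrow PL_n/PL_n'\longrightarrow L_n/PL_n'\stackrel{\pi}{\longrightarrow} S_n\longrightarrow 1$$ such that $L_n/PL_n'$ is a crystallographic group of dimension $1+n!\left(\frac{2n-7}{6}\right)$. Furthermore, $L_n/PL_n'$ is not a Bieberbach group.
   Context: The triplet group is $L_n=\langle y_1,\dots,y_{n-1}\mid y_j^2=1 \text{ for } 1\le j\le n-1,\ y_iy_{i+1}y_i=y_{i+1}y_iy_{i+1} \text{ for } 1\le i\le n-2\rangle$. The pure triplet group $PL_n$ is the kernel of the surjection $L_n\to S_n$ sending $y_i$ to the transposition $\tau_i=(i,i+1)$; $PL_n'$ is the commutator subgroup of $PL_n$ (normal in $L_n$), and $\pi$ is the map induced by $L_n\to S_n$. A crystallographic group of dimension $d$ is a group isomorphic to a discrete uniform (i.e. cocompact) subgroup of $\mathbb{R}^d\rtimes \mathrm{O}(d,\mathbb{R})$. Equivalently, it is a group $G$ for which there are a finite group $H$ and a short exact sequence $0\to\mathbb{Z}^d\to G\stackrel{\eta}{\to} H\to1$ such that the representation $\Theta:H\to\mathrm{Aut}(\mathbb{Z}^d)$, $\Theta(h)(x)=zxz^{-1}$ (where $z\in G$ satisfies $\eta(z)=h$), is faithful. A Bieberbach group is a torsion free crystallographic group. *)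

theory Defs
  imports "HOL-Analysis.Analysis" "HOL-Algebra.Algebra"
begin

section \<open>Groups given by generators and relations\<close>

text \<open>
  The letter \<open>(True, a)\<close> stands for the generator \<open>a\<close> and \<open>(False, a)\<close> for its formal inverse.
  A relation is a pair of words, to be read as an equation between them.
\<close>

type_synonym 'a word = "(bool \<times> 'a) list"

definition words :: "'a set \<Rightarrow> 'a word set" where
  "words S = lists (UNIV \<times> S)"

inductive_set pres_rel :: "'a set \<Rightarrow> ('a word \<times> 'a word) set \<Rightarrow> ('a word \<times> 'a word) set"
  for S R where
  refl: "w \<in> words S \<Longrightarrow> (w, w) \<in> pres_rel S R"
| sym: "(v, w) \<in> pres_rel S R \<Longrightarrow> (w, v) \<in> pres_rel S R"
| trans: "(u, v) \<in> pres_rel S R \<Longrightarrow> (v, w) \<in> pres_rel S R \<Longrightarrow> (u, w) \<in> pres_rel S R"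
| cancel: "u \<in> words S \<Longrightarrow> v \<in> words S \<Longrightarrow> a \<in> S \<Longrightarrow>
    (u @ [(b, a), (\<not> b, a)] @ v, u @ v) \<in> pres_rel S R"
| relation: "u \<in> words S \<Longrightarrow> v \<in> words S \<Longrightarrow> (r, s) \<in> R \<Longrightarrow> r \<in> words S \<Longrightarrow> s \<in> words S \<Longrightarrow>
    (u @ r @ v, u @ s @ v) \<in> pres_rel S R"

definition presented_group :: "'a set \<Rightarrow> ('a word \<times> 'a word) set \<Rightarrow> 'a word set monoid" where
  "presented_group S R =
    \<lparr>carrier = words S // pres_rel S R,
     mult = (\<lambda>C D. \<Union>u\<in>C. \<Union>v\<in>D. pres_rel S R `` {u @ v}),
     one = pres_rel S R `` {[]}\<rparr>"

definition word_value :: "('b, 'c) monoid_scheme \<Rightarrow> ('a \<Rightarrow> 'b) \<Rightarrow> 'a word \<Rightarrow> 'b" where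
  "word_value G f w =
    foldr (\<lambda>(b, a) x. (if b then f a else inv\<^bsub>G\<^esub> (f a)) \<otimes>\<^bsub>G\<^esub> x) w \<one>\<^bsub>G\<^esub>"

text \<open>
  The map induced by \<open>f\<close> on classes, or on cosets.  It is meaningful when \<open>f\<close> is constant on
  the class.
\<close>

definition induced_map :: "('a \<Rightarrow> 'b) \<Rightarrow> 'a set \<Rightarrow> 'b" where
  "induced_map f C = the_elem (f ` C)"


section \<open>Triplet groups\<close>

text \<open>The generator \<open>y\<^sub>j\<close> is represented by the number \<open>j\<close>.\<close>

definition triplet_relations :: "nat \<Rightarrow> (nat word \<times> nat word) set" where
  "triplet_relations n =
    {([(True, j), (True, j)], []) | j. 1 \<le> j \<and> j \<le> n - 1} \<union>
    {([(True, i), (True, i + 1), (True, i)], [(True, i + 1), (True, i), (True, i + 1)])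
      | i. 1 \<le> i \<and> i \<le> n - 2}"

definition triplet_group :: "nat \<Rightarrow> nat word set monoid" where
  "triplet_group n = presented_group {1..n - 1} (triplet_relations n)"

definition triplet_perm :: "nat \<Rightarrow> nat word set \<Rightarrow> (nat \<Rightarrow> nat)" where
  "triplet_perm n = induced_map (word_value (sym_group n) (\<lambda>i. Transposition.transpose i (i + 1)))"

definition pure_triplet :: "nat \<Rightarrow> nat word set set" where
  "pure_triplet n = kernel (triplet_group n) (sym_group n) (triplet_perm n)"

definition pure_triplet_group :: "nat \<Rightarrow> nat word set monoid" where
  "pure_triplet_group n = (triplet_group n)\<lparr>carrier := pure_triplet n\<rparr>"

definition pure_triplet_derived :: "nat \<Rightarrow> nat word set set" where
  "pure_triplet_derived n = derived (triplet_group n) (pure_triplet n)"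


section \<open>Short exact sequences\<close>

text \<open>
  Unlike \<^const>\<open>short_exact_sequence\<close>, this does not force the three groups to have elements of
  the same type.
\<close>

definition short_exact ::
  "('a, 'k) monoid_scheme \<Rightarrow> ('a \<Rightarrow> 'b) \<Rightarrow> ('b, 'l) monoid_scheme \<Rightarrow> ('b \<Rightarrow> 'c) \<Rightarrow>
   ('c, 'm) monoid_scheme \<Rightarrow> bool" where
  "short_exact A f B g C \<longleftrightarrow>
    group A \<and> group B \<and> group C \<and>
    f \<in> mon A B \<and> g \<in> epi B C \<and> kernel B C g = f ` carrier A"


section \<open>Crystallographic and Bieberbach groups\<close>

text \<open>
  Vectors of \<open>\<real>\<^sup>d\<close> are functions vanishing from \<open>d\<close> on (as for \<^const>\<open>Euclidean_space\<close>), and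
  \<open>d \<times> d\<close> matrices are functions vanishing outside \<open>{..<d} \<times> {..<d}\<close>.  The pair \<open>(v, A)\<close> is the
  isometry \<open>x \<mapsto> A x + v\<close>.
\<close>

type_synonym isometry = "(nat \<Rightarrow> real) \<times> (nat \<Rightarrow> nat \<Rightarrow> real)"

definition real_vectors :: "nat \<Rightarrow> (nat \<Rightarrow> real) set" where
  "real_vectors d = {v. \<forall>i\<ge>d. v i = 0}"

definition identity_matrix :: "nat \<Rightarrow> nat \<Rightarrow> nat \<Rightarrow> real" where
  "identity_matrix d = (\<lambda>i j. if i = j \<and> i < d then 1 else 0)"

definition orthogonal_matrices :: "nat \<Rightarrow> (nat \<Rightarrow> nat \<Rightarrow> real) set" where
  "orthogonal_matrices d =
    {A. (\<forall>i j. i \<ge> d \<or> j \<ge> d \<longrightarrow> A i j = 0) \<and>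
        (\<lambda>i j. \<Sum>k<d. A k i * A k j) = identity_matrix d}"

definition euclidean_group :: "nat \<Rightarrow> isometry monoid" where
  "euclidean_group d =
    \<lparr>carrier = real_vectors d \<times> orthogonal_matrices d,
     mult = (\<lambda>(v, A) (w, B).
       (\<lambda>i. v i + (\<Sum>k<d. A i k * w k), \<lambda>i j. \<Sum>k<d. A i k * B k j)),
     one = (\<lambda>i. 0, identity_matrix d)\<rparr>"

text \<open>
  Function types carry the product topology, so this is the usual topology of \<open>\<real>\<^sup>d \<rtimes> O(d)\<close> as a
  subspace of \<open>\<real>\<^sup>d \<times> \<real>\<^bsup>d \<times> d\<^esup>\<close>.
\<close>

definition euclidean_group_topology :: "nat \<Rightarrow> isometry topology" where
  "euclidean_group_topology d = top_of_set (carrier (euclidean_group d))"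

definition discrete_subgroup :: "nat \<Rightarrow> isometry set \<Rightarrow> bool" where
  "discrete_subgroup d \<Gamma> \<longleftrightarrow>
    subgroup \<Gamma> (euclidean_group d) \<and>
    subtopology (euclidean_group_topology d) \<Gamma> = discrete_topology \<Gamma>"

text \<open>The quotient topology on the space of right cosets of \<open>\<Gamma>\<close>.\<close>

definition coset_space_topology :: "nat \<Rightarrow> isometry set \<Rightarrow> isometry set topology" where
  "coset_space_topology d \<Gamma> =
    topology (\<lambda>\<U>. \<U> \<subseteq> rcosets\<^bsub>euclidean_group d\<^esub> \<Gamma> \<and>
                  openin (euclidean_group_topology d) (\<Union>\<U>))"

definition uniform_subgroup :: "nat \<Rightarrow> isometry set \<Rightarrow> bool" where
  "uniform_subgroup d \<Gamma> \<longleftrightarrow>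
    subgroup \<Gamma> (euclidean_group d) \<and> compact_space (coset_space_topology d \<Gamma>)"

definition crystallographic_group :: "nat \<Rightarrow> ('a, 'b) monoid_scheme \<Rightarrow> bool" where
  "crystallographic_group d G \<longleftrightarrow>
    group G \<and>
    (\<exists>\<Gamma>. discrete_subgroup d \<Gamma> \<and> uniform_subgroup d \<Gamma> \<and>
         G \<cong> (euclidean_group d)\<lparr>carrier := \<Gamma>\<rparr>)"

definition torsion_free_group :: "('a, 'b) monoid_scheme \<Rightarrow> bool" where
  "torsion_free_group G \<longleftrightarrow>
    (\<forall>x\<in>carrier G. \<forall>k::nat. k > 0 \<longrightarrow> x [^]\<^bsub>G\<^esub> k = \<one>\<^bsub>G\<^esub> \<longrightarrow> x = \<one>\<^bsub>G\<^esub>)"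

definition bieberbach_group :: "('a, 'b) monoid_scheme \<Rightarrow> bool" where
  "bieberbach_group G \<longleftrightarrow> (\<exists>d. crystallographic_group d G) \<and> torsion_free_group G"

end

theory Submission
  imports Defs
begin

text \<open>
  Neighbouring generators \<open>y\<^sub>i\<close>, \<open>y\<^bsub>i+1\<^esub>\<close> generate a copy of the symmetric group on
  \<open>{i, i+1, i+2}\<close>, and the triplet group \<open>L\<close> is the amalgam of these \<open>n - 2\<close> finite groups along
  the subgroups of order two generated by the \<open>y\<^sub>i\<close> with \<open>2 \<le> i \<le> n - 2\<close>.  So \<open>L\<close> acts on
  a tree.  The pure group \<open>PL\<close> meets no conjugate of these finite groups outside the identity; it
  acts freely, and it is the fundamental group of a finite graph on which the symmetric group acts.
  The vertices of the graph are the left cosets of the permutations of \<open>{i, i+1, i+2}\<close>, its edges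
  the left cosets of the permutations of \<open>{i, i+1}\<close>.  Consequently the abelianisation of \<open>PL\<close> is
  the first homology of the graph, a free abelian group whose rank is
  \<open>1 - (n - 2) n!/6 + (n - 3) n!/2 = 1 + n! (2n - 7)/6\<close>, the number of edges minus the number of
  vertices plus one.

  The proof below needs no tree and no free groups, only chains on the graph.  A path in the tree
  from the base vertex to its image under \<open>x\<close> projects to a chain on the graph; algebraically this is
  a crossed homomorphism \<open>chain\<close> on \<open>L\<close>, obtained from the presentation.  On \<open>PL\<close> it is additive and its
  values are cycles.  Two facts identify the abelianisation of \<open>PL\<close> with the integral cycles: an element
  of \<open>PL\<close> with zero chain lies in the commutator subgroup (\<open>chain_zero_imp_derived\<close>), and every real
  cycle is a combination, with its own coefficients, of the chains of certain elements of \<open>PL\<close>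
  (\<open>closed_chain_expansion\<close>).  Both rest on height functions (\<open>equivariant_height\<close>), which say how
  far a vertex of the tree lies from a chosen representative of its \<open>PL\<close>-orbit.

  The symmetric group permutes the edges and preserves their orientation, so it acts orthogonally on
  real chains and on the Euclidean space of real cycles, whose dimension is found in
  \<open>cycle_basis\<close>.  The orthogonal projection of \<open>chain x\<close> to the cycles as translation part and the
  action of the permutation of \<open>x\<close> as linear part define a homomorphism from \<open>L\<close> to the
  isometries of this space.  The action on cycles is faithful (\<open>faithful_on_cycles\<close>), so
  the kernel of the homomorphism is the commutator subgroup of \<open>PL\<close>.  Its image is discrete because
  the cycles coming from \<open>PL\<close> are integral, and cocompact because they span.  Finally \<open>y\<^sub>1\<close>
  gives an element of order two.
\<close>

section \<open>Maps out of a group given by generators and relations\<close>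

lemma words_simps [simp]:
  "[] \<in> words S"
  "(b, a) # w \<in> words S \<longleftrightarrow> a \<in> S \<and> w \<in> words S"
  "v @ w \<in> words S \<longleftrightarrow> v \<in> words S \<and> w \<in> words S"
  by (auto simp: words_def)

lemma pres_rel_words:
  assumes "(v, w) \<in> pres_rel S R"
  shows "v \<in> words S" "w \<in> words S"
  using assms by (induction) auto

lemma equiv_pres_rel: "equiv (words S) (pres_rel S R)"
  unfolding equiv_def refl_on_def sym_def trans_def
  by (meson mem_Sigma_iff pres_rel.refl pres_rel.sym pres_rel.trans pres_rel_words subrelI)

lemma pres_rel_context:
  assumes "(v, w) \<in> pres_rel S R" "x \<in> words S" "y \<in> words S"
  shows "(x @ v @ y, x @ w @ y) \<in> pres_rel S R"
  using assms
proof (induction)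
  case (refl w)
  then show ?case by (intro pres_rel.refl) auto
next
  case (sym v w)
  then show ?case by (blast intro: pres_rel.sym)
next
  case (trans u v w)
  then show ?case by (blast intro: pres_rel.trans)
next
  case (cancel u v a b)
  have "((x @ u) @ [(b, a), (\<not> b, a)] @ (v @ y), (x @ u) @ (v @ y)) \<in> pres_rel S R"
    using cancel by (intro pres_rel.cancel) auto
  then show ?case by simp
next
  case (relation u v r s)
  have "((x @ u) @ r @ (v @ y), (x @ u) @ s @ (v @ y)) \<in> pres_rel S R"
    using relation by (intro pres_rel.relation) auto
  then show ?case by simp
qed

lemma pres_rel_append:
  assumes "(u, u') \<in> pres_rel S R" "(v, v') \<in> pres_rel S R"
  shows "(u @ v, u' @ v') \<in> pres_rel S R"
proof -
  have "([] @ u @ v, [] @ u' @ v) \<in> pres_rel S R"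
    using assms pres_rel_words by (intro pres_rel_context) auto
  moreover have "(u' @ v @ [], u' @ v' @ []) \<in> pres_rel S R"
    using assms pres_rel_words by (intro pres_rel_context) auto
  ultimately show ?thesis by (auto intro: pres_rel.trans)
qed

lemma presented_group_mult:
  assumes "u \<in> words S" "v \<in> words S"
  shows "pres_rel S R `` {u} \<otimes>\<^bsub>presented_group S R\<^esub> pres_rel S R `` {v} = pres_rel S R `` {u @ v}"
proof -
  have "(\<lambda>u v. pres_rel S R `` {u @ v}) respects2 pres_rel S R"
    using equiv_class_eq[OF equiv_pres_rel] pres_rel_append
    unfolding congruent2_def by blast
  from UN_equiv_class2[OF equiv_pres_rel equiv_pres_rel this assms] show ?thesis
    by (simp add: presented_group_def)
qed

lemma presented_group_carrierE:
  assumes "x \<in> carrier (presented_group S R)"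
  obtains w where "w \<in> words S" "x = pres_rel S R `` {w}"
  using assms by (auto simp: presented_group_def elim: quotientE)

lemma class_in_presented_group:
  "w \<in> words S \<Longrightarrow> pres_rel S R `` {w} \<in> carrier (presented_group S R)"
  by (auto simp: presented_group_def intro: quotientI)

lemma class_eqI: "(v, w) \<in> pres_rel S R \<Longrightarrow> pres_rel S R `` {v} = pres_rel S R `` {w}"
  by (rule equiv_class_eq[OF equiv_pres_rel])

lemma inverse_word:
  assumes "w \<in> words S"
  shows "\<exists>v\<in>words S. (v @ w, []) \<in> pres_rel S R"
  using assms
proof (induction w)
  case Nil
  then show ?case by (auto intro!: bexI[of _ "[]"] pres_rel.refl)
next
  case (Cons l w)
  obtain b a where l: "l = (b, a)" by (cases l)
  then have "w \<in> words S" "a \<in> S" using Cons.prems by auto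
  then obtain v where v: "v \<in> words S" "(v @ w, []) \<in> pres_rel S R"
    using Cons.IH by blast
  have "(v @ [(\<not> b, a), (\<not> \<not> b, a)] @ w, v @ w) \<in> pres_rel S R"
    using Cons v l by (intro pres_rel.cancel) auto
  then have "((v @ [(\<not> b, a)]) @ l # w, []) \<in> pres_rel S R"
    using v l by (auto intro: pres_rel.trans)
  moreover have "v @ [(\<not> b, a)] \<in> words S"
    using v Cons l by auto
  ultimately show ?case by blast
qed

lemma group_presented_group: "group (presented_group S R)"
proof (rule groupI)
  let ?G = "presented_group S R"
  have one: "\<one>\<^bsub>?G\<^esub> = pres_rel S R `` {[]}" by (simp add: presented_group_def)
  have nil: "[] \<in> words S" by (simp add: words_def)
  have app: "u @ v \<in> words S" if "u \<in> words S" "v \<in> words S" for u v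
    using that by auto
  show "\<one>\<^bsub>?G\<^esub> \<in> carrier ?G" using one nil class_in_presented_group by metis
  fix x assume "x \<in> carrier ?G"
  then obtain u where u: "u \<in> words S" "x = pres_rel S R `` {u}" by (rule presented_group_carrierE)
  show "\<one>\<^bsub>?G\<^esub> \<otimes>\<^bsub>?G\<^esub> x = x"
    using u nil by (simp add: one presented_group_mult)
  obtain u' where u': "u' \<in> words S" "(u' @ u, []) \<in> pres_rel S R"
    using inverse_word[OF u(1)] by blast
  show "\<exists>y\<in>carrier ?G. y \<otimes>\<^bsub>?G\<^esub> x = \<one>\<^bsub>?G\<^esub>"
    using u u' class_eqI[OF u'(2)] class_in_presented_group[OF u'(1)]
    by (metis one presented_group_mult)
  fix y assume "y \<in> carrier ?G"
  then obtain v where v: "v \<in> words S" "y = pres_rel S R `` {v}" by (rule presented_group_carrierE)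
  show "x \<otimes>\<^bsub>?G\<^esub> y \<in> carrier ?G"
    using u v app by (simp add: presented_group_mult class_in_presented_group)
  fix z assume "z \<in> carrier ?G"
  then obtain w where w: "w \<in> words S" "z = pres_rel S R `` {w}" by (rule presented_group_carrierE)
  show "x \<otimes>\<^bsub>?G\<^esub> y \<otimes>\<^bsub>?G\<^esub> z = x \<otimes>\<^bsub>?G\<^esub> (y \<otimes>\<^bsub>?G\<^esub> z)"
    using u v w app by (simp add: presented_group_mult)
qed

lemma word_value_Nil [simp]: "word_value G f [] = \<one>\<^bsub>G\<^esub>"
  by (simp add: word_value_def)

lemma word_value_Cons [simp]:
  "word_value G f ((b, a) # w) = (if b then f a else inv\<^bsub>G\<^esub> (f a)) \<otimes>\<^bsub>G\<^esub> word_value G f w"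
  by (simp add: word_value_def)

context group
begin

lemma word_value_closed:
  assumes "f \<in> S \<rightarrow> carrier G" "w \<in> words S"
  shows "word_value G f w \<in> carrier G"
  using assms(2)
proof (induction w)
  case (Cons l w)
  obtain b a where l: "l = (b, a)" by (cases l)
  then have "f a \<in> carrier G" using Cons.prems assms(1) by auto
  then show ?case using Cons l by auto
qed simp

lemma word_value_append:
  assumes "f \<in> S \<rightarrow> carrier G" "v \<in> words S" "w \<in> words S"
  shows "word_value G f (v @ w) = word_value G f v \<otimes> word_value G f w"
  using assms(2)
proof (induction v)
  case Nil
  then show ?case using word_value_closed[OF assms(1,3)] by simp
next
  case (Cons l v)
  obtain b a where l: "l = (b, a)" by (cases l)
  have "v \<in> words S" "a \<in> S" using Cons l by auto
  moreover have "word_value G f v \<in> carrier G" "word_value G f w \<in> carrier G"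
    using assms calculation by (auto intro: word_value_closed)
  ultimately show ?case using Cons l assms by (auto simp: m_assoc Pi_iff)
qed

lemma word_value_pres_rel:
  assumes f: "f \<in> S \<rightarrow> carrier G"
    and R: "\<And>r s. (r, s) \<in> R \<Longrightarrow> word_value G f r = word_value G f s"
    and "(v, w) \<in> pres_rel S R"
  shows "word_value G f v = word_value G f w"
  using assms(3)
proof (induction)
  case (cancel u v a b)
  have ab: "[(b, a), (\<not> b, a)] \<in> words S" "[(b, a), (\<not> b, a)] @ v \<in> words S"
    using cancel by auto
  have "word_value G f [(b, a), (\<not> b, a)] = \<one>"
    using f cancel by (auto simp: Pi_iff)
  then show ?case
    using cancel ab f word_value_closed[OF f]
    by (simp add: word_value_append[OF f] del: append_Cons append_Nil word_value_Cons)
next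
  case (relation u v r s)
  then have "r @ v \<in> words S" "s @ v \<in> words S" by auto
  then show ?case using relation R[of r s] by (simp add: word_value_append[OF f])
qed auto

text \<open>
  The universal property of a presentation.  The extended map is given by an explicit formula
  because the projection to the symmetric group is defined by this formula.
\<close>

lemma induced_word_value:
  assumes f: "f \<in> S \<rightarrow> carrier G"
    and R: "\<And>r s. (r, s) \<in> R \<Longrightarrow> word_value G f r = word_value G f s"
  shows "\<And>w. w \<in> words S \<Longrightarrow> induced_map (word_value G f) (pres_rel S R `` {w}) = word_value G f w"
    and "induced_map (word_value G f) \<in> hom (presented_group S R) G"
proof -
  show eq: "induced_map (word_value G f) (pres_rel S R `` {w}) = word_value G f w"
    if "w \<in> words S" for w
  proof -
    have "(w, w) \<in> pres_rel S R" using that by (rule pres_rel.refl)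
    moreover have "word_value G f v = word_value G f w" if "(w, v) \<in> pres_rel S R" for v
      using word_value_pres_rel[OF f R that] by simp
    ultimately have "word_value G f ` (pres_rel S R `` {w}) = {word_value G f w}"
      by blast
    then show ?thesis by (simp add: induced_map_def)
  qed
  show "induced_map (word_value G f) \<in> hom (presented_group S R) G"
  proof (rule homI)
    fix x assume "x \<in> carrier (presented_group S R)"
    then obtain u where u: "u \<in> words S" "x = pres_rel S R `` {u}" by (rule presented_group_carrierE)
    show "induced_map (word_value G f) x \<in> carrier G"
      using u by (simp add: eq word_value_closed[OF f])
    fix y assume "y \<in> carrier (presented_group S R)"
    then obtain v where v: "v \<in> words S" "y = pres_rel S R `` {v}" by (rule presented_group_carrierE)
    have "u @ v \<in> words S" using u v by auto
    then show "induced_map (word_value G f) (x \<otimes>\<^bsub>presented_group S R\<^esub> y)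
        = induced_map (word_value G f) x \<otimes> induced_map (word_value G f) y"
      using u v by (simp add: presented_group_mult eq word_value_append[OF f])
  qed
qed

end

section \<open>Permutations of intervals and their cosets\<close>

definition swap :: "nat \<Rightarrow> nat \<Rightarrow> nat" where
  "swap j = Transposition.transpose j (j + 1)"

lemma swap_apply: "swap j x = (if x = j then j + 1 else if x = j + 1 then j else x)"
  by (simp add: swap_def Transposition.transpose_def)

lemma swap_involutory [simp]: "swap j \<circ> swap j = id"
  by (simp add: swap_def)

lemma permutes_swap: "a \<le> j \<Longrightarrow> j < b \<Longrightarrow> swap j permutes {a..b}"
  unfolding swap_def by (rule permutes_swap_id) auto

text \<open>
  The permutations \<open>p\<close> for which right multiplication by \<open>p\<close> preserves \<open>P\<close> are closed under
  composition, so it suffices to reach all transpositions, which is done by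
  \<open>(i k+1) = (k k+1)(i k)(k k+1)\<close>.
\<close>

lemma permutes_interval_induct [consumes 1, case_names id swap]:
  fixes a b :: nat
  assumes p: "p permutes {a..b}" and id: "P id"
    and step: "\<And>q j. q permutes {a..b} \<Longrightarrow> P q \<Longrightarrow> a \<le> j \<Longrightarrow> j < b \<Longrightarrow> P (q \<circ> swap j)"
  shows "P p"
proof -
  define K where "K = {p. p permutes {a..b} \<and> (\<forall>q. q permutes {a..b} \<longrightarrow> P q \<longrightarrow> P (q \<circ> p))}"
  have K_comp: "p \<circ> q \<in> K" if "p \<in> K" "q \<in> K" for p q
    using that permutes_compose[of _ "{a..b}"] unfolding K_def by (auto simp: comp_assoc[symmetric])
  have K_swap: "swap j \<in> K" if "a \<le> j" "j < b" for j
    using that step permutes_swap[OF that] unfolding K_def by auto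
  have K_id: "id \<in> K" unfolding K_def by (auto simp: permutes_id)
  have K_less: "Transposition.transpose i (i + Suc d) \<in> K" if "a \<le> i" "i + Suc d \<le> b" for i d
    using that
  proof (induction d)
    case 0
    then show ?case using K_swap[of i] by (simp add: swap_def)
  next
    case (Suc d)
    have "Transposition.transpose i (i + Suc (Suc d)) =
        swap (i + Suc d) \<circ> (Transposition.transpose i (i + Suc d) \<circ> swap (i + Suc d))"
      by (rule ext) (auto simp: swap_apply Transposition.transpose_def)
    moreover have "Transposition.transpose i (i + Suc d) \<in> K" "swap (i + Suc d) \<in> K"
      using Suc K_swap[of "i + Suc d"] by auto
    ultimately show ?case using K_comp by metis
  qed
  have K_transpose: "Transposition.transpose i k \<in> K" if "i \<in> {a..b}" "k \<in> {a..b}" for i k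
  proof (cases i k rule: linorder_cases)
    case less
    then show ?thesis using K_less[of i "k - Suc i"] that by auto
  next
    case equal
    then show ?thesis using K_id by simp
  next
    case greater
    then show ?thesis using K_less[of k "i - Suc k"] that by (auto simp: transpose_commute)
  qed
  have "p \<in> K"
    using p finite_atLeastAtMost
  proof (induction rule: permutes_induct)
    case id
    show ?case by (rule K_id)
  next
    case (swap i k p)
    then show ?case using K_transpose[of i k] K_comp by blast
  qed
  then have "P (id \<circ> p)" using id permutes_id unfolding K_def by blast
  then show ?thesis by simp
qed

definition perm_coset :: "'a set \<Rightarrow> ('a \<Rightarrow> 'a) \<Rightarrow> ('a \<Rightarrow> 'a) set" where
  "perm_coset S w = {w \<circ> p |p. p permutes S}"

lemma perm_coset_self: "w \<in> perm_coset S w"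
  unfolding perm_coset_def using permutes_id[of S] by (auto intro!: exI[of _ id])

lemma perm_coset_absorb:
  assumes "p permutes S"
  shows "perm_coset S (w \<circ> p) = perm_coset S w"
proof
  show "perm_coset S (w \<circ> p) \<subseteq> perm_coset S w"
    using permutes_compose[OF _ assms] unfolding perm_coset_def by (auto simp: comp_assoc)
  show "perm_coset S w \<subseteq> perm_coset S (w \<circ> p)"
  proof
    fix v assume "v \<in> perm_coset S w"
    then obtain q where q: "q permutes S" "v = w \<circ> q" unfolding perm_coset_def by blast
    have "v = (w \<circ> p) \<circ> (inv' p \<circ> q)"
      using q permutes_inverses[OF assms] by (auto simp: fun_eq_iff)
    moreover have "inv' p \<circ> q permutes S" using q assms permutes_inv permutes_compose by blast
    ultimately show "v \<in> perm_coset S (w \<circ> p)" unfolding perm_coset_def by blast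
  qed
qed

lemma perm_coset_eq_iff: "perm_coset S v = perm_coset S w \<longleftrightarrow> (\<exists>p. p permutes S \<and> v = w \<circ> p)"
proof
  assume "perm_coset S v = perm_coset S w"
  then have "v \<in> perm_coset S w" using perm_coset_self[of v S] by simp
  then show "\<exists>p. p permutes S \<and> v = w \<circ> p" unfolding perm_coset_def by blast
qed (auto simp: perm_coset_absorb)

lemma perm_coset_eqI: "v \<in> perm_coset S w \<Longrightarrow> perm_coset S v = perm_coset S w"
  by (subst perm_coset_eq_iff) (auto simp: perm_coset_def)

lemma comp_perm_coset: "(\<lambda>v. u \<circ> v) ` perm_coset S w = perm_coset S (u \<circ> w)"
  unfolding perm_coset_def by (auto simp: comp_assoc image_iff)

lemma perm_coset_fixes:
  assumes "perm_coset S v = perm_coset S w" "x \<notin> S"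
  shows "v x = w x"
  using assms by (auto simp: perm_coset_eq_iff permutes_def)

lemma card_perm_coset:
  assumes "finite S" "inj w"
  shows "card (perm_coset S w) = fact (card S)"
proof -
  have "perm_coset S w = (\<lambda>p. w \<circ> p) ` {p. p permutes S}" unfolding perm_coset_def by blast
  moreover have "inj_on (\<lambda>p. w \<circ> p) {p. p permutes S}"
    using assms(2) by (auto simp: inj_on_def fun_eq_iff)
  ultimately show ?thesis using card_permutations[OF HOL.refl assms(1)] by (simp add: card_image)
qed

text \<open>
  Lagrange's theorem for the permutations of \<open>S\<close> among the permutations of \<open>A\<close>; it gives the
  numbers of vertices and edges of the quotient graph.
\<close>

lemma card_perm_cosets:
  assumes "finite A" "S \<subseteq> A"
  shows "fact (card S) * card (perm_coset S ` {w. w permutes A}) = fact (card A)"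
proof -
  let ?C = "perm_coset S ` {w. w permutes A}"
  have sub: "\<Union>?C = {w. w permutes A}"
  proof
    show "\<Union>?C \<subseteq> {w. w permutes A}"
    proof
      fix v assume "v \<in> \<Union>?C"
      then obtain w p where "w permutes A" "p permutes S" "v = w \<circ> p"
        unfolding perm_coset_def by blast
      then show "v \<in> {w. w permutes A}"
        using permutes_compose[OF permutes_subset[OF _ assms(2)]] by blast
    qed
    show "{w. w permutes A} \<subseteq> \<Union>?C" using perm_coset_self by blast
  qed
  have "fact (card S) * card ?C = card (\<Union>?C)"
  proof (rule card_partition)
    show "finite ?C" using finite_permutations[OF assms(1)] by auto
    show "finite (\<Union>?C)" unfolding sub using finite_permutations[OF assms(1)] by auto
    fix c assume "c \<in> ?C"
    then show "card c = fact (card S)"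
      using card_perm_coset[OF finite_subset[OF assms(2,1)]] permutes_inj by auto
  next
    fix c1 c2 assume c: "c1 \<in> ?C" "c2 \<in> ?C" "c1 \<noteq> c2"
    show "c1 \<inter> c2 = {}"
    proof (rule ccontr)
      assume "c1 \<inter> c2 \<noteq> {}"
      then obtain v where "v \<in> c1" "v \<in> c2" by blast
      moreover have "perm_coset S v = c" if "v \<in> c" "c \<in> ?C" for c
        using that perm_coset_eqI by blast
      ultimately have "perm_coset S v = c1" "perm_coset S v = c2" using c by blast+
      then show False using c by blast
    qed
  qed
  then show ?thesis unfolding sub using card_permutations[OF HOL.refl assms(1)] by simp
qed

section \<open>Orthonormal bases of orthogonal complements\<close>

definition dot :: "'e set \<Rightarrow> ('e \<Rightarrow> real) \<Rightarrow> ('e \<Rightarrow> real) \<Rightarrow> real" where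
  "dot E x y = (\<Sum>e\<in>E. x e * y e)"

lemma dot_commute: "dot E x y = dot E y x"
  by (simp add: dot_def mult.commute)

lemma dot_add_left: "dot E (\<lambda>e. x e + y e) z = dot E x z + dot E y z"
  by (simp add: dot_def sum.distrib distrib_right)

lemma dot_diff_left: "dot E (\<lambda>e. x e - y e) z = dot E x z - dot E y z"
  by (simp add: dot_def sum_subtractf left_diff_distrib)

lemma dot_scale_left: "dot E (\<lambda>e. r * x e) z = r * dot E x z"
  by (simp add: dot_def sum_distrib_left mult.assoc)

lemma dot_sum_left: "dot E (\<lambda>e. \<Sum>i\<in>I. x i e) z = (\<Sum>i\<in>I. dot E (x i) z)"
  by (simp add: dot_def sum_distrib_right) (rule sum.swap)

lemmas dot_left = dot_add_left dot_diff_left dot_scale_left dot_sum_left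

lemma dot_right:
  "dot E z (\<lambda>e. x e + y e) = dot E z x + dot E z y"
  "dot E z (\<lambda>e. x e - y e) = dot E z x - dot E z y"
  "dot E z (\<lambda>e. r * x e) = r * dot E z x"
  "dot E z (\<lambda>e. \<Sum>i\<in>I. w i e) = (\<Sum>i\<in>I. dot E z (w i))"
  using dot_left by (simp_all add: dot_commute[of E z])

lemma dot_zero [simp]: "dot E (\<lambda>e. 0) x = 0" "dot E x (\<lambda>e. 0) = 0"
  by (simp_all add: dot_def)

lemma dot_cong:
  "(\<And>e. e \<in> E \<Longrightarrow> x e = x' e) \<Longrightarrow> (\<And>e. e \<in> E \<Longrightarrow> y e = y' e) \<Longrightarrow> dot E x y = dot E x' y'"
  by (simp add: dot_def)

lemma dot_self_zero:
  assumes "finite E" "dot E x x = 0" "e \<in> E"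
  shows "x e = 0"
proof -
  have "x e * x e = 0"
    using assms sum_nonneg_eq_0_iff[of E "\<lambda>e. x e * x e"] unfolding dot_def by auto
  then show ?thesis by simp
qed

definition orthonormal :: "'e set \<Rightarrow> nat \<Rightarrow> (nat \<Rightarrow> 'e \<Rightarrow> real) \<Rightarrow> bool" where
  "orthonormal E m b \<longleftrightarrow> (\<forall>k<m. \<forall>l<m. dot E (b k) (b l) = (if k = l then 1 else 0))"

definition proj :: "'e set \<Rightarrow> nat \<Rightarrow> (nat \<Rightarrow> 'e \<Rightarrow> real) \<Rightarrow> ('e \<Rightarrow> real) \<Rightarrow> 'e \<Rightarrow> real" where
  "proj E m b x = (\<lambda>e. \<Sum>k<m. dot E x (b k) * b k e)"

lemma dot_proj_basis:
  assumes "orthonormal E m b" "k < m"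
  shows "dot E (proj E m b x) (b k) = dot E x (b k)"
proof -
  have "dot E (proj E m b x) (b k) = (\<Sum>l<m. dot E x (b l) * dot E (b l) (b k))"
    by (simp add: proj_def dot_left)
  also have "\<dots> = (\<Sum>l<m. if l = k then dot E x (b l) else 0)"
    using assms by (intro sum.cong) (auto simp: orthonormal_def)
  finally show ?thesis using assms(2) by simp
qed

text \<open>
  The basis of the complement of a unit vector \<open>a\<close> consists of the images of all but the first
  of the \<open>b k\<close> under the reflection that exchanges \<open>b 0\<close> and \<open>a\<close>.  The sign condition on
  \<open>\<alpha> 0\<close> keeps the vector \<open>q\<close> defining the reflection away from \<open>0\<close>.
\<close>

lemma orthonormal_drop_unit:
  assumes on: "orthonormal E (Suc m) b"
    and unit: "(\<Sum>k<Suc m. \<alpha> k * \<alpha> k) = 1" and neg: "\<alpha> 0 \<le> 0"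
    and a_def: "a = (\<lambda>e. \<Sum>k<Suc m. \<alpha> k * b k e)"
  obtains b' where "orthonormal E m b'" "\<And>k. k < m \<Longrightarrow> dot E a (b' k) = 0"
    "\<And>k y. k < m \<Longrightarrow> (\<And>l. l < Suc m \<Longrightarrow> dot E y (b l) = 0) \<Longrightarrow> dot E y (b' k) = 0"
    "\<And>x e. proj E (Suc m) b x e = proj E m b' x e + dot E x a * a e"
proof -
  define s where "s = 1 - \<alpha> 0"
  have s: "s \<noteq> 0" using neg by (simp add: s_def)
  define q where "q = (\<lambda>e. b 0 e - a e)"
  define b' where "b' = (\<lambda>k e. b (Suc k) e + (\<alpha> (Suc k) / s) * q e)"
  have bb: "dot E (b k) (b l) = (if k = l then 1 else 0)" if "k < Suc m" "l < Suc m" for k l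
    using on that by (simp add: orthonormal_def)
  have ab: "dot E a (b k) = \<alpha> k" if "k < Suc m" for k
  proof -
    have "dot E a (b k) = (\<Sum>l<Suc m. \<alpha> l * dot E (b l) (b k))"
      by (simp only: a_def dot_left)
    also have "\<dots> = (\<Sum>l<Suc m. if l = k then \<alpha> l else 0)"
      using that by (intro sum.cong) (auto simp: bb)
    finally show ?thesis using that by simp
  qed
  have ya: "dot E y a = (\<Sum>l<Suc m. \<alpha> l * dot E y (b l))" for y
    by (simp only: a_def dot_right)
  have aa: "dot E a a = 1" using unit ab by (simp add: ya[of a])
  have qb: "dot E q (b (Suc k)) = - \<alpha> (Suc k)" if "k < m" for k
    using that by (simp add: q_def dot_left bb ab)
  have qq: "dot E q q = 2 * s"
    by (simp add: q_def dot_left dot_right bb ab aa s_def dot_commute[of E "b 0" a])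
  have qa: "dot E q a = - s"
    by (simp add: q_def dot_left aa ab s_def dot_commute[of E "b 0" a])
  have on': "orthonormal E m b'"
    unfolding orthonormal_def
  proof (intro allI impI)
    fix k l assume kl: "k < m" "l < m"
    have "dot E (b' k) (b' l) = dot E (b (Suc k)) (b (Suc l))
      + (\<alpha> (Suc l) / s) * dot E q (b (Suc k))
      + (\<alpha> (Suc k) / s) * (dot E q (b (Suc l)) + (\<alpha> (Suc l) / s) * dot E q q)"
      by (simp only: b'_def dot_left dot_right dot_commute[of E "b (Suc k)" q])
    also have "\<dots> = dot E (b (Suc k)) (b (Suc l))"
      using kl s by (simp add: qb qq field_simps)
    finally show "dot E (b' k) (b' l) = (if k = l then 1 else 0)" using kl by (simp add: bb)
  qed
  have "dot E a (b' k) = 0" if "k < m" for k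
  proof -
    have "dot E a (b' k) = dot E a (b (Suc k)) + (\<alpha> (Suc k) / s) * dot E a q"
      by (simp only: b'_def dot_right)
    then show ?thesis using that s by (simp add: ab qa dot_commute[of E a q])
  qed
  moreover have "dot E y (b' k) = 0" if "k < m" "\<And>l. l < Suc m \<Longrightarrow> dot E y (b l) = 0" for k y
  proof -
    have "dot E y a = 0" using that(2) by (simp add: ya[of y])
    moreover have "dot E y (b' k)
        = dot E y (b (Suc k)) + (\<alpha> (Suc k) / s) * (dot E y (b 0) - dot E y a)"
      by (simp only: b'_def q_def dot_right)
    ultimately show ?thesis using that by simp
  qed
  moreover have "proj E (Suc m) b x e = proj E m b' x e + dot E x a * a e" for x e
  proof -
    define w where "w = (\<lambda>k. dot E x (b k))"
    define c where "c = dot E x a"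
    have c: "c = \<alpha> 0 * w 0 + (\<Sum>k<m. \<alpha> (Suc k) * w (Suc k))"
      by (simp only: c_def a_def dot_right w_def sum.lessThan_Suc_shift o_def)
    have ae: "a e = \<alpha> 0 * b 0 e + (\<Sum>k<m. \<alpha> (Suc k) * b (Suc k) e)"
      by (simp only: a_def sum.lessThan_Suc_shift o_def)
    have al: "(\<Sum>k<m. \<alpha> (Suc k) * \<alpha> (Suc k)) = 1 - \<alpha> 0 * \<alpha> 0"
      using unit by (simp only: sum.lessThan_Suc_shift o_def)
    have "proj E m b' x e
      = (\<Sum>k<m. (w (Suc k) + (\<alpha> (Suc k) / s) * (w 0 - c)) * (b (Suc k) e + (\<alpha> (Suc k) / s) * q e))"
      by (simp only: proj_def b'_def q_def dot_right w_def c_def)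
    also have "\<dots> = (\<Sum>k<m. w (Suc k) * b (Suc k) e + ((w 0 - c) / s) * (\<alpha> (Suc k) * b (Suc k) e)
        + (q e / s) * (\<alpha> (Suc k) * w (Suc k))
        + ((w 0 - c) * q e / (s * s)) * (\<alpha> (Suc k) * \<alpha> (Suc k)))"
      using s by (intro sum.cong) (auto simp: field_simps)
    also have "\<dots> = (\<Sum>k<m. w (Suc k) * b (Suc k) e) + ((w 0 - c) / s) * (a e - \<alpha> 0 * b 0 e)
        + (q e / s) * (c - \<alpha> 0 * w 0) + ((w 0 - c) * q e / (s * s)) * (1 - \<alpha> 0 * \<alpha> 0)"
    proof -
      have "(\<Sum>k<m. \<alpha> (Suc k) * w (Suc k)) = c - \<alpha> 0 * w 0"
        "(\<Sum>k<m. \<alpha> (Suc k) * b (Suc k) e) = a e - \<alpha> 0 * b 0 e"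
        using c ae by linarith+
      then show ?thesis by (simp only: sum.distrib sum_distrib_left[symmetric] al)
    qed
    also have "\<dots> + c * a e = (\<Sum>k<m. w (Suc k) * b (Suc k) e) + w 0 * b 0 e"
    proof -
      have "1 - \<alpha> 0 * \<alpha> 0 = s * (1 + \<alpha> 0)" by (simp add: s_def algebra_simps)
      then have "((w 0 - c) / s) * (a e - \<alpha> 0 * b 0 e)
        + (q e / s) * (c - \<alpha> 0 * w 0) + ((w 0 - c) * q e / (s * s)) * (1 - \<alpha> 0 * \<alpha> 0) + c * a e
        = ((w 0 - c) * (a e - \<alpha> 0 * b 0 e) + q e * (c - \<alpha> 0 * w 0)
           + (w 0 - c) * q e * (1 + \<alpha> 0) + c * a e * s) / s"
        using s by (simp add: add_divide_distrib)
      also have "(w 0 - c) * (a e - \<alpha> 0 * b 0 e) + q e * (c - \<alpha> 0 * w 0)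
           + (w 0 - c) * q e * (1 + \<alpha> 0) + c * a e * s = s * (w 0 * b 0 e)"
        unfolding q_def s_def by (simp add: algebra_simps)
      finally show ?thesis using s by simp
    qed
    also have "\<dots> = proj E (Suc m) b x e"
      by (simp only: proj_def w_def sum.lessThan_Suc_shift o_def)
    finally show ?thesis by (simp add: c_def)
  qed
  ultimately show ?thesis using that on' by blast
qed

text \<open>
  Rank and nullity at once: each further independent condition costs one dimension, because its
  component orthogonal to the earlier ones does not vanish.  For this the induction keeps track of
  where the residual of the projection lies.
\<close>

lemma orthonormal_complement_aux:
  fixes a :: "'j \<Rightarrow> 'e \<Rightarrow> real"
  assumes E: "finite E" and "finite J"
    and "\<And>t. (\<And>e. e \<in> E \<Longrightarrow> (\<Sum>j\<in>J. t j * a j e) = 0) \<Longrightarrow> (\<And>j. j \<in> J \<Longrightarrow> t j = 0)"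
  shows "\<exists>m b. m + card J = card E \<and> orthonormal E m b \<and> (\<forall>k<m. \<forall>j\<in>J. dot E (a j) (b k) = 0) \<and>
    (\<forall>x. \<exists>t. \<forall>e\<in>E. x e - proj E m b x e = (\<Sum>j\<in>J. t j * a j e))"
  using assms(2,3)
proof (induction J rule: finite_induct)
  case empty
  obtain f where f: "bij_betw f {..<card E} E"
    using ex_bij_betw_nat_finite[OF E] by (auto simp: atLeast0LessThan)
  define b where "b = (\<lambda>k e. if e = f k then 1 else 0 :: real)"
  have dot_b: "dot E x (b k) = x (f k)" if "k < card E" for x k
  proof -
    have "dot E x (b k) = (\<Sum>e\<in>E. if e = f k then x e else 0)"
      unfolding dot_def b_def by (intro sum.cong) auto
    then show ?thesis using E bij_betwE[OF f] that by auto
  qed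
  have "orthonormal E (card E) b"
    using f by (auto simp: orthonormal_def dot_b) (auto simp: b_def bij_betw_def inj_on_def)
  moreover have "proj E (card E) b x e = x e" if "e \<in> E" for x e
  proof -
    have "proj E (card E) b x e = (\<Sum>k<card E. x (f k) * b k e)"
      unfolding proj_def by (intro sum.cong) (auto simp: dot_b)
    also have "\<dots> = (\<Sum>e'\<in>E. x e' * (if e = e' then 1 else 0))"
      unfolding b_def by (rule sum.reindex_bij_betw[OF f])
    also have "\<dots> = (\<Sum>e'\<in>E. if e = e' then x e' else 0)"
      by (intro sum.cong) auto
    finally show ?thesis using E that by simp
  qed
  ultimately show ?case by (intro exI[of _ "card E"] exI[of _ b]) auto
next
  case (insert i J)
  have "t j = 0" if t: "\<And>e. e \<in> E \<Longrightarrow> (\<Sum>j\<in>J. t j * a j e) = 0" and "j \<in> J" for t j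
  proof -
    have "(\<Sum>j\<in>insert i J. (t(i := 0)) j * a j e) = 0" if "e \<in> E" for e
    proof -
      have "(\<Sum>j\<in>J. (t(i := 0)) j * a j e) = (\<Sum>j\<in>J. t j * a j e)"
        using insert.hyps by (intro sum.cong) auto
      then show ?thesis using insert.hyps t[OF that] by simp
    qed
    from insert.prems[OF this, of j] show ?thesis
      using \<open>j \<in> J\<close> insert.hyps by (cases "j = i") auto
  qed
  then obtain m b where m: "m + card J = card E" and on: "orthonormal E m b"
    and perp: "\<And>k j. k < m \<Longrightarrow> j \<in> J \<Longrightarrow> dot E (a j) (b k) = 0"
    and res: "\<And>x. \<exists>t. \<forall>e\<in>E. x e - proj E m b x e = (\<Sum>j\<in>J. t j * a j e)"
    using insert.IH by blast
  define \<beta> where "\<beta> = (\<lambda>k. dot E (a i) (b k))"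
  obtain t where t: "\<And>e. e \<in> E \<Longrightarrow> a i e - proj E m b (a i) e = (\<Sum>j\<in>J. t j * a j e)"
    using res by blast
  have "\<exists>k<m. \<beta> k \<noteq> 0"
  proof (rule ccontr)
    assume "\<not> (\<exists>k<m. \<beta> k \<noteq> 0)"
    then have z: "a i e = (\<Sum>j\<in>J. t j * a j e)" if "e \<in> E" for e
      using t[OF that] by (simp add: proj_def \<beta>_def)
    have "(\<Sum>j\<in>insert i J. (t(i := -1)) j * a j e) = 0" if "e \<in> E" for e
    proof -
      have "(\<Sum>j\<in>J. (t(i := -1)) j * a j e) = (\<Sum>j\<in>J. t j * a j e)"
        using insert.hyps by (intro sum.cong) auto
      then show ?thesis using insert.hyps z[OF that] by simp
    qed
    from insert.prems[OF this, of i] show False by simp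
  qed
  then obtain k0 where k0: "k0 < m" "\<beta> k0 \<noteq> 0" by blast
  then obtain m' where m': "m = Suc m'" by (cases m) auto
  define r where "r = (\<Sum>k<m. \<beta> k * \<beta> k)"
  have r: "r > 0"
    unfolding r_def using k0 by (intro sum_pos2[of _ k0]) (auto simp: zero_less_mult_iff)
  \<comment> \<open>normalises the component, with the sign needed to reflect the first basis vector to it\<close>
  define \<sigma> where "\<sigma> = (if \<beta> 0 \<le> 0 then 1 else -1) / sqrt r"
  have \<sigma>: "\<sigma> * \<sigma> * r = 1" "\<sigma> \<noteq> 0" "\<sigma> * \<beta> 0 \<le> 0"
    using r by (auto simp: \<sigma>_def mult_le_0_iff divide_le_0_iff)
  define c where "c = (\<lambda>e. \<Sum>k<Suc m'. (\<sigma> * \<beta> k) * b k e)"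
  have c: "c e = \<sigma> * proj E m b (a i) e" for e
    by (simp only: c_def proj_def \<beta>_def m' sum_distrib_left mult.assoc)
  have unit: "(\<Sum>k<Suc m'. \<sigma> * \<beta> k * (\<sigma> * \<beta> k)) = 1"
  proof -
    have "(\<Sum>k<Suc m'. \<sigma> * \<beta> k * (\<sigma> * \<beta> k)) = \<sigma> * \<sigma> * r"
      unfolding r_def m' sum_distrib_left by (intro sum.cong) auto
    then show ?thesis using \<sigma> by simp
  qed
  obtain b' where b': "orthonormal E m' b'" "\<And>k. k < m' \<Longrightarrow> dot E c (b' k) = 0"
    "\<And>k y. k < m' \<Longrightarrow> (\<And>l. l < Suc m' \<Longrightarrow> dot E y (b l) = 0) \<Longrightarrow> dot E y (b' k) = 0"
    "\<And>x e. proj E (Suc m') b x e = proj E m' b' x e + dot E x c * c e"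
    using orthonormal_drop_unit[OF on[unfolded m'] unit \<sigma>(3) c_def] by blast
  have perp': "dot E (a j) (b' k) = 0" if "k < m'" "j \<in> insert i J" for k j
  proof (cases "j = i")
    case True
    have "dot E (\<lambda>e. a i e - proj E m b (a i) e) (b' k) = 0"
      using b'(3)[OF that(1), of "\<lambda>e. a i e - proj E m b (a i) e"] dot_proj_basis[OF on]
      by (simp add: dot_left m')
    moreover have "dot E (proj E m b (a i)) (b' k) = 0"
    proof -
      have "c = (\<lambda>e. \<sigma> * proj E m b (a i) e)" using c by blast
      then have "dot E c (b' k) = \<sigma> * dot E (proj E m b (a i)) (b' k)"
        by (simp only: dot_left)
      then show ?thesis using b'(2)[OF that(1)] \<sigma> by simp
    qed
    ultimately show ?thesis using True by (simp add: dot_left)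
  next
    case False
    then have "dot E (a j) (b l) = 0" if "l < Suc m'" for l
      using that perp[of l j] m' \<open>j \<in> insert i J\<close> by auto
    then show ?thesis using b'(3)[OF that(1)] by blast
  qed
  have "\<exists>u. \<forall>e\<in>E. x e - proj E m' b' x e = (\<Sum>j\<in>insert i J. u j * a j e)" for x
  proof -
    obtain v where v: "\<And>e. e \<in> E \<Longrightarrow> x e - proj E m b x e = (\<Sum>j\<in>J. v j * a j e)"
      using res by blast
    define \<rho> where "\<rho> = dot E x c * \<sigma>"
    have "x e - proj E m' b' x e
        = (\<Sum>j\<in>insert i J. ((\<lambda>j. v j - \<rho> * t j)(i := \<rho>)) j * a j e)" if "e \<in> E" for e
    proof -
      have "x e - proj E m' b' x e = (x e - proj E m b x e) + \<rho> * proj E m b (a i) e"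
        using b'(4)[of x e] by (simp add: m' c \<rho>_def)
      also have "\<dots> = (\<Sum>j\<in>J. v j * a j e) + \<rho> * (a i e - (\<Sum>j\<in>J. t j * a j e))"
        using v[OF that] t[OF that] by simp
      also have "\<dots> = \<rho> * a i e + (\<Sum>j\<in>J. (v j - \<rho> * t j) * a j e)"
        by (simp add: sum_subtractf sum_distrib_left algebra_simps)
      also have "(\<Sum>j\<in>J. (v j - \<rho> * t j) * a j e)
          = (\<Sum>j\<in>J. ((\<lambda>j. v j - \<rho> * t j)(i := \<rho>)) j * a j e)"
        using insert.hyps by (intro sum.cong) auto
      finally show ?thesis using insert.hyps by simp
    qed
    then show ?thesis by blast
  qed
  moreover have "m' + card (insert i J) = card E" using m m' insert.hyps by simp
  ultimately show ?case using b'(1) perp' by blast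
qed

text \<open>
  A vector orthogonal to all conditions has a residual that is orthogonal to them and also a
  combination of them, hence zero.
\<close>

lemma orthonormal_complement:
  fixes a :: "'j \<Rightarrow> 'e \<Rightarrow> real"
  assumes E: "finite E" and J: "finite J"
    and indep: "\<And>t. (\<And>e. e \<in> E \<Longrightarrow> (\<Sum>j\<in>J. t j * a j e) = 0) \<Longrightarrow> (\<And>j. j \<in> J \<Longrightarrow> t j = 0)"
  obtains m b where "m + card J = card E" "orthonormal E m b" "\<And>k e. e \<notin> E \<Longrightarrow> b k e = 0"
    "\<And>k j. k < m \<Longrightarrow> j \<in> J \<Longrightarrow> dot E (a j) (b k) = 0"
    "\<And>x e. (\<And>j. j \<in> J \<Longrightarrow> dot E (a j) x = 0) \<Longrightarrow> e \<in> E \<Longrightarrow> x e = proj E m b x e"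
proof -
  obtain m b where m: "m + card J = card E" and on: "orthonormal E m b"
    and perp: "\<And>k j. k < m \<Longrightarrow> j \<in> J \<Longrightarrow> dot E (a j) (b k) = 0"
    and res: "\<And>x. \<exists>t. \<forall>e\<in>E. x e - proj E m b x e = (\<Sum>j\<in>J. t j * a j e)"
    using orthonormal_complement_aux[OF E J, of a] indep by blast
  have expand: "x e = proj E m b x e" if x: "\<And>j. j \<in> J \<Longrightarrow> dot E (a j) x = 0" and e: "e \<in> E" for x e
  proof -
    define y where "y = (\<lambda>e. x e - proj E m b x e)"
    obtain t where t: "\<And>e. e \<in> E \<Longrightarrow> y e = (\<Sum>j\<in>J. t j * a j e)"
      using res unfolding y_def by blast
    have "dot E (a j) y = 0" if "j \<in> J" for j
    proof -
      have "dot E (a j) (proj E m b x) = 0"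
        using perp that by (simp add: proj_def dot_right)
      then show ?thesis using x[OF that] by (simp add: y_def dot_right)
    qed
    then have "dot E (\<lambda>e. \<Sum>j\<in>J. t j * a j e) y = 0" by (simp add: dot_left)
    moreover have "dot E y y = dot E (\<lambda>e. \<Sum>j\<in>J. t j * a j e) y"
      using t by (intro dot_cong) auto
    ultimately show ?thesis using dot_self_zero[OF E _ e, of y] by (simp add: y_def)
  qed
  define b' where "b' = (\<lambda>k e. if e \<in> E then b k e else 0)"
  have dot_b': "dot E x (b' k) = dot E x (b k)" for x k
    by (intro dot_cong) (auto simp: b'_def)
  have "orthonormal E m b'"
    using on unfolding orthonormal_def dot_b' dot_commute[of E "b' _"] by (simp add: dot_commute)
  moreover have "proj E m b' x e = proj E m b x e" if "e \<in> E" for x e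
    using that by (simp add: proj_def dot_b') (simp add: b'_def)
  ultimately show ?thesis
    using m perp expand by (intro that[of m b']) (auto simp: dot_b', simp add: b'_def)
qed

section \<open>The triplet group and its action on the symmetric group\<close>

locale triplet =
  fixes n :: nat
  assumes n_ge_4: "4 \<le> n"
begin

abbreviation L :: "nat word set monoid" where "L \<equiv> triplet_group n"
abbreviation \<pi> :: "nat word set \<Rightarrow> nat \<Rightarrow> nat" where "\<pi> \<equiv> triplet_perm n"
abbreviation PL :: "nat word set set" where "PL \<equiv> pure_triplet n"
abbreviation DPL :: "nat word set set" where "DPL \<equiv> pure_triplet_derived n"

definition gen :: "nat \<Rightarrow> nat word set" where
  "gen j = pres_rel {1..n - 1} (triplet_relations n) `` {[(True, j)]}"

sublocale L: group L
  unfolding triplet_group_def by (rule group_presented_group)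

lemma gen_closed [simp]: "1 \<le> j \<Longrightarrow> j < n \<Longrightarrow> gen j \<in> carrier L"
  unfolding gen_def triplet_group_def by (rule class_in_presented_group) auto

lemma class_mult:
  assumes "u \<in> words {1..n - 1}" "v \<in> words {1..n - 1}"
  shows "pres_rel {1..n - 1} (triplet_relations n) `` {u} \<otimes>\<^bsub>L\<^esub> pres_rel {1..n - 1} (triplet_relations n) `` {v}
    = pres_rel {1..n - 1} (triplet_relations n) `` {u @ v}"
  using presented_group_mult[OF assms] by (simp add: triplet_group_def)

lemma class_eq_relation:
  assumes "(r, s) \<in> triplet_relations n" "r \<in> words {1..n - 1}" "s \<in> words {1..n - 1}"
  shows "pres_rel {1..n - 1} (triplet_relations n) `` {r} = pres_rel {1..n - 1} (triplet_relations n) `` {s}"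
  using pres_rel.relation[of "[]" _ "[]", OF _ _ assms] by (intro class_eqI) auto

lemma gen_square:
  assumes "1 \<le> j" "j < n"
  shows "gen j \<otimes>\<^bsub>L\<^esub> gen j = \<one>\<^bsub>L\<^esub>"
proof -
  have "gen j \<otimes>\<^bsub>L\<^esub> gen j = pres_rel {1..n - 1} (triplet_relations n) `` {[(True, j), (True, j)]}"
    unfolding gen_def using assms by (subst class_mult) auto
  also have "\<dots> = pres_rel {1..n - 1} (triplet_relations n) `` {[]}"
    using assms by (intro class_eq_relation) (auto simp: triplet_relations_def)
  finally show ?thesis by (simp add: triplet_group_def presented_group_def)
qed

lemma gen_inv: "1 \<le> j \<Longrightarrow> j < n \<Longrightarrow> inv\<^bsub>L\<^esub> gen j = gen j"
  by (rule L.inv_equality) (auto simp: gen_square)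

lemma gen_cancel [simp]:
  "1 \<le> j \<Longrightarrow> j < n \<Longrightarrow> x \<in> carrier L \<Longrightarrow> x \<otimes>\<^bsub>L\<^esub> gen j \<otimes>\<^bsub>L\<^esub> gen j = x"
  by (simp add: L.m_assoc gen_square)

lemma gen_braid:
  assumes "1 \<le> i" "i + 1 < n"
  shows "gen i \<otimes>\<^bsub>L\<^esub> gen (i + 1) \<otimes>\<^bsub>L\<^esub> gen i = gen (i + 1) \<otimes>\<^bsub>L\<^esub> gen i \<otimes>\<^bsub>L\<^esub> gen (i + 1)"
proof -
  have rel: "([(True, i), (True, i + 1), (True, i)], [(True, i + 1), (True, i), (True, i + 1)])
      \<in> triplet_relations n"
    using assms by (auto simp: triplet_relations_def)
  have "gen a \<otimes>\<^bsub>L\<^esub> gen b \<otimes>\<^bsub>L\<^esub> gen a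
      = pres_rel {1..n - 1} (triplet_relations n) `` {[(True, a), (True, b), (True, a)]}"
    if "a \<in> {1..n - 1}" "b \<in> {1..n - 1}" for a b
    unfolding gen_def using that by (subst class_mult, simp, simp)+ simp
  moreover have "i \<in> {1..n - 1}" "i + 1 \<in> {1..n - 1}" using assms by auto
  ultimately show ?thesis
    using class_eq_relation[of "[(True, i), (True, i + 1), (True, i)]"
        "[(True, i + 1), (True, i), (True, i + 1)]"] rel by simp
qed

text \<open>
  The class of a formal inverse of a generator is the class of the generator, so every element is
  reached by multiplying with generators on the right.
\<close>

lemma L_induct [consumes 1, case_names one step]:
  assumes "x \<in> carrier L" "P \<one>\<^bsub>L\<^esub>"
    and step: "\<And>x j. x \<in> carrier L \<Longrightarrow> P x \<Longrightarrow> 1 \<le> j \<Longrightarrow> j < n \<Longrightarrow> P (x \<otimes>\<^bsub>L\<^esub> gen j)"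
  shows "P x"
proof -
  let ?cls = "\<lambda>w. pres_rel {1..n - 1} (triplet_relations n) `` {w}"
  obtain w where w: "w \<in> words {1..n - 1}" "x = ?cls w"
    using assms(1) unfolding triplet_group_def by (rule presented_group_carrierE)
  have closed: "?cls w \<in> carrier L" if "w \<in> words {1..n - 1}" for w
    unfolding triplet_group_def using that by (rule class_in_presented_group)
  have one: "\<one>\<^bsub>L\<^esub> = ?cls []" by (simp add: triplet_group_def presented_group_def)
  have "P (?cls w)"
    using w(1)
  proof (induction w rule: rev_induct)
    case Nil
    show ?case using assms(2) by (simp add: one)
  next
    case (snoc l w)
    obtain b j where l: "l = (b, j)" by (cases l)
    then have j: "1 \<le> j" "j < n" "w \<in> words {1..n - 1}" using snoc.prems n_ge_4 by auto
    have letter: "?cls [(b, j)] = gen j"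
    proof (cases b)
      case False
      have "([] @ [(False, j), (\<not> False, j)] @ [], [] @ []) \<in> pres_rel {1..n - 1} (triplet_relations n)"
        using j by (intro pres_rel.cancel) auto
      then have "?cls [(False, j)] \<otimes>\<^bsub>L\<^esub> gen j = \<one>\<^bsub>L\<^esub>"
        unfolding gen_def one using j by (subst class_mult) (auto dest: class_eqI)
      then have "inv\<^bsub>L\<^esub> gen j = ?cls [(False, j)]"
        using j closed[of "[(False, j)]"] by (intro L.inv_equality) auto
      then show ?thesis using False j by (simp add: gen_inv)
    qed (simp add: gen_def)
    have "?cls (w @ [l]) = ?cls w \<otimes>\<^bsub>L\<^esub> gen j"
      unfolding letter[symmetric] using l j by (subst class_mult) auto
    then show ?case using step[of "?cls w" j] closed snoc.IH j by simp
  qed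
  then show ?thesis using w by simp
qed

text \<open>
  The braid relation is bracketed to the right because \<^const>\<open>word_value\<close> evaluates words from
  the right.
\<close>

lemma universal_property:
  assumes G: "group G" and f: "\<And>j. 1 \<le> j \<Longrightarrow> j < n \<Longrightarrow> f j \<in> carrier G"
    and sq: "\<And>j. 1 \<le> j \<Longrightarrow> j < n \<Longrightarrow> f j \<otimes>\<^bsub>G\<^esub> f j = \<one>\<^bsub>G\<^esub>"
    and braid: "\<And>i. 1 \<le> i \<Longrightarrow> i + 1 < n \<Longrightarrow>
      f i \<otimes>\<^bsub>G\<^esub> (f (i + 1) \<otimes>\<^bsub>G\<^esub> f i) = f (i + 1) \<otimes>\<^bsub>G\<^esub> (f i \<otimes>\<^bsub>G\<^esub> f (i + 1))"
  shows "induced_map (word_value G f) \<in> hom L G"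
    and "\<And>j. 1 \<le> j \<Longrightarrow> j < n \<Longrightarrow> induced_map (word_value G f) (gen j) = f j"
proof -
  interpret G: group G by (rule G)
  have fS: "f \<in> {1..n - 1} \<rightarrow> carrier G" using f n_ge_4 by auto
  have R: "word_value G f r = word_value G f s" if "(r, s) \<in> triplet_relations n" for r s
    using that unfolding triplet_relations_def
  proof (elim UnE CollectE exE conjE)
    fix j assume "(r, s) = ([(True, j), (True, j)], [])" "1 \<le> j" "j \<le> n - 1"
    then show ?thesis using f[of j] sq[of j] n_ge_4 by auto
  next
    fix i assume "(r, s) = ([(True, i), (True, i + 1), (True, i)],
        [(True, i + 1), (True, i), (True, i + 1)])" "1 \<le> i" "i \<le> n - 2"
    then show ?thesis using f[of i] f[of "i + 1"] braid[of i] n_ge_4 by auto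
  qed
  show "induced_map (word_value G f) \<in> hom L G"
    unfolding triplet_group_def by (rule G.induced_word_value(2)[OF fS R])
  show "induced_map (word_value G f) (gen j) = f j" if "1 \<le> j" "j < n" for j
  proof -
    have "[(True, j)] \<in> words {1..n - 1}" using that by auto
    from G.induced_word_value(1)[OF fS R this] show ?thesis
      using f[OF that] by (simp add: gen_def)
  qed
qed

lemma swap_permutes: "1 \<le> j \<Longrightarrow> j < n \<Longrightarrow> swap j permutes {1..n}"
  by (rule permutes_swap)

lemma triplet_perm_properties: "\<pi> \<in> hom L (sym_group n)" "1 \<le> j \<Longrightarrow> j < n \<Longrightarrow> \<pi> (gen j) = swap j"
proof -
  have perm: "\<pi> = induced_map (word_value (sym_group n) swap)"
    unfolding triplet_perm_def swap_def ..
  have closed: "swap j \<in> carrier (sym_group n)" if "1 \<le> j" "j < n" for j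
    using swap_permutes[OF that] by (simp add: sym_group_carrier)
  have sq: "swap j \<otimes>\<^bsub>sym_group n\<^esub> swap j = \<one>\<^bsub>sym_group n\<^esub>"
    if "1 \<le> j" "j < n" for j
    by (simp add: sym_group_mult sym_group_one)
  have braid: "swap i \<otimes>\<^bsub>sym_group n\<^esub> (swap (i + 1) \<otimes>\<^bsub>sym_group n\<^esub> swap i)
    = swap (i + 1) \<otimes>\<^bsub>sym_group n\<^esub> (swap i \<otimes>\<^bsub>sym_group n\<^esub> swap (i + 1))"
    if "1 \<le> i" "i + 1 < n" for i
    unfolding sym_group_mult by (rule ext) (auto simp: swap_apply)
  note * = universal_property[OF sym_group_is_group, of swap n]
  show "\<pi> \<in> hom L (sym_group n)" unfolding perm by (rule *(1); (rule closed sq braid)?; assumption)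
  show "\<pi> (gen j) = swap j" if "1 \<le> j" "j < n"
    unfolding perm using that by (intro *(2)) (rule closed sq braid; assumption)+
qed

lemma \<pi>_gen [simp]: "1 \<le> j \<Longrightarrow> j < n \<Longrightarrow> \<pi> (gen j) = swap j"
  by (rule triplet_perm_properties)

sublocale \<pi>: group_hom L "sym_group n" \<pi>
  using triplet_perm_properties(1) sym_group_is_group L.group_axioms
  by (simp add: group_hom_def group_hom_axioms_def)

lemma \<pi>_permutes: "x \<in> carrier L \<Longrightarrow> \<pi> x permutes {1..n}"
  using \<pi>.hom_closed by (simp add: sym_group_carrier)

declare sym_group_mult [simp] sym_group_one [simp]

lemma \<pi>_surj:
  assumes "p permutes {1..n}"
  shows "\<exists>x\<in>carrier L. \<pi> x = p"
  using assms
proof (induction rule: permutes_interval_induct)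
  case id
  show ?case by (intro bexI[of _ "\<one>\<^bsub>L\<^esub>"]) auto
next
  case (swap q j)
  then obtain x where "x \<in> carrier L" "\<pi> x = q" by blast
  then show ?case using swap by (intro bexI[of _ "x \<otimes>\<^bsub>L\<^esub> gen j"]) auto
qed

lemma PL_iff: "x \<in> PL \<longleftrightarrow> x \<in> carrier L \<and> \<pi> x = id"
  by (simp add: pure_triplet_def kernel_def sym_group_one)

lemma PL_carrier: "x \<in> PL \<Longrightarrow> x \<in> carrier L"
  by (simp add: PL_iff)

lemma PL_normal: "PL \<lhd> L"
  unfolding pure_triplet_def by (rule \<pi>.normal_kernel)

lemma PL_subgroup: "subgroup PL L"
  using PL_normal by (rule normal_imp_subgroup)

lemma same_\<pi>:
  assumes "x \<in> carrier L" "y \<in> carrier L" "\<pi> x = \<pi> y"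
  shows "\<exists>p\<in>PL. y = p \<otimes>\<^bsub>L\<^esub> x"
proof
  show "y = (y \<otimes>\<^bsub>L\<^esub> inv\<^bsub>L\<^esub> x) \<otimes>\<^bsub>L\<^esub> x" using assms by (simp add: L.m_assoc)
  have "\<pi> (y \<otimes>\<^bsub>L\<^esub> inv\<^bsub>L\<^esub> x) = \<pi> (x \<otimes>\<^bsub>L\<^esub> inv\<^bsub>L\<^esub> x)"
    using assms by (metis L.inv_closed \<pi>.hom_mult)
  then show "y \<otimes>\<^bsub>L\<^esub> inv\<^bsub>L\<^esub> x \<in> PL" using assms by (simp add: PL_iff)
qed

text \<open>
  This is how functions on \<open>L\<close> become functions on the vertices and edges of a quotient of the
  tree on which \<open>L\<close> acts.
\<close>

lemma depends_on_coset:
  fixes F :: "nat word set \<Rightarrow> 'x"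
  assumes ab: "1 \<le> a" "b \<le> n"
    and left: "\<And>p x. p \<in> PL \<Longrightarrow> x \<in> carrier L \<Longrightarrow> F (p \<otimes>\<^bsub>L\<^esub> x) = F x"
    and right: "\<And>x j. x \<in> carrier L \<Longrightarrow> a \<le> j \<Longrightarrow> j < b \<Longrightarrow> F (x \<otimes>\<^bsub>L\<^esub> gen j) = F x"
    and xy: "x \<in> carrier L" "y \<in> carrier L"
    and eq: "perm_coset {a..b} (\<pi> x) = perm_coset {a..b} (\<pi> y)"
  shows "F x = F y"
proof -
  obtain p where p: "p permutes {a..b}" "\<pi> x = \<pi> y \<circ> p"
    using eq by (auto simp: perm_coset_eq_iff)
  have "F x = F y" if "x \<in> carrier L" "\<pi> x = \<pi> y \<circ> p" for x
    using p(1) that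
  proof (induction arbitrary: x rule: permutes_interval_induct)
    case id
    then have "\<pi> y = \<pi> x" by simp
    then show ?case using same_\<pi>[OF xy(2) id(1)] left xy(2) by auto
  next
    case (swap q j)
    have j: "1 \<le> j" "j < n" using swap ab by auto
    have "\<pi> (x \<otimes>\<^bsub>L\<^esub> gen j) = \<pi> y \<circ> q"
    proof -
      have "\<pi> (x \<otimes>\<^bsub>L\<^esub> gen j) = \<pi> y \<circ> (q \<circ> (swap j \<circ> swap j))"
        using swap.prems(1) j by (simp only: \<pi>.hom_mult gen_closed \<pi>_gen swap.prems(2)
          sym_group_mult comp_assoc)
      then show ?thesis by simp
    qed
    then have "F (x \<otimes>\<^bsub>L\<^esub> gen j) = F y" using swap.IH[of "x \<otimes>\<^bsub>L\<^esub> gen j"] swap.prems j by simp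
    then show ?case using right[of x j] swap by simp
  qed
  then show ?thesis using xy p by blast
qed

end

section \<open>The quotient graph and its chains\<close>

type_synonym cell = "nat \<times> (nat \<Rightarrow> nat) set"

text \<open>
  The edge \<open>i\<close> at \<open>w\<close> leads from the vertex \<open>i - 1\<close> at \<open>w\<close> to the vertex \<open>i\<close> at \<open>w\<close>.  A coset of the
  permutations of \<open>{i..i + 1}\<close> lies in exactly one coset of the larger group belonging to either
  vertex, and the union in the definitions of \<open>head\<close> and \<open>tail\<close> produces that coset.
\<close>

definition edge :: "nat \<Rightarrow> (nat \<Rightarrow> nat) \<Rightarrow> cell" where
  "edge i w = (i, perm_coset {i..i + 1} w)"

definition vert :: "nat \<Rightarrow> (nat \<Rightarrow> nat) \<Rightarrow> cell" where
  "vert i w = (i, perm_coset {i..i + 2} w)"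

definition head :: "cell \<Rightarrow> cell" where
  "head = (\<lambda>(i, C). (i, \<Union>w\<in>C. perm_coset {i..i + 2} w))"

definition tail :: "cell \<Rightarrow> cell" where
  "tail = (\<lambda>(i, C). (i - 1, \<Union>w\<in>C. perm_coset {i - 1..i + 1} w))"

definition move :: "(nat \<Rightarrow> nat) \<Rightarrow> cell \<Rightarrow> cell" where
  "move p = (\<lambda>(i, C). (i, (\<lambda>w. p \<circ> w) ` C))"

definition act :: "(nat \<Rightarrow> nat) \<Rightarrow> (cell \<Rightarrow> 'a) \<Rightarrow> cell \<Rightarrow> 'a" where
  "act p f = (\<lambda>e. f (move (inv' p) e))"

text \<open>
  The chain of the path that runs from \<open>vert 1 w\<close> to \<open>vert m w\<close> along the edges \<open>2, \<dots>, m\<close> at \<open>w\<close>.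
\<close>

definition walk :: "nat \<Rightarrow> (nat \<Rightarrow> nat) \<Rightarrow> cell \<Rightarrow> int" where
  "walk m w = (\<lambda>e. \<Sum>i=2..m. of_bool (e = edge i w))"

lemma edge_swap: "edge i (w \<circ> swap i) = edge i w"
  unfolding edge_def by (simp add: perm_coset_absorb permutes_swap)

lemma vert_swap: "j = i \<or> j = i + 1 \<Longrightarrow> vert i (w \<circ> swap j) = vert i w"
  unfolding vert_def by (auto simp: perm_coset_absorb permutes_swap)

lemma Union_perm_coset:
  assumes "T \<subseteq> S"
  shows "(\<Union>v\<in>perm_coset T w. perm_coset S v) = perm_coset S w"
proof -
  have "perm_coset S v = perm_coset S w" if "v \<in> perm_coset T w" for v
    using that permutes_subset[OF _ assms] unfolding perm_coset_def[of T]
    by (auto simp: perm_coset_absorb)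
  then show ?thesis using perm_coset_self[of w T] by blast
qed

lemma head_edge: "head (edge i w) = vert i w"
  by (simp add: head_def edge_def vert_def Union_perm_coset)

lemma tail_edge: "1 \<le> i \<Longrightarrow> tail (edge i w) = vert (i - 1) w"
  by (simp add: tail_def edge_def vert_def Union_perm_coset)

lemma move_edge: "move p (edge i w) = edge i (p \<circ> w)"
  by (simp add: move_def edge_def comp_perm_coset)

lemma move_vert: "move p (vert i w) = vert i (p \<circ> w)"
  by (simp add: move_def vert_def comp_perm_coset)

lemma move_comp: "move (p \<circ> q) e = move p (move q e)"
  by (auto simp: move_def comp_assoc image_iff split: prod.split)

lemma move_id [simp]: "move id e = e"
  by (simp add: move_def split: prod.split)

lemma move_inv:
  assumes "p permutes S"
  shows "move (inv' p) (move p e) = e" "move p (move (inv' p) e) = e"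
  using permutes_inv_o[OF assms] by (simp_all flip: move_comp)

lemma act_comp:
  assumes "p permutes S" "q permutes S"
  shows "act (p \<circ> q) f = act p (act q f)"
  unfolding act_def using assms
  by (simp add: permutes_bij o_inv_distrib[OF permutes_bij permutes_bij] move_comp)

lemma act_id [simp]: "act id f = f"
  by (simp add: act_def)

lemma act_walk:
  assumes "p permutes S"
  shows "act p (walk m w) = walk m (p \<circ> w)"
proof -
  have "move (inv' p) e = edge i w \<longleftrightarrow> e = edge i (p \<circ> w)" for e i
    using move_inv[OF assms] by (metis move_edge)
  then show ?thesis by (simp add: act_def walk_def)
qed

lemma walk_step: "1 \<le> m \<Longrightarrow> walk (m + 1) w = (\<lambda>e. walk m w e + of_bool (e = edge (m + 1) w))"
  by (simp add: walk_def)

lemma walk_trivial: "m \<le> 1 \<Longrightarrow> walk m w = (\<lambda>e. 0)"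
  by (simp add: walk_def)

text \<open>
  The reflection \<open>swap j\<close> fixes both ends of the edge \<open>j\<close>, so it does not matter which end
  a walk goes to before it is reflected.
\<close>

lemma walk_diff_swap:
  assumes "1 \<le> j"
  shows "walk (j - 1) w e - walk (j - 1) (w \<circ> swap j) e = walk j w e - walk j (w \<circ> swap j) e"
proof (cases "j = 1")
  case False
  then have "walk j w e = walk (j - 1) w e + of_bool (e = edge j w)" for w
    using walk_step[of "j - 1" w] assms by auto
  then show ?thesis by (simp add: edge_swap)
qed (simp add: walk_trivial)

context triplet
begin

text \<open>
  The semidirect product of the integral chains with the symmetric group.  A homomorphism into it
  whose second component is the projection to the symmetric group has a crossed homomorphism as its
  first component.
\<close>

definition chain_extension :: "((cell \<Rightarrow> int) \<times> (nat \<Rightarrow> nat)) monoid" where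
  "chain_extension =
    \<lparr>carrier = UNIV \<times> {p. p permutes {1..n}},
     mult = (\<lambda>(f, p) (g, q). (\<lambda>e. f e + act p g e, p \<circ> q)),
     one = (\<lambda>e. 0, id)\<rparr>"

lemma group_chain_extension: "group chain_extension"
proof (rule groupI)
  fix x y z assume xyz: "x \<in> carrier chain_extension" "y \<in> carrier chain_extension"
    "z \<in> carrier chain_extension"
  obtain f p g q h r where eqs: "x = (f, p)" "y = (g, q)" "z = (h, r)" by (cases x, cases y, cases z)
  have "act p (\<lambda>e. g e + act q h e) = (\<lambda>e. act p g e + act (p \<circ> q) h e)"
    using xyz eqs act_comp[of p "{1..n}" q h] by (simp add: chain_extension_def act_def)
  then show "x \<otimes>\<^bsub>chain_extension\<^esub> y \<otimes>\<^bsub>chain_extension\<^esub> z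
      = x \<otimes>\<^bsub>chain_extension\<^esub> (y \<otimes>\<^bsub>chain_extension\<^esub> z)"
    by (simp add: chain_extension_def eqs comp_assoc add.assoc)
next
  fix x assume x: "x \<in> carrier chain_extension"
  obtain f p where eqs: "x = (f, p)" by (cases x)
  have p: "p permutes {1..n}" using x eqs by (simp add: chain_extension_def)
  have "(\<lambda>e. - act (inv' p) f e, inv' p) \<otimes>\<^bsub>chain_extension\<^esub> x = \<one>\<^bsub>chain_extension\<^esub>"
    using permutes_inv_o[OF p] by (simp add: eqs chain_extension_def)
  moreover have "(\<lambda>e. - act (inv' p) f e, inv' p) \<in> carrier chain_extension"
    using permutes_inv[OF p] by (simp add: chain_extension_def)
  ultimately show "\<exists>y\<in>carrier chain_extension. y \<otimes>\<^bsub>chain_extension\<^esub> x = \<one>\<^bsub>chain_extension\<^esub>"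
    by blast
  show "\<one>\<^bsub>chain_extension\<^esub> \<otimes>\<^bsub>chain_extension\<^esub> x = x"
    by (simp add: eqs chain_extension_def)
qed (auto simp: chain_extension_def permutes_compose permutes_id)

text \<open>
  The reflection \<open>swap j\<close> fixes the vertex \<open>j - 1\<close>.  A path from the base vertex to its reflection
  goes to this vertex and returns along the reflected path.
\<close>

definition gen_chain :: "nat \<Rightarrow> (cell \<Rightarrow> int) \<times> (nat \<Rightarrow> nat)" where
  "gen_chain j = (\<lambda>e. walk (j - 1) id e - walk (j - 1) (swap j) e, swap j)"

definition chain_hom :: "nat word set \<Rightarrow> (cell \<Rightarrow> int) \<times> (nat \<Rightarrow> nat)" where
  "chain_hom = induced_map (word_value chain_extension gen_chain)"

lemma chain_extension_mult:
  "(f, p) \<otimes>\<^bsub>chain_extension\<^esub> (g, q) = (\<lambda>e. f e + act p g e, p \<circ> q)"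
  by (simp add: chain_extension_def)

lemma act_diff: "act p (\<lambda>e. f e - g e) = (\<lambda>e. act p f e - act p g e)"
  by (simp add: act_def)

lemma act_add: "act p (\<lambda>e. f e + g e) = (\<lambda>e. act p f e + act p g e)"
  by (simp add: act_def)

text \<open>
  The braid relation holds because the chain of any product of \<open>y\<^sub>i\<close> and \<open>y\<^bsub>i+1\<^esub>\<close> depends
  only on its permutation \<open>p\<close>: it goes to the vertex \<open>i\<close>, fixed by both reflections, and returns along
  the translate by \<open>p\<close>.
\<close>

lemma chain_hom_properties:
  shows "chain_hom \<in> hom L chain_extension"
    and "\<And>j. 1 \<le> j \<Longrightarrow> j < n \<Longrightarrow> chain_hom (gen j) = gen_chain j"
proof -
  have closed: "gen_chain j \<in> carrier chain_extension" if "1 \<le> j" "j < n" for j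
    using swap_permutes[OF that] by (simp add: gen_chain_def chain_extension_def)
  have act_swap: "act (swap j) (walk m w) = walk m (swap j \<circ> w)" if "1 \<le> j" "j < n" for j m w
    using act_walk[OF swap_permutes[OF that]] .
  have sq: "gen_chain j \<otimes>\<^bsub>chain_extension\<^esub> gen_chain j = \<one>\<^bsub>chain_extension\<^esub>"
    if "1 \<le> j" "j < n" for j
    using that by (simp only: gen_chain_def chain_extension_mult act_diff act_swap)
      (simp add: chain_extension_def)
  have D: "walk (j - 1) w e - walk (j - 1) (w \<circ> swap j) e = walk i w e - walk i (w \<circ> swap j) e"
    if "1 \<le> i" "j = i \<or> j = i + 1" for i j w e
    using that walk_diff_swap[of i w e] by auto
  have triple: "gen_chain a \<otimes>\<^bsub>chain_extension\<^esub> (gen_chain b \<otimes>\<^bsub>chain_extension\<^esub> gen_chain a)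
      = (\<lambda>e. walk i id e - walk i (swap a \<circ> (swap b \<circ> swap a)) e, swap a \<circ> (swap b \<circ> swap a))"
    if i: "1 \<le> i" "i + 1 < n" and ab: "a = i \<or> a = i + 1" "b = i \<or> b = i + 1" for a b i
  proof -
    have ab': "1 \<le> a" "a < n" "1 \<le> b" "b < n" using i ab by auto
    have "gen_chain a \<otimes>\<^bsub>chain_extension\<^esub> (gen_chain b \<otimes>\<^bsub>chain_extension\<^esub> gen_chain a)
      = (\<lambda>e. (walk (a - 1) id e - walk (a - 1) (id \<circ> swap a) e)
         + ((walk (b - 1) (swap a) e - walk (b - 1) (swap a \<circ> swap b) e)
         + (walk (a - 1) (swap a \<circ> swap b) e - walk (a - 1) ((swap a \<circ> swap b) \<circ> swap a) e)),
         swap a \<circ> (swap b \<circ> swap a))"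
      using ab' by (simp only: gen_chain_def chain_extension_mult act_diff act_add act_swap
          comp_id id_comp comp_assoc)
    then show ?thesis by (simp only: D[OF i(1) ab(1)] D[OF i(1) ab(2)]) (simp add: comp_assoc)
  qed
  have braid: "gen_chain i \<otimes>\<^bsub>chain_extension\<^esub> (gen_chain (i + 1) \<otimes>\<^bsub>chain_extension\<^esub> gen_chain i)
      = gen_chain (i + 1) \<otimes>\<^bsub>chain_extension\<^esub> (gen_chain i \<otimes>\<^bsub>chain_extension\<^esub> gen_chain (i + 1))"
    if "1 \<le> i" "i + 1 < n" for i
  proof -
    have "swap i \<circ> (swap (i + 1) \<circ> swap i) = swap (i + 1) \<circ> (swap i \<circ> swap (i + 1))"
      by (rule ext) (auto simp: swap_apply)
    then show ?thesis
      using triple[OF that, of i "i + 1"] triple[OF that, of "i + 1" i] by simp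
  qed
  note * = universal_property[OF group_chain_extension, of gen_chain]
  show "chain_hom \<in> hom L chain_extension"
    unfolding chain_hom_def by (rule *(1); (rule closed sq braid)?; assumption)
  show "chain_hom (gen j) = gen_chain j" if "1 \<le> j" "j < n" for j
    unfolding chain_hom_def using that by (intro *(2)) (rule closed sq braid; assumption)+
qed

sublocale ch: group_hom L chain_extension chain_hom
  using chain_hom_properties(1) group_chain_extension L.group_axioms
  by (simp add: group_hom_def group_hom_axioms_def)

lemma snd_chain_hom: "x \<in> carrier L \<Longrightarrow> snd (chain_hom x) = \<pi> x"
proof (induction rule: L_induct)
  case one
  have "\<pi> \<one>\<^bsub>L\<^esub> = id" by simp
  then show ?case by (simp add: chain_extension_def)
next
  case (step x j)
  have "\<pi> (x \<otimes>\<^bsub>L\<^esub> gen j) = \<pi> x \<circ> swap j"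
    using step by (simp only: \<pi>.hom_mult gen_closed \<pi>_gen sym_group_mult)
  moreover have "chain_hom (x \<otimes>\<^bsub>L\<^esub> gen j) = chain_hom x \<otimes>\<^bsub>chain_extension\<^esub> gen_chain j"
    using step by (simp add: chain_hom_properties(2))
  ultimately show ?case
    using step.IH by (cases "chain_hom x") (simp add: chain_extension_mult gen_chain_def)
qed

definition chain :: "nat word set \<Rightarrow> cell \<Rightarrow> int" where
  "chain x = fst (chain_hom x)"

lemma chain_mult:
  assumes "x \<in> carrier L" "y \<in> carrier L"
  shows "chain (x \<otimes>\<^bsub>L\<^esub> y) = (\<lambda>e. chain x e + act (\<pi> x) (chain y) e)"
  unfolding chain_def using assms snd_chain_hom[OF assms(1)]
  by (cases "chain_hom x"; cases "chain_hom y")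
    (simp add: ch.hom_mult[OF assms] chain_extension_mult)

lemma chain_one: "chain \<one>\<^bsub>L\<^esub> = (\<lambda>e. 0)"
  by (simp add: chain_def) (simp add: chain_extension_def)

lemma chain_step:
  assumes "x \<in> carrier L" "1 \<le> j" "j < n"
  shows "chain (x \<otimes>\<^bsub>L\<^esub> gen j) =
    (\<lambda>e. chain x e + (walk (j - 1) (\<pi> x) e - walk (j - 1) (\<pi> x \<circ> swap j) e))"
proof -
  have "chain (gen j) = (\<lambda>e. walk (j - 1) id e - walk (j - 1) (swap j) e)"
    using assms by (simp add: chain_def chain_hom_properties(2) gen_chain_def)
  then show ?thesis
    using assms act_walk[OF \<pi>_permutes[OF assms(1)]] by (simp add: chain_mult act_diff)
qed

lemma chain_PL_mult:
  "p \<in> PL \<Longrightarrow> x \<in> carrier L \<Longrightarrow> chain (p \<otimes>\<^bsub>L\<^esub> x) = (\<lambda>e. chain p e + chain x e)"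
  by (simp add: chain_mult PL_iff)

section \<open>Cycles\<close>

definition edges :: "cell set" where
  "edges = {edge i w |i w. 2 \<le> i \<and> i \<le> n - 2 \<and> w permutes {1..n}}"

definition verts :: "cell set" where
  "verts = {vert i w |i w. 1 \<le> i \<and> i \<le> n - 2 \<and> w permutes {1..n}}"

lemma edge_in_edges: "2 \<le> i \<Longrightarrow> i \<le> n - 2 \<Longrightarrow> w permutes {1..n} \<Longrightarrow> edge i w \<in> edges"
  unfolding edges_def by blast

lemma vert_in_verts: "1 \<le> i \<Longrightarrow> i \<le> n - 2 \<Longrightarrow> w permutes {1..n} \<Longrightarrow> vert i w \<in> verts"
  unfolding verts_def by blast

lemma edges_Sigma: "edges = Sigma {2..n - 2} (\<lambda>i. perm_coset {i..i + 1} ` {w. w permutes {1..n}})"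
  by (auto simp: edges_def edge_def)

lemma verts_Sigma: "verts = Sigma {1..n - 2} (\<lambda>i. perm_coset {i..i + 2} ` {w. w permutes {1..n}})"
  by (auto simp: verts_def vert_def)

lemma finite_cells [simp]: "finite edges" "finite verts"
  unfolding edges_Sigma verts_Sigma by (auto intro!: finite_permutations)

lemma card_edges: "2 * card edges = (n - 3) * fact n"
proof -
  have "2 * card (perm_coset {i..i + 1} ` {w. w permutes {1..n}}) = fact n" if "i \<in> {2..n - 2}" for i
  proof -
    have "{i..i + 1} \<subseteq> {1..n}" using that n_ge_4 by auto
    from card_perm_cosets[OF _ this] show ?thesis by (simp add: numeral_2_eq_2)
  qed
  then have "(\<Sum>i\<in>{2..n - 2}. 2 * card (perm_coset {i..i + 1} ` {w. w permutes {1..n}})) = (n - 3) * fact n"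
    using n_ge_4 by (simp add: numeral_eq_Suc)
  then show ?thesis
    unfolding edges_Sigma by (subst card_SigmaI) (auto simp: sum_distrib_left intro!: finite_permutations)
qed

lemma card_verts: "6 * card verts = (n - 2) * fact n"
proof -
  have "6 * card (perm_coset {i..i + 2} ` {w. w permutes {1..n}}) = fact n" if "i \<in> {1..n - 2}" for i
  proof -
    have "{i..i + 2} \<subseteq> {1..n}" using that n_ge_4 by auto
    from card_perm_cosets[OF _ this] show ?thesis by (simp add: eval_nat_numeral)
  qed
  then have "(\<Sum>i\<in>{1..n - 2}. 6 * card (perm_coset {i..i + 2} ` {w. w permutes {1..n}})) = (n - 2) * fact n"
    by simp
  then show ?thesis
    unfolding verts_Sigma by (subst card_SigmaI) (auto simp: sum_distrib_left intro!: finite_permutations)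
qed

lemma head_tail_verts: "e \<in> edges \<Longrightarrow> head e \<in> verts \<and> tail e \<in> verts"
proof -
  assume "e \<in> edges"
  then obtain i w where i: "2 \<le> i" "i \<le> n - 2" "w permutes {1..n}" "e = edge i w"
    unfolding edges_def by blast
  then have "1 \<le> i" "1 \<le> i - 1" "i - 1 \<le> n - 2" by auto
  then show ?thesis using i vert_in_verts by (simp add: head_edge tail_edge)
qed

lemma move_edges: "p permutes {1..n} \<Longrightarrow> e \<in> edges \<Longrightarrow> move p e \<in> edges"
  unfolding edges_def by (auto simp: move_edge) (metis permutes_compose)

lemma head_move: "e \<in> edges \<Longrightarrow> head (move p e) = move p (head e)"
  unfolding edges_def by (auto simp: move_edge move_vert head_edge)

lemma tail_move: "e \<in> edges \<Longrightarrow> tail (move p e) = move p (tail e)"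
  unfolding edges_def by (auto simp: move_edge move_vert tail_edge)

lemma bij_move:
  assumes "p permutes {1..n}"
  shows "bij_betw (move p) edges edges"
  by (rule bij_betw_byWitness[where f' = "move (inv' p)"])
    (use move_inv[OF assms] move_edges[OF assms] move_edges[OF permutes_inv[OF assms]] in auto)

text \<open>
  The incidence function of a vertex is its coboundary, so a chain is closed iff it is orthogonal to
  all of these functions.
\<close>

definition incidence :: "cell \<Rightarrow> cell \<Rightarrow> real" where
  "incidence v e = of_bool (head e = v) - of_bool (tail e = v)"

definition boundary :: "(cell \<Rightarrow> real) \<Rightarrow> cell \<Rightarrow> real" where
  "boundary x v = dot edges (incidence v) x"

definition closed_chain :: "(cell \<Rightarrow> real) \<Rightarrow> bool" where
  "closed_chain x \<longleftrightarrow> (\<forall>e. e \<notin> edges \<longrightarrow> x e = 0) \<and> (\<forall>v. boundary x v = 0)"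

lemma dot_act:
  assumes "p permutes {1..n}"
  shows "dot edges (act p x) y = dot edges x (act (inv' p) y)"
proof -
  have "dot edges x (act (inv' p) y) = (\<Sum>e\<in>edges. x (move (inv' p) (move p e)) * y (move p e))"
    unfolding dot_def act_def using move_inv[OF assms] permutes_inv_inv[OF assms] by simp
  also have "\<dots> = dot edges (act p x) y"
    unfolding dot_def act_def by (rule sum.reindex_bij_betw[OF bij_move[OF assms]])
  finally show ?thesis by simp
qed

lemma closed_chain_act:
  assumes p: "p permutes {1..n}" and "closed_chain x"
  shows "closed_chain (act p x)"
  unfolding closed_chain_def
proof (intro conjI allI impI)
  fix e assume e: "e \<notin> edges"
  have "move (inv' p) e \<notin> edges"
    using move_edges[OF p, of "move (inv' p) e"] move_inv[OF p] e by metis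
  then show "act p x e = 0" using assms(2) unfolding act_def closed_chain_def by blast
next
  fix v
  have "boundary (act p x) v = dot edges (act (inv' p) (incidence v)) x"
    unfolding boundary_def dot_commute[of edges "incidence v"] dot_act[OF p] by (rule dot_commute)
  also have "\<dots> = boundary x (move (inv' p) v)"
    unfolding boundary_def
  proof (rule dot_cong)
    fix e assume e: "e \<in> edges"
    have "move p u = v \<longleftrightarrow> u = move (inv' p) v" for u using move_inv[OF p] by metis
    then show "act (inv' p) (incidence v) e = incidence (move (inv' p) v) e"
      using e by (simp add: act_def incidence_def permutes_inv_inv[OF p] head_move tail_move)
  qed simp
  finally show "boundary (act p x) v = 0" using assms(2) unfolding closed_chain_def by metis
qed

lemma closed_chain_sum:
  assumes "\<And>k. k \<in> K \<Longrightarrow> closed_chain (x k)"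
  shows "closed_chain (\<lambda>e. \<Sum>k\<in>K. r k * x k e)"
  using assms unfolding closed_chain_def boundary_def by (simp add: dot_right)

lemma boundary_walk:
  assumes "1 \<le> m" "m \<le> n - 2" "w permutes {1..n}"
  shows "boundary (\<lambda>e. of_int (walk m w e)) v = of_bool (vert m w = v) - of_bool (vert 1 w = v)"
  using assms(1,2)
proof (induction m rule: nat_induct_at_least)
  case base
  then show ?case by (simp add: walk_trivial boundary_def)
next
  case (Suc m)
  have e: "edge (m + 1) w \<in> edges" using Suc assms(3) by (intro edge_in_edges) auto
  have "dot edges (incidence v) (\<lambda>e. of_bool (e = edge (m + 1) w))
      = (\<Sum>e\<in>edges. if e = edge (m + 1) w then incidence v e else 0)"
    unfolding dot_def by (intro sum.cong) auto
  also have "\<dots> = of_bool (vert (m + 1) w = v) - of_bool (vert m w = v)"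
    using e by (simp add: incidence_def head_edge tail_edge)
  finally show ?case
    using Suc walk_step[OF Suc.hyps, of w] by (simp add: boundary_def dot_right)
qed

abbreviation real_chain :: "nat word set \<Rightarrow> cell \<Rightarrow> real" where
  "real_chain x \<equiv> (\<lambda>e. of_int (chain x e))"

lemma walk_support: "m \<le> n - 2 \<Longrightarrow> w permutes {1..n} \<Longrightarrow> e \<notin> edges \<Longrightarrow> walk m w e = 0"
  unfolding walk_def using edge_in_edges[of _ w] by (intro sum.neutral) fastforce

lemma chain_support:
  assumes "x \<in> carrier L" "e \<notin> edges"
  shows "chain x e = 0"
  using assms(1)
proof (induction rule: L_induct)
  case one
  show ?case by (simp add: chain_one)
next
  case (step x j)
  have "j - 1 \<le> n - 2" using step by simp
  then show ?case
    using step walk_support[OF _ _ assms(2)] \<pi>_permutes[of x]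
      permutes_compose[OF swap_permutes[of j] \<pi>_permutes[of x]]
    by (simp add: chain_step)
qed

text \<open>
  This expresses that \<open>chain x\<close> is the chain of a path from the base vertex to its image under \<open>x\<close>.
\<close>

lemma boundary_chain:
  assumes "x \<in> carrier L"
  shows "boundary (real_chain x) v = of_bool (vert 1 (\<pi> x) = v) - of_bool (vert 1 id = v)"
  using assms
proof (induction rule: L_induct)
  case one
  have "\<pi> \<one>\<^bsub>L\<^esub> = id" by simp
  then show ?case by (simp add: chain_one boundary_def)
next
  case (step x j)
  let ?w = "\<pi> x"
  have w: "?w permutes {1..n}" "?w \<circ> swap j permutes {1..n}"
    using step \<pi>_permutes permutes_compose[OF swap_permutes] by auto
  have \<pi>: "\<pi> (x \<otimes>\<^bsub>L\<^esub> gen j) = ?w \<circ> swap j"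
    using step by (simp only: \<pi>.hom_mult gen_closed \<pi>_gen sym_group_mult)
  have "boundary (real_chain (x \<otimes>\<^bsub>L\<^esub> gen j)) v
      = boundary (real_chain x) v
        + (boundary (\<lambda>e. of_int (walk (j - 1) ?w e)) v
         - boundary (\<lambda>e. of_int (walk (j - 1) (?w \<circ> swap j) e)) v)"
    using step by (simp add: chain_step boundary_def dot_right)
  also have "boundary (\<lambda>e. of_int (walk (j - 1) ?w e)) v
         - boundary (\<lambda>e. of_int (walk (j - 1) (?w \<circ> swap j) e)) v
      = of_bool (vert 1 (?w \<circ> swap j) = v) - of_bool (vert 1 ?w = v)"
  proof (cases "j = 1")
    case True
    then show ?thesis by (simp add: walk_trivial boundary_def vert_swap)
  next
    case False
    then have "1 \<le> j - 1" "j - 1 \<le> n - 2" "j = j - 1 + 1" using step by auto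
    then show ?thesis using w vert_swap[of j "j - 1" ?w] by (simp add: boundary_walk)
  qed
  finally show ?case unfolding \<pi> step.IH by linarith
qed

lemma closed_chain_of_PL: "x \<in> PL \<Longrightarrow> closed_chain (real_chain x)"
  by (simp add: closed_chain_def PL_iff chain_support boundary_chain)

lemma graph_connected:
  assumes "\<And>e. e \<in> edges \<Longrightarrow> a (head e) = a (tail e)" and "v \<in> verts"
  shows "a v = a (vert 1 id)"
proof -
  have shift: "a (vert i w) = a (vert 1 w)" if "1 \<le> i" "i \<le> n - 2" "w permutes {1..n}" for i w
    using that
  proof (induction i rule: nat_induct_at_least)
    case (Suc i)
    then have "edge (Suc i) w \<in> edges" by (intro edge_in_edges) auto
    from assms(1)[OF this] show ?case using Suc by (simp add: head_edge tail_edge)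
  qed simp
  have "a (vert 1 w) = a (vert 1 id)" if "w permutes {1..n}" for w
    using that
  proof (induction rule: permutes_interval_induct)
    case (swap q j)
    define i where "i = (if j = 1 then 1 else j - 1)"
    have i: "1 \<le> i" "i \<le> n - 2" "j = i \<or> j = i + 1" using swap n_ge_4 by (auto simp: i_def)
    have "q \<circ> swap j permutes {1..n}" using swap permutes_compose[OF swap_permutes] by auto
    then have "a (vert 1 (q \<circ> swap j)) = a (vert i (q \<circ> swap j))"
      using shift[OF i(1,2)] by metis
    also have "\<dots> = a (vert i q)" using vert_swap[OF i(3)] by simp
    finally show ?case using shift[OF i(1,2) swap(1)] swap by (simp add: o_def id_def)
  qed simp
  moreover obtain i w where "1 \<le> i" "i \<le> n - 2" "w permutes {1..n}" "v = vert i w"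
    using assms(2) unfolding verts_def by blast
  ultimately show ?thesis using shift[of i w] by metis
qed

lemma root_in_verts: "vert 1 id \<in> verts"
  using n_ge_4 by (intro vert_in_verts permutes_id) auto

text \<open>
  Since the graph is connected, the coboundaries of all vertices but one are independent, and the
  cycles form their orthogonal complement.  The dimension is the number of edges minus the number of
  vertices plus one.
\<close>

lemma cycle_basis:
  obtains d b where "real d = 1 + fact n * ((2 * real n - 7) / 6)" "orthonormal edges d b"
    "\<And>k. k < d \<Longrightarrow> closed_chain (b k)" "\<And>x e. closed_chain x \<Longrightarrow> x e = proj edges d b x e"
proof -
  define J where "J = verts - {vert 1 id}"
  have indep: "t j = 0" if t: "\<And>e. e \<in> edges \<Longrightarrow> (\<Sum>v\<in>J. t v * incidence v e) = 0" and "j \<in> J" for t j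
  proof -
    define s where "s = (\<lambda>v. if v \<in> J then t v else 0)"
    have "s (head e) = s (tail e)" if e: "e \<in> edges" for e
    proof -
      have "(\<Sum>v\<in>J. t v * incidence v e)
          = (\<Sum>v\<in>J. if v = head e then t v else 0) - (\<Sum>v\<in>J. if v = tail e then t v else 0)"
        unfolding sum_subtractf[symmetric] incidence_def by (intro sum.cong) auto
      also have "\<dots> = s (head e) - s (tail e)" by (simp add: s_def J_def)
      finally show ?thesis using t[OF e] by simp
    qed
    from graph_connected[of s, OF this, of j] show ?thesis using \<open>j \<in> J\<close> by (auto simp: s_def J_def)
  qed
  show ?thesis
  proof (rule orthonormal_complement[of edges J incidence])
    show "finite edges" "finite J" by (simp_all add: J_def)
    show "t j = 0" if "\<And>e. e \<in> edges \<Longrightarrow> (\<Sum>v\<in>J. t v * incidence v e) = 0" "j \<in> J" for t j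
      by (rule indep[OF that])
    fix d b
    assume d: "d + card J = card edges" and on: "orthonormal edges d b"
      and supp: "\<And>k e. e \<notin> edges \<Longrightarrow> b k e = 0"
      and perp: "\<And>k v. k < d \<Longrightarrow> v \<in> J \<Longrightarrow> dot edges (incidence v) (b k) = 0"
      and expand: "\<And>x e. (\<And>v. v \<in> J \<Longrightarrow> dot edges (incidence v) x = 0) \<Longrightarrow> e \<in> edges
        \<Longrightarrow> x e = proj edges d b x e"
    have "6 * d + 6 * (card J) = 3 * (2 * card edges)" using d by simp
    moreover have "card verts = Suc (card J)"
      using card_Suc_Diff1[OF _ root_in_verts] by (simp add: J_def)
    ultimately have "6 * d + (n - 2) * fact n = 3 * (n - 3) * fact n + 6"
      using card_edges card_verts by simp
    then have "real (6 * d + (n - 2) * fact n) = real (3 * (n - 3) * fact n + 6)" by (rule arg_cong)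
    then have "6 * real d + (real n - 2) * fact n = 3 * (real n - 3) * fact n + 6"
      using n_ge_4 by (simp add: of_nat_diff)
    moreover have "6 * D + (N - 2) * F = 3 * (N - 3) * F + 6 \<Longrightarrow> D = 1 + F * ((2 * N - 7) / 6)"
      for D N F :: real by (simp add: field_simps)
    ultimately have dim: "real d = 1 + fact n * ((2 * real n - 7) / 6)" by blast
    have cyc: "closed_chain (b k)" if "k < d" for k
    proof -
      have in_J: "boundary (b k) v = 0" if v: "v \<in> J" for v
        using perp[OF \<open>k < d\<close> v] by (simp add: boundary_def)
      moreover have out: "boundary (b k) v = 0" if v: "v \<notin> verts" for v
      proof -
        have "boundary (b k) v = dot edges (\<lambda>e. 0) (b k)"
          unfolding boundary_def using head_tail_verts v
          by (intro dot_cong) (auto simp: incidence_def)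
        then show ?thesis by simp
      qed
      moreover have "boundary (b k) (vert 1 id) = 0"
      proof -
        have "(\<Sum>v\<in>verts. boundary (b k) v) = dot edges (\<lambda>e. \<Sum>v\<in>verts. incidence v e) (b k)"
          by (simp add: boundary_def dot_left)
        also have "\<dots> = dot edges (\<lambda>e. 0) (b k)"
        proof (rule dot_cong)
          fix e assume "e \<in> edges"
          then have "head e \<in> verts" "tail e \<in> verts" using head_tail_verts by blast+
          then show "(\<Sum>v\<in>verts. incidence v e) = 0"
            by (simp add: incidence_def sum_subtractf of_bool_def)
        qed simp
        finally have "(\<Sum>v\<in>verts. boundary (b k) v) = 0" by simp
        moreover have "(\<Sum>v\<in>verts. boundary (b k) v) = boundary (b k) (vert 1 id) + (\<Sum>v\<in>J. boundary (b k) v)"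
          unfolding J_def using root_in_verts by (intro sum.remove) auto
        ultimately show ?thesis using in_J by simp
      qed
      ultimately have "boundary (b k) v = 0" for v using J_def by blast
      then show ?thesis using supp by (simp add: closed_chain_def)
    qed
    have "x e = proj edges d b x e" if "closed_chain x" for x e
    proof (cases "e \<in> edges")
      case True
      have "dot edges (incidence v) x = 0" for v
        using that unfolding closed_chain_def boundary_def by blast
      then show ?thesis using expand True by blast
    next
      case False
      then have "x e = 0" using that unfolding closed_chain_def by blast
      then show ?thesis using False supp by (simp add: proj_def)
    qed
    with dim on cyc show thesis by (intro that[of d b])
  qed
qed

end

section \<open>Heights of vertices\<close>

text \<open>
  \<open>N\<close> acts freely from the left on the cosets \<open>x P\<close>, so choosing one coset in every orbit
  measures each \<open>x\<close> by an element of \<open>N\<close>.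
\<close>

lemma (in group) equivariant_height:
  assumes N: "N \<lhd> G" and P: "subgroup P G" and trivial: "N \<inter> P = {\<one>}"
  obtains h where "\<And>x. x \<in> carrier G \<Longrightarrow> h x \<in> N"
    "\<And>m x. m \<in> N \<Longrightarrow> x \<in> carrier G \<Longrightarrow> h (m \<otimes> x) = m \<otimes> h x"
    "\<And>x p. x \<in> carrier G \<Longrightarrow> p \<in> P \<Longrightarrow> h (x \<otimes> p) = h x"
proof -
  have Ns: "subgroup N G" using N by (rule normal_imp_subgroup)
  note Nc = subgroup.mem_carrier[OF Ns] and Pc = subgroup.mem_carrier[OF P]
  note Nm = subgroup.m_closed[OF Ns] and Pm = subgroup.m_closed[OF P]
  note Ni = subgroup.m_inv_closed[OF Ns] and Pi = subgroup.m_inv_closed[OF P]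
  note No = subgroup.one_closed[OF Ns] and Po = subgroup.one_closed[OF P]
  have canc: "inv u \<otimes> (u \<otimes> v) = v" "u \<otimes> (inv u \<otimes> v) = v"
    if "u \<in> carrier G" "v \<in> carrier G" for u v
    using that by (simp_all flip: m_assoc)
  \<comment> \<open>the orbit of the coset of \<open>x\<close>\<close>
  define D where "D = (\<lambda>x. {m \<otimes> x \<otimes> p |m p. m \<in> N \<and> p \<in> P})"
  have D_sub: "D (m \<otimes> x \<otimes> p) \<subseteq> D x" if "m \<in> N" "x \<in> carrier G" "p \<in> P" for m x p
  proof
    fix z assume "z \<in> D (m \<otimes> x \<otimes> p)"
    then obtain m' p' where z: "m' \<in> N" "p' \<in> P" "z = m' \<otimes> (m \<otimes> x \<otimes> p) \<otimes> p'"
      unfolding D_def by blast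
    have "z = (m' \<otimes> m) \<otimes> x \<otimes> (p \<otimes> p')"
      using z that Nc Pc by (simp add: m_assoc)
    then show "z \<in> D x" unfolding D_def using z that Nm Pm by blast
  qed
  have D_eq: "D (m \<otimes> x \<otimes> p) = D x" if "m \<in> N" "x \<in> carrier G" "p \<in> P" for m x p
  proof
    have "inv m \<otimes> (m \<otimes> x \<otimes> p) \<otimes> inv p = x"
      using that Nc[of m] Pc[of p] by (simp add: m_assoc canc)
    moreover have "m \<otimes> x \<otimes> p \<in> carrier G" using that Nc Pc by simp
    ultimately show "D x \<subseteq> D (m \<otimes> x \<otimes> p)"
      using D_sub[of "inv m" "m \<otimes> x \<otimes> p" "inv p"] that Ni Pi by simp
  qed (rule D_sub[OF that])
  define r where "r = (\<lambda>x. SOME y. y \<in> D x)"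
  have D_self: "x \<in> D x" if "x \<in> carrier G" for x
    unfolding D_def using that No Po by force
  have D_carrier: "D x \<subseteq> carrier G" if "x \<in> carrier G" for x
    unfolding D_def using that Nc Pc by auto
  have r_in: "r x \<in> D x" if "x \<in> carrier G" for x
    unfolding r_def using D_self[OF that] by (rule someI)
  have ex: "\<exists>m\<in>N. \<exists>p\<in>P. x = m \<otimes> r x \<otimes> p" if x: "x \<in> carrier G" for x
  proof -
    obtain m p where mp: "m \<in> N" "p \<in> P" "r x = m \<otimes> x \<otimes> p" using r_in[OF x] unfolding D_def by blast
    have "x = inv m \<otimes> r x \<otimes> inv p"
      using mp x Nc[of m] Pc[of p] by (simp add: m_assoc canc)
    then show ?thesis using mp Ni Pi by blast
  qed
  have uniq: "m = m'" if "m \<in> N" "m' \<in> N" "p \<in> P" "p' \<in> P" "y \<in> carrier G"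
    "m \<otimes> y \<otimes> p = m' \<otimes> y \<otimes> p'" for m m' p p' y
  proof -
    have c: "m \<in> carrier G" "m' \<in> carrier G" "p \<in> carrier G" "p' \<in> carrier G" using that Nc Pc by auto
    have "inv y \<otimes> (inv m' \<otimes> m) \<otimes> y = inv y \<otimes> (inv m' \<otimes> (m \<otimes> y \<otimes> p)) \<otimes> inv p"
      using c \<open>y \<in> carrier G\<close> by (simp add: m_assoc)
    also have "\<dots> = p' \<otimes> inv p"
      unfolding that(6) using c \<open>y \<in> carrier G\<close>
      by (simp add: m_assoc canc)
    finally have eq: "inv y \<otimes> (inv m' \<otimes> m) \<otimes> y = p' \<otimes> inv p" .
    have "inv y \<otimes> (inv m' \<otimes> m) \<otimes> y \<in> N"
      using normal.inv_op_closed1[OF N \<open>y \<in> carrier G\<close>] that Nm Ni by blast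
    moreover have "p' \<otimes> inv p \<in> P" using that Pm Pi by blast
    ultimately have "inv y \<otimes> (inv m' \<otimes> m) \<otimes> y = \<one>" using eq trivial by auto
    then have "m' \<otimes> (y \<otimes> (inv y \<otimes> (inv m' \<otimes> m) \<otimes> y) \<otimes> inv y) = m' \<otimes> (y \<otimes> \<one> \<otimes> inv y)"
      by simp
    then show ?thesis using c \<open>y \<in> carrier G\<close> by (simp add: m_assoc canc)
  qed
  define h where "h = (\<lambda>x. SOME m. m \<in> N \<and> (\<exists>p\<in>P. x = m \<otimes> r x \<otimes> p))"
  have h: "h x \<in> N \<and> (\<exists>p\<in>P. x = h x \<otimes> r x \<otimes> p)" if "x \<in> carrier G" for x
    unfolding h_def by (rule someI_ex) (use ex[OF that] in blast)
  have h_eq: "h x = m" if x: "x \<in> carrier G" and mp: "m \<in> N" "p \<in> P" "x = m \<otimes> r x \<otimes> p" for x m p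
  proof -
    obtain q where q: "q \<in> P" "x = h x \<otimes> r x \<otimes> q" using h[OF x] by blast
    have "r x \<in> carrier G" using r_in D_carrier x by blast
    moreover have "h x \<otimes> r x \<otimes> q = m \<otimes> r x \<otimes> p" using q(2) mp(3) by simp
    ultimately show ?thesis using uniq[of "h x" m q p "r x"] h[OF x] q(1) mp by blast
  qed
  show ?thesis
  proof (rule that[of h])
    show "h x \<in> N" if "x \<in> carrier G" for x using h[OF that] by blast
    fix x assume x: "x \<in> carrier G"
    obtain p where p: "p \<in> P" "x = h x \<otimes> r x \<otimes> p" using h[OF x] by blast
    have hx: "h x \<in> carrier G" "r x \<in> carrier G" using h[OF x] Nc r_in[OF x] D_carrier[OF x] by auto
    show "h (m \<otimes> x) = m \<otimes> h x" if m: "m \<in> N" for m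
    proof (rule h_eq)
      have "D (m \<otimes> x) = D x" using D_eq[OF m x Po] Nc[OF m] x by simp
      then have "r (m \<otimes> x) = r x" by (simp add: r_def)
      moreover have "m \<otimes> (h x \<otimes> r x \<otimes> p) = m \<otimes> h x \<otimes> r x \<otimes> p"
        using hx Nc[OF m] Pc[OF p(1)] by (simp add: m_assoc)
      ultimately show "m \<otimes> x = m \<otimes> h x \<otimes> r (m \<otimes> x) \<otimes> p" using p(2) by metis
      show "m \<otimes> x \<in> carrier G" "m \<otimes> h x \<in> N" "p \<in> P"
        using m p(1) x h[OF x] Nm Nc by auto
    qed
    show "h (x \<otimes> q) = h x" if q: "q \<in> P" for q
    proof (rule h_eq)
      have "D (x \<otimes> q) = D x" using D_eq[OF No x q] x by simp
      then have "r (x \<otimes> q) = r x" by (simp add: r_def)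
      moreover have "(h x \<otimes> r x \<otimes> p) \<otimes> q = h x \<otimes> r x \<otimes> (p \<otimes> q)"
        using hx Pc[OF p(1)] Pc[OF q] by (simp add: m_assoc)
      ultimately show "x \<otimes> q = h x \<otimes> r (x \<otimes> q) \<otimes> (p \<otimes> q)" using p(2) by metis
      show "x \<otimes> q \<in> carrier G" "h x \<in> N" "p \<otimes> q \<in> P"
        using q p(1) x h[OF x] Pm Pc by auto
    qed
  qed
qed

text \<open>
  The relations reduce every word in \<open>a\<close> and \<open>b\<close> to one of six.
\<close>

lemma (in group) subgroup_braid_pair:
  assumes c: "a \<in> carrier G" "b \<in> carrier G"
    and sq: "a \<otimes> a = \<one>" "b \<otimes> b = \<one>" and braid: "a \<otimes> b \<otimes> a = b \<otimes> a \<otimes> b"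
  shows "subgroup {\<one>, a, b, a \<otimes> b, b \<otimes> a, a \<otimes> b \<otimes> a} G"
proof -
  define H where "H = {\<one>, a, b, a \<otimes> b, b \<otimes> a, a \<otimes> b \<otimes> a}"
  have H_elim: P if "x \<in> H" "x = \<one> \<Longrightarrow> P" "x = a \<Longrightarrow> P" "x = b \<Longrightarrow> P" "x = a \<otimes> b \<Longrightarrow> P"
    "x = b \<otimes> a \<Longrightarrow> P" "x = a \<otimes> b \<otimes> a \<Longrightarrow> P" for x P
    using that unfolding H_def by blast
  have H_intro: "\<one> \<in> H" "a \<in> H" "b \<in> H" "a \<otimes> b \<in> H" "b \<otimes> a \<in> H" "a \<otimes> b \<otimes> a \<in> H" "b \<otimes> a \<otimes> b \<in> H"
    unfolding H_def braid by simp_all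
  have cancel: "x \<otimes> a \<otimes> a = x" "x \<otimes> b \<otimes> b = x" if "x \<in> carrier G" for x
    using that c sq by (simp_all add: m_assoc)
  have right_a: "x \<otimes> a \<in> H" if "x \<in> H" for x
    using that by (rule H_elim) (simp_all add: c sq cancel H_intro)
  have abab: "a \<otimes> b \<otimes> a \<otimes> b = b \<otimes> a" unfolding braid using c cancel by simp
  have right_b: "x \<otimes> b \<in> H" if "x \<in> H" for x
    using that by (rule H_elim) (simp_all add: c sq cancel abab H_intro)
  have sub: "H \<subseteq> carrier G" using c by (auto elim!: H_elim)
  have inv_ab: "inv a = a" "inv b = b" using c sq by (simp_all add: inv_equality)
  have "subgroup H G"
  proof (rule subgroupI)
    fix x assume x: "x \<in> H"
    show "inv x \<in> H"
      using x by (rule H_elim) (simp_all add: c inv_mult_group inv_ab H_intro m_assoc[symmetric])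
    fix y assume "y \<in> H"
    moreover have "x \<in> carrier G" using x sub by blast
    ultimately show "x \<otimes> y \<in> H"
      using x c by (elim H_elim[of y]) (simp_all add: right_a right_b flip: m_assoc)
  qed (use sub H_intro in auto)
  then show ?thesis by (simp only: H_def)
qed

context triplet
begin

definition dihedral :: "nat \<Rightarrow> nat word set set" where
  "dihedral i = {\<one>\<^bsub>L\<^esub>, gen i, gen (i + 1), gen i \<otimes>\<^bsub>L\<^esub> gen (i + 1), gen (i + 1) \<otimes>\<^bsub>L\<^esub> gen i,
     gen i \<otimes>\<^bsub>L\<^esub> gen (i + 1) \<otimes>\<^bsub>L\<^esub> gen i}"

lemma dihedral_subgroup:
  assumes "1 \<le> i" "i + 1 < n"
  shows "subgroup (dihedral i) L"
  unfolding dihedral_def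
  by (intro L.subgroup_braid_pair gen_braid gen_closed gen_square) (use assms in auto)

text \<open>
  The permutation of every element listed in \<open>dihedral i\<close>, except for the identity, moves \<open>i\<close> or
  \<open>i + 1\<close>.
\<close>

lemma PL_inter_dihedral:
  assumes "1 \<le> i" "i + 1 < n"
  shows "PL \<inter> dihedral i = {\<one>\<^bsub>L\<^esub>}"
proof -
  have trivial: "x = \<one>\<^bsub>L\<^esub>" if "x \<in> dihedral i" "\<pi> x = id" for x
  proof -
    define a b where "a = gen i" and "b = gen (i + 1)"
    have c: "a \<in> carrier L" "b \<in> carrier L" using assms by (auto simp: a_def b_def)
    have p: "\<pi> (x \<otimes>\<^bsub>L\<^esub> y) = \<pi> x \<circ> \<pi> y" if "x \<in> carrier L" "y \<in> carrier L" for x y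
      using \<pi>.hom_mult[OF that] by simp
    have \<pi>: "\<pi> a = swap i" "\<pi> b = swap (i + 1)" unfolding a_def b_def using assms \<pi>_gen by auto
    have "\<pi> a i \<noteq> i" "\<pi> b (i + 1) \<noteq> i + 1" "\<pi> (a \<otimes>\<^bsub>L\<^esub> b) i \<noteq> i" "\<pi> (b \<otimes>\<^bsub>L\<^esub> a) i \<noteq> i"
      "\<pi> (a \<otimes>\<^bsub>L\<^esub> b \<otimes>\<^bsub>L\<^esub> a) i \<noteq> i"
      by (simp_all only: p c L.m_closed \<pi>) (simp_all add: swap_apply)
    moreover have "x \<in> {\<one>\<^bsub>L\<^esub>, a, b, a \<otimes>\<^bsub>L\<^esub> b, b \<otimes>\<^bsub>L\<^esub> a, a \<otimes>\<^bsub>L\<^esub> b \<otimes>\<^bsub>L\<^esub> a}"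
      using that(1) by (simp only: dihedral_def a_def b_def)
    ultimately show ?thesis using that(2) by (metis empty_iff id_apply insert_iff)
  qed
  show ?thesis
  proof
    show "PL \<inter> dihedral i \<subseteq> {\<one>\<^bsub>L\<^esub>}" using trivial by (simp add: PL_iff subset_iff)
    show "{\<one>\<^bsub>L\<^esub>} \<subseteq> PL \<inter> dihedral i"
      using subgroup.one_closed[OF PL_subgroup] by (simp add: dihedral_def)
  qed
qed

text \<open>
  A height at \<open>i\<close> is constant on the cosets of \<open>dihedral i\<close>, which correspond to the vertices of the
  tree over the vertices \<open>vert i w\<close> of the graph, and it turns the action of \<open>PL\<close> into left
  multiplication.
\<close>

definition is_height :: "nat \<Rightarrow> (nat word set \<Rightarrow> nat word set) \<Rightarrow> bool" where
  "is_height i h \<longleftrightarrow> (\<forall>x\<in>carrier L. h x \<in> PL \<and> (\<forall>p\<in>PL. h (p \<otimes>\<^bsub>L\<^esub> x) = p \<otimes>\<^bsub>L\<^esub> h x) \<and>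
     h (x \<otimes>\<^bsub>L\<^esub> gen i) = h x \<and> h (x \<otimes>\<^bsub>L\<^esub> gen (i + 1)) = h x)"

lemma ex_height:
  assumes "1 \<le> i" "i + 1 < n"
  shows "\<exists>h. is_height i h"
proof (rule L.equivariant_height[OF PL_normal dihedral_subgroup[OF assms] PL_inter_dihedral[OF assms]])
  fix h
  assume "\<And>x. x \<in> carrier L \<Longrightarrow> h x \<in> PL"
    "\<And>m x. m \<in> PL \<Longrightarrow> x \<in> carrier L \<Longrightarrow> h (m \<otimes>\<^bsub>L\<^esub> x) = m \<otimes>\<^bsub>L\<^esub> h x"
    "\<And>x p. x \<in> carrier L \<Longrightarrow> p \<in> dihedral i \<Longrightarrow> h (x \<otimes>\<^bsub>L\<^esub> p) = h x"
  moreover have "gen i \<in> dihedral i" "gen (i + 1) \<in> dihedral i" by (simp_all add: dihedral_def)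
  ultimately have "is_height i h" unfolding is_height_def by simp
  then show ?thesis by blast
qed

definition height :: "nat \<Rightarrow> nat word set \<Rightarrow> nat word set" where
  "height i = (SOME h. is_height i h)"

lemma height:
  assumes "1 \<le> i" "i + 1 < n" "x \<in> carrier L"
  shows height_PL: "height i x \<in> PL"
    and height_mult: "\<And>p. p \<in> PL \<Longrightarrow> height i (p \<otimes>\<^bsub>L\<^esub> x) = p \<otimes>\<^bsub>L\<^esub> height i x"
    and height_gen: "\<And>j. j = i \<or> j = i + 1 \<Longrightarrow> height i (x \<otimes>\<^bsub>L\<^esub> gen j) = height i x"
proof -
  have "is_height i (height i)"
    unfolding height_def using ex_height[OF assms(1,2)] by (rule someI_ex)
  with assms(3) show "height i x \<in> PL"
    "\<And>p. p \<in> PL \<Longrightarrow> height i (p \<otimes>\<^bsub>L\<^esub> x) = p \<otimes>\<^bsub>L\<^esub> height i x"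
    "\<And>j. j = i \<or> j = i + 1 \<Longrightarrow> height i (x \<otimes>\<^bsub>L\<^esub> gen j) = height i x"
    unfolding is_height_def by blast+
qed

end

section \<open>Chains detect the commutator subgroup\<close>

text \<open>
  The homomorphism from integral functions on \<open>E\<close> to a commutative group that takes prescribed
  values on the indicator functions of points.
\<close>

definition (in comm_group) weighted_product :: "'e set \<Rightarrow> ('e \<Rightarrow> 'a) \<Rightarrow> ('e \<Rightarrow> int) \<Rightarrow> 'a" where
  "weighted_product E w f = finprod G (\<lambda>e. w e [^] f e) E"

context comm_group
begin

lemma weighted_product_closed:
  "w \<in> E \<rightarrow> carrier G \<Longrightarrow> weighted_product E w f \<in> carrier G"
  unfolding weighted_product_def by (intro finprod_closed) auto

lemma weighted_product_add:
  assumes "w \<in> E \<rightarrow> carrier G"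
  shows "weighted_product E w (\<lambda>e. f e + g e) = weighted_product E w f \<otimes> weighted_product E w g"
proof -
  have "weighted_product E w (\<lambda>e. f e + g e) = finprod G (\<lambda>e. w e [^] f e \<otimes> w e [^] g e) E"
    unfolding weighted_product_def using assms by (intro finprod_cong) (auto simp: int_pow_mult simp_implies_def Pi_iff)
  also have "\<dots> = weighted_product E w f \<otimes> weighted_product E w g"
    unfolding weighted_product_def using assms by (intro finprod_multf) auto
  finally show ?thesis .
qed

lemma weighted_product_zero: "weighted_product E w (\<lambda>e. 0) = \<one>"
  unfolding weighted_product_def by simp

lemma weighted_product_diff:
  assumes "w \<in> E \<rightarrow> carrier G"
  shows "weighted_product E w (\<lambda>e. f e - g e) = weighted_product E w f \<otimes> inv (weighted_product E w g)"
proof -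
  have "weighted_product E w f = weighted_product E w (\<lambda>e. f e - g e) \<otimes> weighted_product E w g"
    using weighted_product_add[OF assms, of "\<lambda>e. f e - g e" g] by simp
  then show ?thesis
    using weighted_product_closed[OF assms] by (metis inv_solve_right)
qed

lemma weighted_product_single:
  assumes "finite E" "w \<in> E \<rightarrow> carrier G" "e \<in> E"
  shows "weighted_product E w (\<lambda>e'. of_bool (e' = e)) = w e"
proof -
  have "weighted_product E w (\<lambda>e'. of_bool (e' = e)) = finprod G (\<lambda>e'. if e = e' then w e' else \<one>) E"
    unfolding weighted_product_def using assms
    by (intro finprod_cong) (auto simp: simp_implies_def Pi_iff)
  also have "\<dots> = w e" using assms by (intro finprod_singleton) auto
  finally show ?thesis .
qed

end

context triplet
begin

definition ab :: "nat word set set monoid" where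
  "ab = pure_triplet_group n Mod DPL"

lemma group_PL: "group (pure_triplet_group n)"
  unfolding pure_triplet_group_def using PL_subgroup by (rule L.subgroup_imp_group)

lemma DPL_derived: "DPL = derived (pure_triplet_group n) (carrier (pure_triplet_group n))"
  unfolding pure_triplet_derived_def pure_triplet_group_def
  using L.derived_consistent[OF _ PL_subgroup, of PL] by simp

sublocale ab: comm_group ab
  using group.derived_quot_is_comm_group[OF group_PL] by (simp add: DPL_derived ab_def)

lemma DPL_normal_PL: "DPL \<lhd> pure_triplet_group n"
  unfolding DPL_derived by (rule group.derived_self_is_normal[OF group_PL])

lemma DPL_normal: "DPL \<lhd> L"
  unfolding pure_triplet_derived_def using PL_normal by (rule L.derived_is_normal)

lemma DPL_subset: "DPL \<subseteq> PL"
  unfolding pure_triplet_derived_def by (rule L.derived_incl[OF order.refl PL_subgroup])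

definition ab_class :: "nat word set \<Rightarrow> nat word set set" where
  "ab_class p = DPL #>\<^bsub>L\<^esub> p"

lemma ab_class_hom: "ab_class \<in> hom (pure_triplet_group n) ab"
  using normal.r_coset_hom_Mod[OF DPL_normal_PL]
  by (simp add: ab_class_def[abs_def] r_coset_def pure_triplet_group_def ab_def)

lemma ab_class_closed [simp]: "p \<in> PL \<Longrightarrow> ab_class p \<in> carrier ab"
  using ab_class_hom by (auto simp: hom_def pure_triplet_group_def)

lemma ab_class_mult:
  "p \<in> PL \<Longrightarrow> q \<in> PL \<Longrightarrow> ab_class (p \<otimes>\<^bsub>L\<^esub> q) = ab_class p \<otimes>\<^bsub>ab\<^esub> ab_class q"
  using hom_mult[OF ab_class_hom, of p q] by (simp add: pure_triplet_group_def)

lemma ab_class_one: "p \<in> PL \<Longrightarrow> ab_class p = \<one>\<^bsub>ab\<^esub> \<Longrightarrow> p \<in> DPL"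
  using L.coset_join1[of DPL p] PL_carrier normal_imp_subgroup[OF DPL_normal]
  by (simp add: ab_class_def ab_def)

text \<open>
  The change of height along the edge \<open>i\<close> at \<open>x\<close>.  It is taken in the abelianisation so that it
  becomes invariant under \<open>PL\<close> and depends only on the edge of the graph (\<open>edge_rise\<close>).
\<close>

definition rise :: "nat \<Rightarrow> nat word set \<Rightarrow> nat word set set" where
  "rise i x = ab_class (height i x) \<otimes>\<^bsub>ab\<^esub> inv\<^bsub>ab\<^esub> ab_class (height (i - 1) x)"

lemma height_closed [simp]:
  assumes "1 \<le> i" "i \<le> n - 2" "x \<in> carrier L"
  shows "height i x \<in> PL"
proof -
  have "i + 1 < n" using assms n_ge_4 by linarith
  then show ?thesis using height_PL assms by blast
qed

lemma edge_lift:
  assumes "e \<in> edges"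
  obtains i x where "2 \<le> i" "i \<le> n - 2" "x \<in> carrier L" "e = edge i (\<pi> x)"
proof -
  obtain i w where "2 \<le> i" "i \<le> n - 2" "w permutes {1..n}" "e = edge i w"
    using assms unfolding edges_def by blast
  then show ?thesis using \<pi>_surj[of w] that by blast
qed

definition lift :: "cell \<Rightarrow> nat word set" where
  "lift e = (SOME x. x \<in> carrier L \<and> e = edge (fst e) (\<pi> x))"

lemma lift:
  assumes "e \<in> edges"
  shows "lift e \<in> carrier L" "edge (fst e) (\<pi> (lift e)) = e"
proof -
  obtain i x where "x \<in> carrier L" "e = edge i (\<pi> x)" using edge_lift[OF assms] by metis
  then have "x \<in> carrier L \<and> e = edge (fst e) (\<pi> x)" by (simp add: edge_def)
  then have "lift e \<in> carrier L \<and> e = edge (fst e) (\<pi> (lift e))"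
    unfolding lift_def by (rule someI)
  then show "lift e \<in> carrier L" "edge (fst e) (\<pi> (lift e)) = e" by simp_all
qed

lemma fst_edges: "e \<in> edges \<Longrightarrow> 2 \<le> fst e \<and> fst e \<le> n - 2"
  unfolding edges_def edge_def by auto

definition edge_rise :: "cell \<Rightarrow> nat word set set" where
  "edge_rise e = rise (fst e) (lift e)"

lemma edge_rise:
  assumes i: "2 \<le> i" "i \<le> n - 2" and x: "x \<in> carrier L"
  shows "edge_rise (edge i (\<pi> x)) = rise i x"
proof -
  let ?e = "edge i (\<pi> x)"
  have e: "?e \<in> edges" using i x \<pi>_permutes by (intro edge_in_edges) auto
  have i': "1 \<le> i" "i + 1 < n" "1 \<le> i - 1" "i - 1 + 1 < n" "i - 1 \<le> n - 2" "i + 1 \<le> n" using i by auto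
  have fst: "fst ?e = i" by (simp add: edge_def)
  have "rise i (lift ?e) = rise i x"
  proof (rule depends_on_coset[OF i'(1) i'(6)])
    show "lift ?e \<in> carrier L" using lift(1)[OF e] .
    show "x \<in> carrier L" by (rule x)
    show "perm_coset {i..i + 1} (\<pi> (lift ?e)) = perm_coset {i..i + 1} (\<pi> x)"
      using lift(2)[OF e] unfolding fst by (simp add: edge_def)
    fix y assume y: "y \<in> carrier L"
    show "rise i (p \<otimes>\<^bsub>L\<^esub> y) = rise i y" if p: "p \<in> PL" for p
    proof -
      have "height i y \<in> PL" "height (i - 1) y \<in> PL" using i' i y by auto
      then have c: "ab_class (height i y) \<in> carrier ab" "ab_class (height (i - 1) y) \<in> carrier ab"
        "ab_class p \<in> carrier ab" using p by auto
      have "rise i (p \<otimes>\<^bsub>L\<^esub> y) = (ab_class p \<otimes>\<^bsub>ab\<^esub> ab_class (height i y)) \<otimes>\<^bsub>ab\<^esub>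
          inv\<^bsub>ab\<^esub> (ab_class p \<otimes>\<^bsub>ab\<^esub> ab_class (height (i - 1) y))"
        unfolding rise_def height_mult[OF i'(1,2) y p] height_mult[OF i'(3,4) y p]
        using \<open>height i y \<in> PL\<close> \<open>height (i - 1) y \<in> PL\<close> p by (simp only: ab_class_mult)
      also have "\<dots> = (ab_class p \<otimes>\<^bsub>ab\<^esub> inv\<^bsub>ab\<^esub> ab_class p) \<otimes>\<^bsub>ab\<^esub> rise i y"
        unfolding rise_def ab.inv_mult[OF c(3,2)] using c
        by (simp only: ab.m_ac ab.inv_closed ab.m_closed)
      also have "\<dots> = rise i y" using c by (simp add: rise_def)
      finally show ?thesis .
    qed
    show "rise i (y \<otimes>\<^bsub>L\<^esub> gen j) = rise i y" if "i \<le> j" "j < i + 1" for j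
    proof -
      have j: "j = i \<or> j = i + 1" "j = i - 1 \<or> j = i - 1 + 1" using that i by auto
      show ?thesis
        unfolding rise_def height_gen[OF i'(1,2) y j(1)] height_gen[OF i'(3,4) y j(2)] ..
    qed
  qed
  then show ?thesis by (simp add: edge_rise_def fst)
qed

lemma edge_rise_closed: "edge_rise \<in> edges \<rightarrow> carrier ab"
proof
  fix e assume "e \<in> edges"
  then obtain i x where "2 \<le> i" "i \<le> n - 2" "x \<in> carrier L" "e = edge i (\<pi> x)" by (rule edge_lift)
  then show "edge_rise e \<in> carrier ab" by (simp add: edge_rise rise_def)
qed

abbreviation total_rise :: "(cell \<Rightarrow> int) \<Rightarrow> nat word set set" where
  "total_rise \<equiv> ab.weighted_product edges edge_rise"

lemma total_rise_walk:
  assumes m: "1 \<le> m" "m \<le> n - 2" and x: "x \<in> carrier L"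
  shows "total_rise (walk m (\<pi> x)) = ab_class (height m x) \<otimes>\<^bsub>ab\<^esub> inv\<^bsub>ab\<^esub> ab_class (height 1 x)"
  using m
proof (induction m rule: nat_induct_at_least)
  case base
  then show ?case using x by (simp add: walk_trivial ab.weighted_product_zero)
next
  case (Suc m)
  have m: "m \<le> n - 2" "2 \<le> m + 1" "m + 1 \<le> n - 2" using Suc by auto
  have e: "edge (m + 1) (\<pi> x) \<in> edges" using m x \<pi>_permutes by (intro edge_in_edges) auto
  have closed: "height m x \<in> PL" "height (m + 1) x \<in> PL" "height 1 x \<in> PL"
    using Suc m x by auto
  have "total_rise (walk (m + 1) (\<pi> x))
      = total_rise (walk m (\<pi> x)) \<otimes>\<^bsub>ab\<^esub> edge_rise (edge (m + 1) (\<pi> x))"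
    unfolding walk_step[OF Suc.hyps] using e
    by (simp add: ab.weighted_product_add edge_rise_closed ab.weighted_product_single)
  also have "\<dots> = (ab_class (height m x) \<otimes>\<^bsub>ab\<^esub> inv\<^bsub>ab\<^esub> ab_class (height 1 x)) \<otimes>\<^bsub>ab\<^esub>
      (ab_class (height (m + 1) x) \<otimes>\<^bsub>ab\<^esub> inv\<^bsub>ab\<^esub> ab_class (height m x))"
    using Suc.IH[OF m(1)] edge_rise[OF m(2,3) x] by (simp add: rise_def)
  also have "\<dots> = (ab_class (height m x) \<otimes>\<^bsub>ab\<^esub> inv\<^bsub>ab\<^esub> ab_class (height m x)) \<otimes>\<^bsub>ab\<^esub>
      (ab_class (height (m + 1) x) \<otimes>\<^bsub>ab\<^esub> inv\<^bsub>ab\<^esub> ab_class (height 1 x))"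
    using closed by (simp only: ab.m_ac ab_class_closed ab.inv_closed ab.m_closed)
  also have "\<dots> = ab_class (height (m + 1) x) \<otimes>\<^bsub>ab\<^esub> inv\<^bsub>ab\<^esub> ab_class (height 1 x)"
    using closed by simp
  finally show ?case by simp
qed

text \<open>
  Rises telescope along a path, so the total rise of \<open>chain x\<close> is the difference of the heights at its
  two ends.
\<close>

lemma total_rise_chain:
  assumes "x \<in> carrier L"
  shows "total_rise (chain x) = ab_class (height 1 x) \<otimes>\<^bsub>ab\<^esub> inv\<^bsub>ab\<^esub> ab_class (height 1 \<one>\<^bsub>L\<^esub>)"
  using assms
proof (induction rule: L_induct)
  case one
  have "height 1 \<one>\<^bsub>L\<^esub> \<in> PL" using n_ge_4 by auto
  then show ?case by (simp add: chain_one ab.weighted_product_zero)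
next
  case (step x j)
  let ?y = "x \<otimes>\<^bsub>L\<^esub> gen j"
  have y: "?y \<in> carrier L" "\<pi> ?y = \<pi> x \<circ> swap j"
    using step \<pi>.hom_mult[of x "gen j"] by auto
  have closed: "height 1 \<one>\<^bsub>L\<^esub> \<in> PL" "height 1 x \<in> PL" "height 1 ?y \<in> PL"
    using n_ge_4 step(1) y by auto
  have "total_rise (\<lambda>e. walk (j - 1) (\<pi> x) e - walk (j - 1) (\<pi> ?y) e)
      = ab_class (height 1 ?y) \<otimes>\<^bsub>ab\<^esub> inv\<^bsub>ab\<^esub> ab_class (height 1 x)"
  proof (cases "j = 1")
    case True
    have "height 1 ?y = height 1 x" using height_gen[of 1 x j] True n_ge_4 step by auto
    then show ?thesis using True closed by (simp add: walk_trivial ab.weighted_product_zero)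
  next
    case False
    define m where "m = j - 1"
    have m: "1 \<le> m" "m \<le> n - 2" "m + 1 < n" "j = m \<or> j = m + 1" using False step by (auto simp: m_def)
    have h: "height m ?y = height m x" using height_gen[OF m(1,3) step(1) m(4)] .
    have hc: "height m x \<in> PL" using m step by auto
    have "total_rise (\<lambda>e. walk m (\<pi> x) e - walk m (\<pi> ?y) e)
      = (ab_class (height m x) \<otimes>\<^bsub>ab\<^esub> inv\<^bsub>ab\<^esub> ab_class (height 1 x)) \<otimes>\<^bsub>ab\<^esub>
        inv\<^bsub>ab\<^esub> (ab_class (height m x) \<otimes>\<^bsub>ab\<^esub> inv\<^bsub>ab\<^esub> ab_class (height 1 ?y))"
      using total_rise_walk[OF m(1,2) step(1)] total_rise_walk[OF m(1,2) y(1)]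
      by (simp only: ab.weighted_product_diff[OF edge_rise_closed] h)
    also have "\<dots> = (ab_class (height m x) \<otimes>\<^bsub>ab\<^esub> inv\<^bsub>ab\<^esub> ab_class (height 1 x)) \<otimes>\<^bsub>ab\<^esub>
        (inv\<^bsub>ab\<^esub> ab_class (height m x) \<otimes>\<^bsub>ab\<^esub> ab_class (height 1 ?y))"
      using hc closed by (simp add: ab.inv_mult)
    also have "\<dots> = (ab_class (height m x) \<otimes>\<^bsub>ab\<^esub> inv\<^bsub>ab\<^esub> ab_class (height m x)) \<otimes>\<^bsub>ab\<^esub>
        (ab_class (height 1 ?y) \<otimes>\<^bsub>ab\<^esub> inv\<^bsub>ab\<^esub> ab_class (height 1 x))"
      using hc closed by (simp only: ab.m_ac ab_class_closed ab.inv_closed ab.m_closed)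
    finally show ?thesis using hc closed by (simp add: m_def)
  qed
  moreover have "chain ?y = (\<lambda>e. chain x e + (walk (j - 1) (\<pi> x) e - walk (j - 1) (\<pi> ?y) e))"
    unfolding y(2) using step by (intro chain_step)
  ultimately have "total_rise (chain ?y) = (ab_class (height 1 x) \<otimes>\<^bsub>ab\<^esub> inv\<^bsub>ab\<^esub> ab_class (height 1 \<one>\<^bsub>L\<^esub>))
      \<otimes>\<^bsub>ab\<^esub> (ab_class (height 1 ?y) \<otimes>\<^bsub>ab\<^esub> inv\<^bsub>ab\<^esub> ab_class (height 1 x))"
    using step.IH by (simp only: ab.weighted_product_add[OF edge_rise_closed])
  also have "\<dots> = (ab_class (height 1 x) \<otimes>\<^bsub>ab\<^esub> inv\<^bsub>ab\<^esub> ab_class (height 1 x))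
      \<otimes>\<^bsub>ab\<^esub> (ab_class (height 1 ?y) \<otimes>\<^bsub>ab\<^esub> inv\<^bsub>ab\<^esub> ab_class (height 1 \<one>\<^bsub>L\<^esub>))"
    using closed by (simp only: ab.m_ac ab_class_closed ab.inv_closed ab.m_closed)
  finally show ?case using closed by simp
qed

text \<open>
  For \<open>p\<close> in \<open>PL\<close> the heights of the two ends differ by \<open>p\<close> itself, so the total rise recovers the
  class of \<open>p\<close> from its chain.
\<close>

lemma chain_zero_imp_derived:
  assumes p: "p \<in> PL" and "chain p = (\<lambda>e. 0)"
  shows "p \<in> DPL"
proof -
  have one: "height 1 \<one>\<^bsub>L\<^esub> \<in> PL" using n_ge_4 by auto
  have "height 1 p = p \<otimes>\<^bsub>L\<^esub> height 1 \<one>\<^bsub>L\<^esub>"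
    using height_mult[of 1 "\<one>\<^bsub>L\<^esub>" p] n_ge_4 p PL_carrier by simp
  then have "total_rise (chain p)
      = ab_class p \<otimes>\<^bsub>ab\<^esub> ab_class (height 1 \<one>\<^bsub>L\<^esub>) \<otimes>\<^bsub>ab\<^esub> inv\<^bsub>ab\<^esub> ab_class (height 1 \<one>\<^bsub>L\<^esub>)"
    using total_rise_chain[OF PL_carrier[OF p]] p one by (simp add: ab_class_mult)
  also have "\<dots> = ab_class p" using p one by (simp add: ab.m_assoc)
  finally have "ab_class p = \<one>\<^bsub>ab\<^esub>" using assms(2) by (simp add: ab.weighted_product_zero)
  then show ?thesis using ab_class_one p by blast
qed

section \<open>Cycles coming from the pure group\<close>

text \<open>
  On \<open>PL\<close> the crossed homomorphism \<open>chain\<close> is a homomorphism to a commutative group.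
\<close>

lemma derived_imp_chain_zero:
  assumes "p \<in> DPL"
  shows "chain p = (\<lambda>e. 0)"
proof -
  have comm: "chain_hom (p \<otimes>\<^bsub>L\<^esub> q) = chain_hom (q \<otimes>\<^bsub>L\<^esub> p)" if "p \<in> PL" "q \<in> PL" for p q
  proof -
    have c: "p \<in> carrier L" "q \<in> carrier L" "\<pi> p = id" "\<pi> q = id" using that by (simp_all add: PL_iff)
    have "chain (p \<otimes>\<^bsub>L\<^esub> q) = chain (q \<otimes>\<^bsub>L\<^esub> p)"
      using chain_PL_mult[OF that(1) c(2)] chain_PL_mult[OF that(2) c(1)] by (simp add: add.commute)
    moreover have "snd (chain_hom (p \<otimes>\<^bsub>L\<^esub> q)) = snd (chain_hom (q \<otimes>\<^bsub>L\<^esub> p))"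
      using c snd_chain_hom[of "p \<otimes>\<^bsub>L\<^esub> q"] snd_chain_hom[of "q \<otimes>\<^bsub>L\<^esub> p"] \<pi>.hom_mult by simp
    ultimately show ?thesis unfolding chain_def by (rule prod_eqI)
  qed
  have "derived_set L PL \<subseteq> kernel L chain_extension chain_hom"
  proof (clarsimp simp: kernel_def)
    fix p q assume pq: "p \<in> PL" "q \<in> PL"
    then have c: "p \<in> carrier L" "q \<in> carrier L" using PL_carrier by auto
    have "p \<otimes>\<^bsub>L\<^esub> q \<otimes>\<^bsub>L\<^esub> inv\<^bsub>L\<^esub> p \<otimes>\<^bsub>L\<^esub> inv\<^bsub>L\<^esub> q = (p \<otimes>\<^bsub>L\<^esub> q) \<otimes>\<^bsub>L\<^esub> inv\<^bsub>L\<^esub> (q \<otimes>\<^bsub>L\<^esub> p)"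
      using c by (simp add: L.inv_mult_group L.m_assoc)
    moreover have "chain_hom ((p \<otimes>\<^bsub>L\<^esub> q) \<otimes>\<^bsub>L\<^esub> inv\<^bsub>L\<^esub> (q \<otimes>\<^bsub>L\<^esub> p)) = chain_hom ((q \<otimes>\<^bsub>L\<^esub> p) \<otimes>\<^bsub>L\<^esub> inv\<^bsub>L\<^esub> (q \<otimes>\<^bsub>L\<^esub> p))"
      using ch.hom_mult[of "p \<otimes>\<^bsub>L\<^esub> q" "inv\<^bsub>L\<^esub> (q \<otimes>\<^bsub>L\<^esub> p)"]
        ch.hom_mult[of "q \<otimes>\<^bsub>L\<^esub> p" "inv\<^bsub>L\<^esub> (q \<otimes>\<^bsub>L\<^esub> p)"] comm[OF pq] c by (simp del: L.r_inv)
    moreover have "(q \<otimes>\<^bsub>L\<^esub> p) \<otimes>\<^bsub>L\<^esub> inv\<^bsub>L\<^esub> (q \<otimes>\<^bsub>L\<^esub> p) = \<one>\<^bsub>L\<^esub>" using c by (intro L.r_inv) auto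
    ultimately have "chain_hom (p \<otimes>\<^bsub>L\<^esub> q \<otimes>\<^bsub>L\<^esub> inv\<^bsub>L\<^esub> p \<otimes>\<^bsub>L\<^esub> inv\<^bsub>L\<^esub> q) = chain_hom \<one>\<^bsub>L\<^esub>" by simp
    then show "p \<otimes>\<^bsub>L\<^esub> q \<otimes>\<^bsub>L\<^esub> inv\<^bsub>L\<^esub> p \<otimes>\<^bsub>L\<^esub> inv\<^bsub>L\<^esub> q \<in> carrier L \<and>
      chain_hom (p \<otimes>\<^bsub>L\<^esub> q \<otimes>\<^bsub>L\<^esub> inv\<^bsub>L\<^esub> p \<otimes>\<^bsub>L\<^esub> inv\<^bsub>L\<^esub> q) = \<one>\<^bsub>chain_extension\<^esub>"
      using c by simp
  qed
  from L.generate_subgroup_incl[OF this ch.subgroup_kernel]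
  have "chain_hom p = \<one>\<^bsub>chain_extension\<^esub>"
    using assms unfolding pure_triplet_derived_def derived_def kernel_def by blast
  then show ?thesis by (simp add: chain_def chain_extension_def)
qed

lemma chain_PL_diff:
  assumes "p \<in> PL" "q \<in> PL"
  shows "p \<otimes>\<^bsub>L\<^esub> inv\<^bsub>L\<^esub> q \<in> PL" "chain (p \<otimes>\<^bsub>L\<^esub> inv\<^bsub>L\<^esub> q) = (\<lambda>e. chain p e - chain q e)"
proof -
  show pq: "p \<otimes>\<^bsub>L\<^esub> inv\<^bsub>L\<^esub> q \<in> PL"
    using assms PL_subgroup by (simp add: subgroup.m_closed subgroup.m_inv_closed)
  have "p \<otimes>\<^bsub>L\<^esub> inv\<^bsub>L\<^esub> q \<otimes>\<^bsub>L\<^esub> q = p" using assms PL_carrier by (simp add: L.m_assoc)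
  then have "chain p = (\<lambda>e. chain (p \<otimes>\<^bsub>L\<^esub> inv\<^bsub>L\<^esub> q) e + chain q e)"
    using chain_PL_mult[OF pq PL_carrier[OF assms(2)]] by simp
  then show "chain (p \<otimes>\<^bsub>L\<^esub> inv\<^bsub>L\<^esub> q) = (\<lambda>e. chain p e - chain q e)" by (auto simp: fun_eq_iff)
qed

lemma ex_PL_combination:
  assumes "finite K" "\<And>k. k \<in> K \<Longrightarrow> g k \<in> PL"
  shows "\<exists>p\<in>PL. chain p = (\<lambda>e. \<Sum>k\<in>K. f k * chain (g k) e)"
proof -
  have neg: "\<exists>q\<in>PL. chain q = (\<lambda>e. - chain p e)" if "p \<in> PL" for p
    using chain_PL_diff[OF subgroup.one_closed[OF PL_subgroup] that]
    by (auto simp: chain_one intro!: bexI[of _ "\<one>\<^bsub>L\<^esub> \<otimes>\<^bsub>L\<^esub> inv\<^bsub>L\<^esub> p"])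
  have add: "\<exists>r\<in>PL. chain r = (\<lambda>e. chain p e + chain q e)" if "p \<in> PL" "q \<in> PL" for p q
    using chain_PL_mult[OF that(1) PL_carrier[OF that(2)]] subgroup.m_closed[OF PL_subgroup that]
    by blast
  have zero: "\<exists>p\<in>PL. chain p = (\<lambda>e. 0)"
    using chain_one subgroup.one_closed[OF PL_subgroup] by blast
  have nat_mult: "\<exists>q\<in>PL. chain q = (\<lambda>e. int m * chain p e)" if p: "p \<in> PL" for m p
  proof (induction m)
    case 0
    then show ?case using zero by simp
  next
    case (Suc m)
    then obtain q where q: "q \<in> PL" "chain q = (\<lambda>e. int m * chain p e)" by blast
    from add[OF this(1) p] show ?case by (simp add: q distrib_right add.commute)
  qed
  have int_mult: "\<exists>q\<in>PL. chain q = (\<lambda>e. z * chain p e)" if p: "p \<in> PL" for z p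
  proof (cases z rule: int_cases2)
    case (nonneg m)
    then show ?thesis using nat_mult[OF p] by blast
  next
    case (nonpos m)
    obtain q where q: "q \<in> PL" "chain q = (\<lambda>e. int m * chain p e)" using nat_mult[OF p] by blast
    from neg[OF this(1)] show ?thesis by (simp add: q nonpos)
  qed
  show ?thesis
    using assms
  proof (induction K rule: finite_induct)
    case empty
    then show ?case using zero by simp
  next
    case (insert k K)
    then obtain p q where "p \<in> PL" "chain p = (\<lambda>e. \<Sum>k\<in>K. f k * chain (g k) e)"
      "q \<in> PL" "chain q = (\<lambda>e. f k * chain (g k) e)"
      using int_mult[of "g k" "f k"] by auto
    then show ?case using add[of q p] insert by simp
  qed
qed

text \<open>
  An element \<open>x\<close> and a vertex \<open>i\<close> give the path that first follows \<open>x\<close> and then walks to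
  the vertex; subtracting the chain of the height removes the dependence on the choice of \<open>x\<close>.
\<close>

definition reduced_path :: "nat \<Rightarrow> nat word set \<Rightarrow> cell \<Rightarrow> int" where
  "reduced_path i x e = chain x e + walk i (\<pi> x) e - chain (height i x) e"

lemma reduced_path_cong:
  assumes i: "1 \<le> i" "i \<le> n - 2" and xy: "x \<in> carrier L" "y \<in> carrier L"
    and eq: "vert i (\<pi> x) = vert i (\<pi> y)"
  shows "reduced_path i x = reduced_path i y"
proof -
  have i': "i + 1 < n" "i + 2 \<le> n" using i n_ge_4 by linarith+
  show ?thesis
  proof (rule depends_on_coset[OF i(1) i'(2) _ _ xy])
    show "perm_coset {i..i + 2} (\<pi> x) = perm_coset {i..i + 2} (\<pi> y)"
      using eq by (simp add: vert_def)
    fix x assume x: "x \<in> carrier L"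
    show "reduced_path i (p \<otimes>\<^bsub>L\<^esub> x) = reduced_path i x" if p: "p \<in> PL" for p
    proof -
      have "\<pi> (p \<otimes>\<^bsub>L\<^esub> x) = \<pi> x" using p x by (simp add: PL_iff)
      moreover have "height i x \<in> carrier L" using height_closed[OF i x] by (rule PL_carrier)
      ultimately show ?thesis
        using height_mult[OF i(1) i'(1) x p] chain_PL_mult[OF p x]
          chain_PL_mult[OF p, of "height i x"]
        by (intro ext) (simp add: reduced_path_def)
    qed
    show "reduced_path i (x \<otimes>\<^bsub>L\<^esub> gen j) = reduced_path i x" if j: "i \<le> j" "j < i + 2" for j
    proof -
      have j': "1 \<le> j" "j < n" "j = i \<or> j = i + 1" using j i i' by auto
      have \<pi>: "\<pi> (x \<otimes>\<^bsub>L\<^esub> gen j) = \<pi> x \<circ> swap j" using j' x \<pi>.hom_mult[of x "gen j"] by simp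
      have "walk (j - 1) (\<pi> x) e - walk (j - 1) (\<pi> x \<circ> swap j) e
          = walk i (\<pi> x) e - walk i (\<pi> x \<circ> swap j) e" for e
        using j'(3) walk_diff_swap[OF i(1), of "\<pi> x" e] by auto
      then show ?thesis
        using chain_step[OF x j'(1,2)] height_gen[OF i(1) i'(1) x j'(3)]
        by (intro ext) (simp add: reduced_path_def \<pi>)
    qed
  qed
qed

lemma ex_vertex_path:
  "\<exists>Q. \<forall>i x. 1 \<le> i \<longrightarrow> i \<le> n - 2 \<longrightarrow> x \<in> carrier L \<longrightarrow> Q (vert i (\<pi> x)) = reduced_path i x"
proof -
  define Q where "Q = (\<lambda>v. reduced_path (fst v) (SOME x. x \<in> carrier L \<and> vert (fst v) (\<pi> x) = v))"
  have "Q (vert i (\<pi> x)) = reduced_path i x" if i: "1 \<le> i" "i \<le> n - 2" and x: "x \<in> carrier L" for i x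
  proof -
    let ?y = "SOME y. y \<in> carrier L \<and> vert i (\<pi> y) = vert i (\<pi> x)"
    have "?y \<in> carrier L \<and> vert i (\<pi> ?y) = vert i (\<pi> x)"
      by (rule someI[of _ x]) (use x in simp)
    then have "reduced_path i ?y = reduced_path i x" using reduced_path_cong[OF i _ x] by blast
    moreover have "fst (vert i (\<pi> x)) = i" by (simp add: vert_def)
    ultimately show ?thesis by (simp add: Q_def)
  qed
  then show ?thesis by blast
qed

text \<open>
  The element of \<open>PL\<close> by which the height changes along a lift of \<open>e\<close>.
\<close>

definition edge_loop :: "cell \<Rightarrow> nat word set" where
  "edge_loop e = height (fst e) (lift e) \<otimes>\<^bsub>L\<^esub> inv\<^bsub>L\<^esub> height (fst e - 1) (lift e)"

lemma edge_loop:
  assumes "e \<in> edges"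
  shows "edge_loop e \<in> PL"
    and "chain (edge_loop e)
      = (\<lambda>e'. chain (height (fst e) (lift e)) e' - chain (height (fst e - 1) (lift e)) e')"
proof -
  have "height (fst e) (lift e) \<in> PL" "height (fst e - 1) (lift e) \<in> PL"
    using fst_edges[OF assms] lift(1)[OF assms] by auto
  then show "edge_loop e \<in> PL"
    "chain (edge_loop e)
      = (\<lambda>e'. chain (height (fst e) (lift e)) e' - chain (height (fst e - 1) (lift e)) e')"
    unfolding edge_loop_def by (rule chain_PL_diff)+
qed

text \<open>
  Every edge is its loop up to a difference of terms attached to its two ends, and in a cycle such
  differences cancel.
\<close>

lemma closed_chain_expansion:
  assumes "closed_chain x"
  shows "x e' = (\<Sum>e\<in>edges. x e * real_chain (edge_loop e) e')"
proof -
  obtain Q where Q: "\<And>i x. 1 \<le> i \<Longrightarrow> i \<le> n - 2 \<Longrightarrow> x \<in> carrier L \<Longrightarrow> Q (vert i (\<pi> x)) = reduced_path i x"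
    using ex_vertex_path by blast
  have single: "of_bool (e' = e) = Q (head e) e' - Q (tail e) e' + chain (edge_loop e) e'"
    if e: "e \<in> edges" for e
  proof -
    define i where "i = fst e"
    define y where "y = lift e"
    have i: "2 \<le> i" "i \<le> n - 2" "1 \<le> i" "1 \<le> i - 1" "i - 1 \<le> n - 2"
      using fst_edges[OF e] by (auto simp: i_def)
    have y: "y \<in> carrier L" "edge i (\<pi> y) = e" using lift[OF e] by (auto simp: y_def i_def)
    have "head e = vert i (\<pi> y)" "tail e = vert (i - 1) (\<pi> y)"
      using y(2) head_edge tail_edge[OF i(3)] by metis+
    then have "Q (head e) e' - Q (tail e) e' = reduced_path i y e' - reduced_path (i - 1) y e'"
      using Q[OF i(3,2) y(1)] Q[OF i(4,5) y(1)] by simp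
    also have "\<dots> = walk i (\<pi> y) e' - walk (i - 1) (\<pi> y) e'
        - (chain (height i y) e' - chain (height (i - 1) y) e')"
      by (simp add: reduced_path_def)
    also have "chain (height i y) e' - chain (height (i - 1) y) e' = chain (edge_loop e) e'"
      using edge_loop(2)[OF e] by (simp add: i_def y_def)
    also have "walk i (\<pi> y) e' = walk (i - 1) (\<pi> y) e' + of_bool (e' = e)"
      using walk_step[OF i(4), of "\<pi> y"] i(3) y(2) by simp
    finally show ?thesis by simp
  qed
  have ends: "(\<Sum>e\<in>edges. x e * of_int (Q (head e) e' - Q (tail e) e')) = 0"
  proof -
    have "(\<Sum>e\<in>edges. x e * of_int (Q (head e) e' - Q (tail e) e'))
        = (\<Sum>e\<in>edges. \<Sum>v\<in>verts. of_int (Q v e') * (incidence v e * x e))"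
    proof (rule sum.cong)
      fix e assume "e \<in> edges"
      then have ht: "head e \<in> verts" "tail e \<in> verts" using head_tail_verts by auto
      have "(\<Sum>v\<in>verts. of_int (Q v e') * (incidence v e * x e))
          = (\<Sum>v\<in>verts. if v = head e then of_int (Q v e') * x e else 0)
            - (\<Sum>v\<in>verts. if v = tail e then of_int (Q v e') * x e else 0)"
        unfolding sum_subtractf[symmetric] incidence_def
        by (intro sum.cong) (auto simp: algebra_simps)
      then show "x e * of_int (Q (head e) e' - Q (tail e) e')
          = (\<Sum>v\<in>verts. of_int (Q v e') * (incidence v e * x e))"
        using ht by (simp add: algebra_simps)
    qed simp
    also have "\<dots> = (\<Sum>v\<in>verts. of_int (Q v e') * boundary x v)"
      unfolding boundary_def dot_def sum_distrib_left by (rule sum.swap)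
    also have "\<dots> = 0"
    proof (rule sum.neutral, rule ballI)
      fix v
      have "boundary x v = 0" using assms unfolding closed_chain_def by blast
      then show "of_int (Q v e') * boundary x v = 0" by simp
    qed
    finally show ?thesis .
  qed
  have "x e' = (\<Sum>e\<in>edges. if e = e' then x e else 0)"
    using assms unfolding closed_chain_def by (cases "e' \<in> edges") (simp, metis (full_types) sum.delta' finite_cells(1) sum.delta)
  also have "\<dots> = (\<Sum>e\<in>edges. x e * of_int (of_bool (e' = e)))" by (intro sum.cong) auto
  also have "\<dots> = (\<Sum>e\<in>edges. x e * of_int (Q (head e) e' - Q (tail e) e') + x e * real_chain (edge_loop e) e')"
  proof (rule sum.cong)
    fix e assume "e \<in> edges"
    from single[OF this] have "(of_int (of_bool (e' = e)) :: real)
        = of_int (Q (head e) e' - Q (tail e) e') + real_chain (edge_loop e) e'"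
      by (simp only: of_int_add)
    then show "x e * of_int (of_bool (e' = e))
        = x e * of_int (Q (head e) e' - Q (tail e) e') + x e * real_chain (edge_loop e) e'"
      by (simp only: distrib_left)
  qed simp
  also have "\<dots> = (\<Sum>e\<in>edges. x e * real_chain (edge_loop e) e')"
    using ends by (simp add: sum.distrib)
  finally show ?thesis .
qed

text \<open>
  The witness is the cycle of \<open>(y\<^sub>1 y\<^sub>3)\<^sup>2\<close>, a closed path of length four.  The edge
  \<open>edge 2 v\<close> determines \<open>v 1\<close> and \<open>v 4\<close>; these values tell the edge at the identity from the three
  others, and all four edges have \<open>v 1 = 1\<close> or \<open>v 1 = 2\<close>.  If \<open>s\<close> fixes the translate of this cycle
  by \<open>w\<close>, it therefore maps \<open>w 1\<close> to \<open>w 1\<close> or \<open>w 2\<close>, and \<open>w 2\<close> can be any point other than \<open>w 1\<close>.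
\<close>

lemma faithful_on_cycles:
  assumes s: "s permutes {1..n}" and fixed: "\<And>x. closed_chain x \<Longrightarrow> act s x = x"
  shows "s = id"
proof -
  define z where "z = gen 1 \<otimes>\<^bsub>L\<^esub> gen 3 \<otimes>\<^bsub>L\<^esub> gen 1 \<otimes>\<^bsub>L\<^esub> gen 3"
  have g: "gen 1 \<in> carrier L" "gen 3 \<in> carrier L" using n_ge_4 by auto
  have \<pi>g: "\<pi> (gen 1) = swap 1" "\<pi> (gen 3) = swap 3" using n_ge_4 by (auto intro!: \<pi>_gen)
  have \<pi>m: "\<pi> (x \<otimes>\<^bsub>L\<^esub> y) = \<pi> x \<circ> \<pi> y" if "x \<in> carrier L" "y \<in> carrier L" for x y
    using \<pi>.hom_mult[OF that] by simp
  have \<pi>z: "\<pi> z = id"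
    unfolding z_def using g by (simp only: \<pi>m L.m_closed \<pi>g) (auto simp: fun_eq_iff swap_apply)
  have z: "z \<in> PL" using \<pi>z g unfolding z_def by (auto simp: PL_iff)
  have w2: "walk 2 w e = of_bool (e = edge 2 w)" for w e by (simp add: walk_def)
  have c3: "chain (x \<otimes>\<^bsub>L\<^esub> gen 3) e = chain x e + (of_bool (e = edge 2 (\<pi> x)) - of_bool (e = edge 2 (\<pi> x \<circ> swap 3)))"
    if "x \<in> carrier L" for x e
    using chain_step[OF that, of 3] n_ge_4 by (simp add: w2)
  have c1: "chain (x \<otimes>\<^bsub>L\<^esub> gen 1) e = chain x e" if "x \<in> carrier L" for x e
    using chain_step[OF that, of 1] n_ge_4 by (simp add: walk_trivial)
  have s13: "swap 1 \<circ> swap 3 \<circ> swap 1 = swap 3" "swap 3 \<circ> swap 3 = id"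
    by (auto simp: fun_eq_iff swap_apply)
  have chain_z: "chain z e = of_bool (e = edge 2 (swap 1)) - of_bool (e = edge 2 (swap 1 \<circ> swap 3))
      + of_bool (e = edge 2 (swap 3)) - of_bool (e = edge 2 id)" for e
  proof -
    have "chain (gen 1) e = 0" using c1[of "\<one>\<^bsub>L\<^esub>" e] g by (simp add: chain_one)
    then show ?thesis
      unfolding z_def using g by (simp only: c3 c1 L.m_closed \<pi>m \<pi>g s13)
  qed
  have ends: "v 1 = w 1 \<and> v 4 = w 4" if "edge 2 v = edge 2 w" for v w :: "nat \<Rightarrow> nat"
    using that perm_coset_fixes[of "{2..3}" v w] unfolding edge_def by auto
  have nz: "chain z (edge 2 id) \<noteq> 0"
    using ends[of id "swap 1"] ends[of id "swap 3"] ends[of id "swap 1 \<circ> swap 3"]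
    unfolding chain_z by (auto simp: swap_apply)
  have near: "p 1 = 1 \<or> p 1 = 2" if "chain z (edge 2 p) \<noteq> 0" for p
  proof (rule ccontr)
    assume "\<not> (p 1 = 1 \<or> p 1 = 2)"
    then have "edge 2 p \<noteq> edge 2 id" "edge 2 p \<noteq> edge 2 (swap 1)" "edge 2 p \<noteq> edge 2 (swap 3)"
      "edge 2 p \<noteq> edge 2 (swap 1 \<circ> swap 3)"
      using ends[of p] by (fastforce simp: swap_apply)+
    then show False using that by (simp add: chain_z)
  qed
  have key: "s (w 1) = w 1 \<or> s (w 1) = w 2" if w: "w permutes {1..n}" for w
  proof -
    have "closed_chain (act w (real_chain z))" using closed_chain_act[OF w closed_chain_of_PL[OF z]] .
    from fixed[OF this] have eq: "act s (act w (real_chain z)) = act w (real_chain z)" .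
    have "act s (act w (real_chain z)) (edge 2 (s \<circ> w)) = real_chain z (edge 2 id)"
      using permutes_inv_o[OF s] permutes_inv_o[OF w]
      by (simp add: act_def move_edge flip: comp_assoc) 
    moreover have "act w (real_chain z) (edge 2 (s \<circ> w)) = real_chain z (edge 2 (inv' w \<circ> (s \<circ> w)))"
      by (simp add: act_def move_edge)
    ultimately have "chain z (edge 2 (inv' w \<circ> (s \<circ> w))) \<noteq> 0" using nz eq by simp
    from near[OF this] have "inv' w (s (w 1)) = 1 \<or> inv' w (s (w 1)) = 2" by simp
    then show ?thesis using permutes_inv_eq[OF w] by metis
  qed
  show ?thesis
  proof (rule ext)
    fix a
    show "s a = id a"
    proof (rule ccontr)
      assume ne: "s a \<noteq> id a"
      then have a: "a \<in> {1..n}" using s by (auto simp: permutes_def)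
      have "\<not> {1..n} \<subseteq> {a, s a}"
      proof
        assume "{1..n} \<subseteq> {a, s a}"
        then have "card {1..n} \<le> card {a, s a}" by (intro card_mono) auto
        also have "\<dots> \<le> 2" by (simp add: card_insert_if)
        finally show False using n_ge_4 by simp
      qed
      then obtain b where b: "b \<in> {1..n}" "b \<noteq> a" "b \<noteq> s a" by blast
      \<comment> \<open>\<open>w\<close> first exchanges \<open>1\<close> and \<open>a\<close>; this moves \<open>2\<close> to \<open>c\<close>, which is then exchanged with \<open>b\<close>\<close>
      define c where "c = Transposition.transpose 1 a 2"
      define w where "w = Transposition.transpose b c \<circ> Transposition.transpose 1 a"
      have c: "c \<in> {1..n}" "c \<noteq> a" using a n_ge_4 by (auto simp: c_def Transposition.transpose_def)
      have "w permutes {1..n}"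
        unfolding w_def using a b c n_ge_4 by (intro permutes_compose permutes_swap_id) auto
      moreover have "w 2 = b" unfolding w_def c_def comp_apply by (rule transpose_apply_second)
      moreover have "w 1 = a" using b c by (simp add: w_def)
      ultimately show False using key[of w] ne b by auto
    qed
  qed
qed

end

section \<open>The Euclidean group\<close>

definition mat_mul :: "nat \<Rightarrow> (nat \<Rightarrow> nat \<Rightarrow> real) \<Rightarrow> (nat \<Rightarrow> nat \<Rightarrow> real) \<Rightarrow> nat \<Rightarrow> nat \<Rightarrow> real" where
  "mat_mul d A B = (\<lambda>i j. \<Sum>k<d. A i k * B k j)"

definition mat_vec :: "nat \<Rightarrow> (nat \<Rightarrow> nat \<Rightarrow> real) \<Rightarrow> (nat \<Rightarrow> real) \<Rightarrow> nat \<Rightarrow> real" where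
  "mat_vec d A v = (\<lambda>i. \<Sum>k<d. A i k * v k)"

definition mat_transpose :: "(nat \<Rightarrow> nat \<Rightarrow> real) \<Rightarrow> nat \<Rightarrow> nat \<Rightarrow> real" where
  "mat_transpose A = (\<lambda>i j. A j i)"

definition square :: "nat \<Rightarrow> (nat \<Rightarrow> nat \<Rightarrow> real) \<Rightarrow> bool" where
  "square d A \<longleftrightarrow> (\<forall>i j. i \<ge> d \<or> j \<ge> d \<longrightarrow> A i j = 0)"

lemma mat_mul_assoc: "mat_mul d (mat_mul d A B) C = mat_mul d A (mat_mul d B C)"
proof (intro ext)
  fix i j
  have "(\<Sum>k<d. (\<Sum>l<d. A i l * B l k) * C k j) = (\<Sum>k<d. \<Sum>l<d. A i l * (B l k * C k j))"
    by (simp add: sum_distrib_right mult.assoc)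
  also have "\<dots> = (\<Sum>l<d. \<Sum>k<d. A i l * (B l k * C k j))" by (rule sum.swap)
  finally show "mat_mul d (mat_mul d A B) C i j = mat_mul d A (mat_mul d B C) i j"
    by (simp add: mat_mul_def sum_distrib_left)
qed

lemma mat_vec_mul: "mat_vec d (mat_mul d A B) v = mat_vec d A (mat_vec d B v)"
proof (rule ext)
  fix i
  have "(\<Sum>k<d. (\<Sum>l<d. A i l * B l k) * v k) = (\<Sum>k<d. \<Sum>l<d. A i l * (B l k * v k))"
    by (simp add: sum_distrib_right mult.assoc)
  also have "\<dots> = (\<Sum>l<d. \<Sum>k<d. A i l * (B l k * v k))" by (rule sum.swap)
  finally show "mat_vec d (mat_mul d A B) v i = mat_vec d A (mat_vec d B v) i"
    by (simp add: mat_mul_def mat_vec_def sum_distrib_left)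
qed

lemma sum_identity_matrix:
  "(\<Sum>k<d. identity_matrix d i k * f k) = (if i < d then f i else 0)"
  "(\<Sum>k<d. f k * identity_matrix d k i) = (if i < d then f i else 0)"
proof -
  have "(\<Sum>k<d. identity_matrix d i k * f k) = (\<Sum>k<d. if k = i then f i else 0)"
    by (intro sum.cong) (auto simp: identity_matrix_def)
  then show "(\<Sum>k<d. identity_matrix d i k * f k) = (if i < d then f i else 0)" by simp
  have "(\<Sum>k<d. f k * identity_matrix d k i) = (\<Sum>k<d. if k = i then f i else 0)"
    by (intro sum.cong) (auto simp: identity_matrix_def)
  then show "(\<Sum>k<d. f k * identity_matrix d k i) = (if i < d then f i else 0)" by simp
qed

lemma mat_mul_identity: "square d A \<Longrightarrow> mat_mul d (identity_matrix d) A = A"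
  by (intro ext) (auto simp: mat_mul_def sum_identity_matrix square_def)

lemma mat_vec_identity: "v \<in> real_vectors d \<Longrightarrow> mat_vec d (identity_matrix d) v = v"
  by (intro ext) (auto simp: mat_vec_def sum_identity_matrix real_vectors_def)

lemma square_mat_mul: "square d A \<Longrightarrow> square d B \<Longrightarrow> square d (mat_mul d A B)"
  by (auto simp: square_def mat_mul_def)

lemma square_identity: "square d (identity_matrix d)"
  by (auto simp: square_def identity_matrix_def)

lemma mat_vec_closed: "square d A \<Longrightarrow> mat_vec d A v \<in> real_vectors d"
  by (auto simp: square_def mat_vec_def real_vectors_def)

lemma mat_vec_add: "mat_vec d A (\<lambda>i. v i + w i) = (\<lambda>i. mat_vec d A v i + mat_vec d A w i)"
  by (simp add: mat_vec_def distrib_left sum.distrib)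

lemma orthogonal_iff:
  "A \<in> orthogonal_matrices d \<longleftrightarrow> square d A \<and> mat_mul d (mat_transpose A) A = identity_matrix d"
  by (simp add: orthogonal_matrices_def square_def mat_mul_def mat_transpose_def)

text \<open>
  The columns of an orthogonal matrix leave no room for a further orthonormal vector; applied to
  the part of a standard basis vector orthogonal to them this says that the rows are orthonormal.
\<close>

lemma orthogonal_transpose:
  assumes A: "A \<in> orthogonal_matrices d"
  shows "mat_transpose A \<in> orthogonal_matrices d"
proof -
  have sq: "square d A" and col: "\<And>i j. (\<Sum>k<d. A k i * A k j) = identity_matrix d i j"
    using A by (auto simp: orthogonal_iff mat_mul_def mat_transpose_def fun_eq_iff)
  have dot_col: "dot {..<d} (\<lambda>k. A k i) (\<lambda>k. A k j) = identity_matrix d i j" for i j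
    using col by (simp add: dot_def)
  have row: "(\<Sum>k<d. A i k * A j k) = identity_matrix d i j" for i j
  proof (cases "i < d \<and> j < d")
    case True
    define x where "x = (\<lambda>e. of_bool (e = i) - (\<Sum>k<d. A i k * A e k))"
    have "x j = 0"
    proof (rule orthonormal_complement[of "{..<d}" "{..<d}" "\<lambda>j k. A k j"])
      fix t j assume t: "\<And>e. e \<in> {..<d} \<Longrightarrow> (\<Sum>j\<in>{..<d}. t j * A e j) = 0" and j: "j \<in> {..<d}"
      have "0 = dot {..<d} (\<lambda>e. \<Sum>j<d. t j * A e j) (\<lambda>k. A k j)"
        using t by (simp add: dot_def)
      also have "\<dots> = (\<Sum>i<d. t i * identity_matrix d i j)"
        by (simp only: dot_left dot_col)
      finally show "t j = 0" using j by (simp add: sum_identity_matrix)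
    next
      fix m b
      assume "m + card {..<d} = card {..<d}"
        and exp: "\<And>x e. (\<And>j. j \<in> {..<d} \<Longrightarrow> dot {..<d} (\<lambda>k. A k j) x = 0) \<Longrightarrow> e \<in> {..<d}
          \<Longrightarrow> x e = proj {..<d} m b x e"
      then have m: "m = 0" by simp
      have "dot {..<d} (\<lambda>k. A k l) x = 0" if "l \<in> {..<d}" for l
      proof -
        have "dot {..<d} (\<lambda>k. A k l) (\<lambda>e. of_bool (e = i)) = (\<Sum>k<d. if k = i then A k l else 0)"
          unfolding dot_def by (intro sum.cong) auto
        also have "\<dots> = A i l" using True by simp
        finally have "dot {..<d} (\<lambda>k. A k l) x = A i l - (\<Sum>k<d. A i k * identity_matrix d l k)"
          unfolding x_def by (simp only: dot_right dot_col)
        also have "(\<Sum>k<d. A i k * identity_matrix d l k) = A i l"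
          using that sum_identity_matrix(1)[of d l "A i"] by (simp add: mult.commute)
        finally show ?thesis by simp
      qed
      from exp[OF this, of j] show ?thesis using True by (simp add: proj_def m)
    qed auto
    then have "(\<Sum>k<d. A i k * A j k) = of_bool (j = i)" by (simp add: x_def)
    then show ?thesis using True by (auto simp: identity_matrix_def)
  next
    case False
    then have "\<forall>k. A i k = 0 \<or> A j k = 0" "identity_matrix d i j = 0"
      using sq by (auto simp: square_def identity_matrix_def)
    then show ?thesis by (metis (no_types, lifting) mult_eq_0_iff sum.neutral)
  qed
  then show ?thesis
    using sq by (auto simp: orthogonal_iff square_def mat_mul_def mat_transpose_def)
qed

lemma euclidean_mult:
  "(v, A) \<otimes>\<^bsub>euclidean_group d\<^esub> (w, B) = (\<lambda>i. v i + mat_vec d A w i, mat_mul d A B)"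
  by (simp add: euclidean_group_def mat_vec_def mat_mul_def)

lemma euclidean_carrier:
  "(v, A) \<in> carrier (euclidean_group d) \<longleftrightarrow> v \<in> real_vectors d \<and> A \<in> orthogonal_matrices d"
  by (simp add: euclidean_group_def)

lemma euclidean_one: "\<one>\<^bsub>euclidean_group d\<^esub> = (\<lambda>i. 0, identity_matrix d)"
  by (simp add: euclidean_group_def)

lemma mat_transpose_mul: "mat_transpose (mat_mul d A B) = mat_mul d (mat_transpose B) (mat_transpose A)"
  by (simp add: mat_transpose_def mat_mul_def mult.commute)

lemma group_euclidean_group: "group (euclidean_group d)"
proof (rule groupI)
  fix x y z :: isometry
  assume x: "x \<in> carrier (euclidean_group d)" and y: "y \<in> carrier (euclidean_group d)"
  obtain v A w B u C where eqs: "x = (v, A)" "y = (w, B)" "z = (u, C)"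
    by (cases x, cases y, cases z)
  have sq: "square d A" "square d B" and v: "v \<in> real_vectors d"
    and orth: "mat_mul d (mat_transpose A) A = identity_matrix d"
      "mat_mul d (mat_transpose B) B = identity_matrix d"
    using x y by (simp_all add: eqs euclidean_carrier orthogonal_iff)
  have "mat_mul d (mat_transpose (mat_mul d A B)) (mat_mul d A B)
      = mat_mul d (mat_transpose B) (mat_mul d (mat_mul d (mat_transpose A) A) B)"
    by (simp only: mat_transpose_mul mat_mul_assoc)
  also have "\<dots> = identity_matrix d" using orth sq by (simp add: mat_mul_identity)
  finally have "mat_mul d A B \<in> orthogonal_matrices d"
    using sq by (simp add: orthogonal_iff square_mat_mul)
  moreover have "(\<lambda>i. v i + mat_vec d A w i) \<in> real_vectors d"
    using v mat_vec_closed[OF sq(1), of w] by (simp add: real_vectors_def)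
  ultimately show "x \<otimes>\<^bsub>euclidean_group d\<^esub> y \<in> carrier (euclidean_group d)"
    by (simp add: eqs euclidean_mult euclidean_carrier)
  show "x \<otimes>\<^bsub>euclidean_group d\<^esub> y \<otimes>\<^bsub>euclidean_group d\<^esub> z
      = x \<otimes>\<^bsub>euclidean_group d\<^esub> (y \<otimes>\<^bsub>euclidean_group d\<^esub> z)"
    by (simp add: eqs euclidean_mult mat_mul_assoc mat_vec_mul mat_vec_add add.assoc)
  show "\<one>\<^bsub>euclidean_group d\<^esub> \<otimes>\<^bsub>euclidean_group d\<^esub> x = x"
    using v sq by (simp add: eqs euclidean_one euclidean_mult mat_mul_identity mat_vec_identity)
  have At: "mat_transpose A \<in> orthogonal_matrices d"
    using x by (intro orthogonal_transpose) (simp add: eqs euclidean_carrier)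
  define v' where "v' = (\<lambda>i. - mat_vec d (mat_transpose A) v i)"
  have "v' \<in> real_vectors d"
    using mat_vec_closed[of d "mat_transpose A" v] At
    by (simp add: v'_def real_vectors_def orthogonal_iff)
  moreover have "(v', mat_transpose A) \<otimes>\<^bsub>euclidean_group d\<^esub> x = \<one>\<^bsub>euclidean_group d\<^esub>"
    using orth(1) by (simp add: eqs euclidean_mult euclidean_one v'_def)
  ultimately show "\<exists>y\<in>carrier (euclidean_group d). y \<otimes>\<^bsub>euclidean_group d\<^esub> x = \<one>\<^bsub>euclidean_group d\<^esub>"
    using At euclidean_carrier by blast
next
  have "mat_mul d (mat_transpose (identity_matrix d)) (identity_matrix d) = identity_matrix d"
    by (intro ext) (simp add: mat_mul_def mat_transpose_def sum_identity_matrix, simp add: identity_matrix_def)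
  then show "\<one>\<^bsub>euclidean_group d\<^esub> \<in> carrier (euclidean_group d)"
    by (simp add: euclidean_one euclidean_carrier orthogonal_iff square_identity real_vectors_def)
qed

lemma topspace_euclidean: "topspace (euclidean_group_topology d) = carrier (euclidean_group d)"
  by (simp add: euclidean_group_topology_def)

lemma compact_pointwise:
  fixes K :: "'i \<Rightarrow> 'b::topological_space set"
  assumes "\<And>i. compact (K i)"
  shows "compact {f. \<forall>i. f i \<in> K i}"
proof -
  have "compactin (product_topology (\<lambda>i. euclidean) UNIV) (PiE UNIV K)"
    using assms by (simp add: compactin_PiE)
  moreover have "PiE UNIV K = {f. \<forall>i. f i \<in> K i}" by auto
  ultimately show ?thesis by (simp add: euclidean_product_topology)
qed

lemma continuous_entry: "continuous_on UNIV (\<lambda>A :: nat \<Rightarrow> nat \<Rightarrow> real. A i j)"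
  by (rule continuous_on_product_then_coordinatewise[OF continuous_on_product_coordinates])

lemma compact_orthogonal_matrices: "compact (orthogonal_matrices d)"
proof -
  have "closed {A :: nat \<Rightarrow> nat \<Rightarrow> real. (i \<ge> d \<or> j \<ge> d) \<longrightarrow> A i j = 0}" for i j
    by (cases "i \<ge> d \<or> j \<ge> d") (auto intro!: closed_Collect_eq continuous_entry continuous_on_const)
  moreover have "closed {A. (\<Sum>k<d. A k i * A k j) = identity_matrix d i j}" for i j
    by (intro closed_Collect_eq continuous_on_sum continuous_on_mult continuous_entry continuous_on_const)
  moreover have "orthogonal_matrices d
      = (\<Inter>i. \<Inter>j. {A. (i \<ge> d \<or> j \<ge> d) \<longrightarrow> A i j = 0})
        \<inter> (\<Inter>i. \<Inter>j. {A. (\<Sum>k<d. A k i * A k j) = identity_matrix d i j})"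
    by (auto simp: orthogonal_matrices_def fun_eq_iff)
  ultimately have closed: "closed (orthogonal_matrices d)"
    by (simp only:) (intro closed_Int closed_INT ballI)
  have sub: "orthogonal_matrices d \<subseteq> {A. \<forall>i. A i \<in> {f. \<forall>j. f j \<in> {-1..1}}}"
  proof (clarsimp)
    fix A i j assume A: "A \<in> orthogonal_matrices d"
    show "-1 \<le> A i j \<and> A i j \<le> 1"
    proof (cases "i < d \<and> j < d")
      case True
      have "A i j * A i j \<le> (\<Sum>k<d. A k j * A k j)"
        using True by (intro member_le_sum) auto
      also have "\<dots> = 1"
        using A True by (simp add: orthogonal_matrices_def fun_eq_iff identity_matrix_def)
      finally have "\<bar>A i j\<bar> \<le> 1" using abs_square_le_1[of "A i j"] by (simp add: power2_eq_square)
      then show ?thesis by linarith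
    next
      case False
      then have "A i j = 0" using A by (auto simp: orthogonal_matrices_def)
      then show ?thesis by simp
    qed
  qed
  have "compact {A :: nat \<Rightarrow> nat \<Rightarrow> real. \<forall>i. A i \<in> {f. \<forall>j. f j \<in> {-1..1}}}"
    by (intro compact_pointwise compact_Icc)
  then show ?thesis using closed sub by (metis compact_Int_closed inf.absorb_iff2)
qed

text \<open>
  A subgroup is cocompact once a bounded set of translation parts meets every coset: the set
  of all isometries with such translation parts is compact and maps onto the coset space.
\<close>

lemma uniform_subgroupI:
  assumes sub: "subgroup \<Gamma> (euclidean_group d)"
    and bounded: "\<And>v A. (v, A) \<in> carrier (euclidean_group d) \<Longrightarrow>
      \<exists>\<gamma>\<in>\<Gamma>. \<exists>w. \<gamma> \<otimes>\<^bsub>euclidean_group d\<^esub> (v, A) = (w, A) \<and> (\<forall>k<d. \<bar>w k\<bar> \<le> B)"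
  shows "uniform_subgroup d \<Gamma>"
proof -
  interpret E: group "euclidean_group d" by (rule group_euclidean_group)
  let ?E = "euclidean_group d" and ?T = "euclidean_group_topology d"
  let ?X = "coset_space_topology d \<Gamma>"
  let ?P = "\<lambda>\<U>. \<U> \<subseteq> rcosets\<^bsub>?E\<^esub> \<Gamma> \<and> openin ?T (\<Union>\<U>)"
  have disj: "C = D" if "C \<in> rcosets\<^bsub>?E\<^esub> \<Gamma>" "D \<in> rcosets\<^bsub>?E\<^esub> \<Gamma>" "x \<in> C" "x \<in> D" for C D x
  proof (rule ccontr)
    assume "C \<noteq> D"
    then have "disjnt C D" using pairwiseD[OF E.rcos_disjoint[OF sub] that(1,2)] by blast
    then show False using that(3,4) unfolding disjnt_iff by blast
  qed
  have "istopology ?P"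
    unfolding istopology_def
  proof (intro conjI allI impI)
    fix \<U> \<V> assume U: "?P \<U>" and V: "?P \<V>"
    have "C = D" if "C \<in> \<U>" "D \<in> \<V>" "x \<in> C" "x \<in> D" for C D x
      using disj[of C D x] that U V by blast
    then have "\<Union>(\<U> \<inter> \<V>) = \<Union>\<U> \<inter> \<Union>\<V>" by blast
    then show "openin ?T (\<Union>(\<U> \<inter> \<V>))" using U V by (simp add: openin_Int)
    show "\<U> \<inter> \<V> \<subseteq> rcosets\<^bsub>?E\<^esub> \<Gamma>" using U by blast
  next
    fix \<K> assume K: "\<forall>\<U>\<in>\<K>. ?P \<U>"
    have "\<Union>(\<Union>\<K>) = \<Union>((\<lambda>\<U>. \<Union>\<U>) ` \<K>)" by blast
    moreover have "openin ?T (\<Union>((\<lambda>\<U>. \<Union>\<U>) ` \<K>))" using K by (intro openin_Union) auto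
    ultimately show "openin ?T (\<Union>(\<Union>\<K>))" by simp
    show "\<Union>\<K> \<subseteq> rcosets\<^bsub>?E\<^esub> \<Gamma>" using K by blast
  qed
  then have openin_X: "openin ?X \<U> \<longleftrightarrow> ?P \<U>" for \<U>
    unfolding coset_space_topology_def by (simp add: topology_inverse')
  have "openin ?T (\<Union>(rcosets\<^bsub>?E\<^esub> \<Gamma>))"
    unfolding E.rcosets_part_G[OF sub] using openin_topspace[of ?T] by (simp add: topspace_euclidean)
  then have top: "topspace ?X = rcosets\<^bsub>?E\<^esub> \<Gamma>"
    unfolding topspace_def openin_X by blast
  define q where "q = (\<lambda>x. \<Gamma> #>\<^bsub>?E\<^esub> x)"
  have q_in: "q x \<in> rcosets\<^bsub>?E\<^esub> \<Gamma>" if "x \<in> carrier ?E" for x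
    unfolding q_def using subgroup.subset[OF sub] that by (rule E.rcosetsI)
  have q_self: "x \<in> q x" if "x \<in> carrier ?E" for x
    unfolding q_def using that sub by (rule E.rcos_self)
  have cont: "continuous_map ?T ?X q"
    unfolding continuous_map_def
  proof (intro conjI allI impI)
    show "q \<in> topspace ?T \<rightarrow> topspace ?X" by (simp add: top topspace_euclidean q_in)
    fix \<U> assume "openin ?X \<U>"
    then have U: "\<U> \<subseteq> rcosets\<^bsub>?E\<^esub> \<Gamma>" "openin ?T (\<Union>\<U>)" by (simp_all add: openin_X)
    have "{x \<in> topspace ?T. q x \<in> \<U>} = \<Union>\<U>"
    proof
      show "{x \<in> topspace ?T. q x \<in> \<U>} \<subseteq> \<Union>\<U>" using q_self by (auto simp: topspace_euclidean)
      show "\<Union>\<U> \<subseteq> {x \<in> topspace ?T. q x \<in> \<U>}"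
      proof
        fix x assume "x \<in> \<Union>\<U>"
        then obtain C where C: "C \<in> \<U>" "x \<in> C" by blast
        then have x: "x \<in> carrier ?E" using openin_subset[OF U(2)] topspace_euclidean by blast
        then have "q x = C" using disj[OF q_in[OF x] _ q_self[OF x] C(2)] C(1) U(1) by blast
        then show "x \<in> {x \<in> topspace ?T. q x \<in> \<U>}" using C x by (simp add: topspace_euclidean)
      qed
    qed
    then show "openin ?T {x \<in> topspace ?T. q x \<in> \<U>}" using U(2) by simp
  qed
  define K where "K = {w. \<forall>k. w k \<in> (if k < d then {-B..B} else {0::real})}"
  have "compact (K \<times> orthogonal_matrices d)"
    unfolding K_def by (intro compact_Times compact_orthogonal_matrices compact_pointwise) simp
  moreover have sub_K: "K \<times> orthogonal_matrices d \<subseteq> carrier ?E"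
  proof -
    have "K \<subseteq> real_vectors d"
    proof
      fix w assume "w \<in> K"
      then have "w k \<in> (if k < d then {-B..B} else {0})" for k unfolding K_def by blast
      then have "w k = 0" if "k \<ge> d" for k using that by (metis not_le singletonD)
      then show "w \<in> real_vectors d" by (simp add: real_vectors_def)
    qed
    then show ?thesis by (auto simp: euclidean_carrier)
  qed
  ultimately have "compactin ?T (K \<times> orthogonal_matrices d)"
    unfolding euclidean_group_topology_def by (simp add: compactin_subtopology)
  then have "compactin ?X (q ` (K \<times> orthogonal_matrices d))"
    using cont by (rule image_compactin)
  moreover have "q ` (K \<times> orthogonal_matrices d) = topspace ?X"
  proof
    show "q ` (K \<times> orthogonal_matrices d) \<subseteq> topspace ?X" using sub_K q_in top by auto
    show "topspace ?X \<subseteq> q ` (K \<times> orthogonal_matrices d)"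
    proof
      fix C assume "C \<in> topspace ?X"
      then obtain x where x: "x \<in> carrier ?E" "C = q x" unfolding top RCOSETS_def q_def by blast
      obtain v A where va: "x = (v, A)" by (cases x)
      then obtain \<gamma> w where g: "\<gamma> \<in> \<Gamma>" "\<gamma> \<otimes>\<^bsub>?E\<^esub> x = (w, A)" "\<forall>k<d. \<bar>w k\<bar> \<le> B"
        using bounded x by blast
      have "\<gamma> \<in> carrier ?E" using subgroup.mem_carrier[OF sub g(1)] .
      then have "(w, A) \<in> carrier ?E" using g(2) x(1) E.m_closed by metis
      then have "(w, A) \<in> K \<times> orthogonal_matrices d"
        using g(3) by (auto simp: K_def euclidean_carrier real_vectors_def abs_le_iff)
      moreover have "(w, A) \<in> \<Gamma> #>\<^bsub>?E\<^esub> x" using g unfolding r_coset_def by force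
      then have "q (w, A) = C" using E.repr_independence[OF _ x(1) sub] x(2) by (simp add: q_def)
      ultimately show "C \<in> q ` (K \<times> orthogonal_matrices d)" by blast
    qed
  qed
  ultimately show ?thesis
    unfolding uniform_subgroup_def compact_space_def using sub by simp
qed

section \<open>The triplet group as a group of isometries\<close>

locale triplet_basis = triplet +
  fixes d :: nat and b :: "nat \<Rightarrow> cell \<Rightarrow> real"
  assumes orthonormal_basis: "orthonormal edges d b"
    and basis_closed: "k < d \<Longrightarrow> closed_chain (b k)"
    and basis_expand: "closed_chain x \<Longrightarrow> x e = proj edges d b x e"
begin

definition coords :: "(cell \<Rightarrow> real) \<Rightarrow> nat \<Rightarrow> real" where
  "coords x = (\<lambda>k. if k < d then dot edges (b k) x else 0)"

definition rotation :: "(nat \<Rightarrow> nat) \<Rightarrow> nat \<Rightarrow> nat \<Rightarrow> real" where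
  "rotation p = (\<lambda>k l. if k < d \<and> l < d then dot edges (b k) (act p (b l)) else 0)"

definition motion :: "nat word set \<Rightarrow> isometry" where
  "motion x = (coords (real_chain x), rotation (\<pi> x))"

lemma coords_closed: "coords x \<in> real_vectors d"
  by (simp add: coords_def real_vectors_def)

lemma coords_zero: "coords (\<lambda>e. 0) = (\<lambda>k. 0)"
  by (auto simp: coords_def)

lemma expand_coords: "closed_chain x \<Longrightarrow> x e = (\<Sum>k<d. coords x k * b k e)"
  using basis_expand[of x e] by (simp add: proj_def coords_def dot_commute)

lemma dot_coords:
  assumes "closed_chain x"
  shows "dot edges y x = (\<Sum>k<d. coords x k * coords y k)"
proof -
  have "dot edges y x = dot edges y (\<lambda>e. \<Sum>k<d. coords x k * b k e)"
    by (rule dot_cong) (simp_all flip: expand_coords[OF assms])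
  also have "\<dots> = (\<Sum>k<d. coords x k * dot edges y (b k))" by (simp only: dot_right)
  finally show ?thesis by (simp add: coords_def dot_commute)
qed

text \<open>
  Taking coordinates projects onto the cycles.  This commutes with the action, because the
  action is orthogonal and preserves the cycles; so the chains themselves need not be closed.
\<close>

lemma coords_act:
  assumes p: "p permutes {1..n}"
  shows "coords (act p y) = mat_vec d (rotation p) (coords y)"
proof (rule ext)
  fix k
  show "coords (act p y) k = mat_vec d (rotation p) (coords y) k"
  proof (cases "k < d")
    case True
    let ?x = "act (inv' p) (b k)"
    have x: "closed_chain ?x" using closed_chain_act[OF permutes_inv[OF p] basis_closed[OF True]] .
    have "coords (act p y) k = dot edges (act p y) (b k)" using True by (simp add: coords_def dot_commute)
    also have "\<dots> = dot edges y ?x" by (rule dot_act[OF p])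
    also have "\<dots> = (\<Sum>l<d. coords ?x l * coords y l)" by (rule dot_coords[OF x])
    also have "\<dots> = (\<Sum>l<d. rotation p k l * coords y l)"
    proof (rule sum.cong)
      fix l assume l: "l \<in> {..<d}"
      have "coords ?x l = dot edges (act p (b l)) (b k)"
        using l dot_act[OF p, of "b l" "b k"] by (simp add: coords_def)
      then show "coords ?x l * coords y l = rotation p k l * coords y l"
        using l True by (simp add: rotation_def dot_commute)
    qed simp
    finally show ?thesis by (simp add: mat_vec_def)
  next
    case False
    then show ?thesis by (simp add: coords_def mat_vec_def rotation_def)
  qed
qed

lemma rotation_comp:
  assumes p: "p permutes {1..n}" and q: "q permutes {1..n}"
  shows "rotation (p \<circ> q) = mat_mul d (rotation p) (rotation q)"
proof (intro ext)
  fix k l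
  show "rotation (p \<circ> q) k l = mat_mul d (rotation p) (rotation q) k l"
  proof (cases "k < d \<and> l < d")
    case True
    have "rotation (p \<circ> q) k l = coords (act p (act q (b l))) k"
      using True by (simp add: rotation_def coords_def act_comp[OF p q])
    also have "\<dots> = (\<Sum>m<d. rotation p k m * coords (act q (b l)) m)"
      unfolding coords_act[OF p] by (simp add: mat_vec_def)
    also have "\<dots> = (\<Sum>m<d. rotation p k m * rotation q m l)"
      using True by (intro sum.cong) (auto simp: rotation_def coords_def)
    finally show ?thesis by (simp add: mat_mul_def)
  next
    case False
    then show ?thesis by (auto simp: rotation_def mat_mul_def)
  qed
qed

lemma rotation_id: "rotation id = identity_matrix d"
  using orthonormal_basis by (intro ext) (auto simp: rotation_def identity_matrix_def orthonormal_def)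

lemma rotation_orthogonal:
  assumes p: "p permutes {1..n}"
  shows "rotation p \<in> orthogonal_matrices d"
proof -
  have "mat_transpose (rotation p) = rotation (inv' p)"
    using dot_act[OF p]
    by (intro ext) (auto simp: mat_transpose_def rotation_def dot_commute[of edges "b _" "act p _"])
  then have "mat_mul d (mat_transpose (rotation p)) (rotation p) = rotation (inv' p \<circ> p)"
    using rotation_comp[OF permutes_inv[OF p] p] by simp
  also have "\<dots> = identity_matrix d" using permutes_inv_o[OF p] rotation_id by simp
  finally show ?thesis by (simp add: orthogonal_iff square_def rotation_def)
qed

text \<open>
  A matrix is the identity only if the permutation fixes every cycle.
\<close>

lemma rotation_inj:
  assumes p: "p permutes {1..n}" and q: "q permutes {1..n}" and eq: "rotation p = rotation q"
  shows "p = q"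
proof -
  have r: "inv' q \<circ> p permutes {1..n}" using permutes_compose[OF p permutes_inv[OF q]] .
  have "rotation (inv' q \<circ> p) = rotation (inv' q \<circ> q)"
    unfolding rotation_comp[OF permutes_inv[OF q] p] rotation_comp[OF permutes_inv[OF q] q] eq ..
  then have id: "rotation (inv' q \<circ> p) = identity_matrix d"
    using permutes_inv_o[OF q] rotation_id by simp
  have "inv' q \<circ> p = id"
  proof (rule faithful_on_cycles[OF r])
    fix x assume x: "closed_chain x"
    have "coords (act (inv' q \<circ> p) x) = coords x"
      unfolding coords_act[OF r] id by (rule mat_vec_identity[OF coords_closed])
    then show "act (inv' q \<circ> p) x = x"
      using expand_coords[OF x] expand_coords[OF closed_chain_act[OF r x]] by (auto simp: fun_eq_iff)
  qed
  then have "q \<circ> (inv' q \<circ> p) = q" by simp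
  then show ?thesis using permutes_inv_o[OF q] by (simp flip: comp_assoc)
qed

lemma motion_hom: "motion \<in> hom L (euclidean_group d)"
proof (rule homI)
  fix x y assume x: "x \<in> carrier L" and y: "y \<in> carrier L"
  show "motion x \<in> carrier (euclidean_group d)"
    using coords_closed rotation_orthogonal \<pi>_permutes[OF x]
    by (simp add: motion_def euclidean_carrier)
  have "coords (real_chain (x \<otimes>\<^bsub>L\<^esub> y)) = (\<lambda>k. coords (real_chain x) k + coords (act (\<pi> x) (real_chain y)) k)"
    using chain_mult[OF x y] by (auto simp: coords_def dot_right act_def)
  moreover have "rotation (\<pi> (x \<otimes>\<^bsub>L\<^esub> y)) = mat_mul d (rotation (\<pi> x)) (rotation (\<pi> y))"
    using rotation_comp[OF \<pi>_permutes[OF x] \<pi>_permutes[OF y]] \<pi>.hom_mult[OF x y] by simp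
  ultimately show "motion (x \<otimes>\<^bsub>L\<^esub> y) = motion x \<otimes>\<^bsub>euclidean_group d\<^esub> motion y"
    by (simp add: motion_def euclidean_mult coords_act[OF \<pi>_permutes[OF x]])
qed

lemma motion_PL: "p \<in> PL \<Longrightarrow> motion p = (coords (real_chain p), identity_matrix d)"
  by (simp add: motion_def PL_iff rotation_id)

lemma chain_zero_iff_coords:
  assumes "p \<in> PL"
  shows "coords (real_chain p) = (\<lambda>k. 0) \<longleftrightarrow> chain p = (\<lambda>e. 0)"
proof
  assume "coords (real_chain p) = (\<lambda>k. 0)"
  then have "real_chain p e = 0" for e using expand_coords[OF closed_chain_of_PL[OF assms], of e] by simp
  then show "chain p = (\<lambda>e. 0)" by (simp add: fun_eq_iff)
qed (simp add: coords_zero)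

lemma motion_kernel: "kernel L (euclidean_group d) motion = DPL"
proof
  show "kernel L (euclidean_group d) motion \<subseteq> DPL"
  proof
    fix x assume "x \<in> kernel L (euclidean_group d) motion"
    then have x: "x \<in> carrier L" and "rotation (\<pi> x) = rotation id" and
      c: "coords (real_chain x) = (\<lambda>k. 0)"
      by (auto simp: kernel_def motion_def euclidean_one rotation_id)
    then have "x \<in> PL" using rotation_inj[OF \<pi>_permutes[OF x] permutes_id] by (simp add: PL_iff)
    then show "x \<in> DPL" using c chain_zero_imp_derived chain_zero_iff_coords by blast
  qed
  show "DPL \<subseteq> kernel L (euclidean_group d) motion"
  proof
    fix x assume x: "x \<in> DPL"
    then have "x \<in> PL" using DPL_subset by blast
    then show "x \<in> kernel L (euclidean_group d) motion"
      using derived_imp_chain_zero[OF x] motion_PL PL_carrier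
      by (simp add: kernel_def euclidean_one coords_zero)
  qed
qed

abbreviation \<Gamma> :: "isometry set" where "\<Gamma> \<equiv> motion ` carrier L"

sublocale iso: group_hom L "euclidean_group d" motion
  using motion_hom group_euclidean_group L.group_axioms
  by (simp add: group_hom_def group_hom_axioms_def)

lemma \<Gamma>_subgroup: "subgroup \<Gamma> (euclidean_group d)"
  by (rule iso.img_is_subgroup)

lemma quotient_iso: "L Mod DPL \<cong> (euclidean_group d)\<lparr>carrier := \<Gamma>\<rparr>"
proof -
  interpret r: group_hom L "(euclidean_group d)\<lparr>carrier := \<Gamma>\<rparr>" motion
    using motion_hom iso.H.subgroup_imp_group[OF \<Gamma>_subgroup] L.group_axioms
    by (auto simp: group_hom_def group_hom_axioms_def hom_def)
  have "L Mod (kernel L ((euclidean_group d)\<lparr>carrier := \<Gamma>\<rparr>) motion) \<cong> (euclidean_group d)\<lparr>carrier := \<Gamma>\<rparr>"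
    by (rule r.FactGroup_iso) simp
  moreover have "kernel L ((euclidean_group d)\<lparr>carrier := \<Gamma>\<rparr>) motion = DPL"
    using motion_kernel by (simp add: kernel_def)
  ultimately show ?thesis by simp
qed

text \<open>
  Only finitely many linear parts occur.  Two elements with the same linear part differ by an
  integral cycle; if their translation parts are close, all coefficients of this cycle are less
  than \<open>1\<close> in absolute value.
\<close>

lemma \<Gamma>_discrete: "discrete_subgroup d \<Gamma>"
proof -
  have sub: "\<Gamma> \<subseteq> carrier (euclidean_group d)" using subgroup.subset[OF \<Gamma>_subgroup] .
  have basis_le: "\<bar>b k e\<bar> \<le> 1" if "k < d" for k e
  proof (cases "e \<in> edges")
    case True
    have "b k e * b k e \<le> dot edges (b k) (b k)"
      unfolding dot_def using True by (intro member_le_sum) auto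
    then have "b k e * b k e \<le> 1" using orthonormal_basis that by (simp add: orthonormal_def)
    then show ?thesis using abs_square_le_1[of "b k e"] by (simp add: power2_eq_square)
  next
    case False
    then have "b k e = 0" using basis_closed[OF that] unfolding closed_chain_def by blast
    then show ?thesis by simp
  qed
  \<comment> \<open>so small that \<open>d\<close> coordinates below \<open>\<epsilon>\<close> add up to less than \<open>1\<close>\<close>
  define \<epsilon> :: real where "\<epsilon> = 1 / (real d + 1)"
  have \<epsilon>: "\<epsilon> > 0" "real d * \<epsilon> < 1" by (simp_all add: \<epsilon>_def)
  have isolated: "openin (top_of_set \<Gamma>) {motion x}" if x: "x \<in> carrier L" for x
  proof -
    define V where "V = {w :: nat \<Rightarrow> real. \<forall>k\<in>{..<d}. \<bar>w k - coords (real_chain x) k\<bar> < \<epsilon>}"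
    define R where "R = rotation ` {p. p permutes {1..n}} - {rotation (\<pi> x)}"
    have "open {w :: nat \<Rightarrow> real. \<bar>w k - coords (real_chain x) k\<bar> < \<epsilon>}" for k
      by (intro open_Collect_less continuous_on_rabs continuous_on_diff continuous_on_product_coordinates
          continuous_on_const)
    then have "open (\<Inter>k\<in>{..<d}. {w :: nat \<Rightarrow> real. \<bar>w k - coords (real_chain x) k\<bar> < \<epsilon>})"
      by (intro open_INT) auto
    moreover have "V = (\<Inter>k\<in>{..<d}. {w. \<bar>w k - coords (real_chain x) k\<bar> < \<epsilon>})" by (auto simp: V_def)
    ultimately have "open V" by simp
    moreover have "closed R"
      unfolding R_def by (intro finite_imp_closed) (simp add: finite_permutations)
    ultimately have "open (V \<times> (- R))" by (intro open_Times) auto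
    moreover have "{motion x} = \<Gamma> \<inter> (V \<times> (- R))"
    proof
      show "{motion x} \<subseteq> \<Gamma> \<inter> (V \<times> (- R))" using x \<epsilon> by (auto simp: motion_def V_def R_def)
      show "\<Gamma> \<inter> (V \<times> (- R)) \<subseteq> {motion x}"
      proof
        fix g assume g: "g \<in> \<Gamma> \<inter> (V \<times> (- R))"
        then obtain y where y: "y \<in> carrier L" "g = motion y" by blast
        have near: "\<bar>coords (real_chain y) k - coords (real_chain x) k\<bar> < \<epsilon>" if "k < d" for k
          using g that by (simp add: y motion_def V_def)
        have "rotation (\<pi> y) \<notin> R" using g by (simp add: y motion_def)
        then have "rotation (\<pi> x) = rotation (\<pi> y)" using \<pi>_permutes[OF y(1)] by (auto simp: R_def)
        then have \<pi>: "\<pi> x = \<pi> y" using rotation_inj \<pi>_permutes x y(1) by blast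
        then obtain p where p: "p \<in> PL" "y = p \<otimes>\<^bsub>L\<^esub> x" using same_\<pi>[OF x y(1)] by blast
        have chain_y: "chain y = (\<lambda>e. chain p e + chain x e)" using chain_PL_mult[OF p(1) x] p(2) by simp
        have "coords (real_chain p) k = coords (real_chain y) k - coords (real_chain x) k" for k
          unfolding chain_y by (simp add: coords_def dot_right)
        then have small: "\<bar>coords (real_chain p) k\<bar> < \<epsilon>" if "k < d" for k using near[OF that] by simp
        have "chain p e = 0" for e
        proof -
          have "\<bar>real_chain p e\<bar> \<le> (\<Sum>k<d. \<bar>coords (real_chain p) k * b k e\<bar>)"
            unfolding expand_coords[OF closed_chain_of_PL[OF p(1)], of e] by (rule sum_abs)
          also have "\<dots> \<le> (\<Sum>k<d. \<epsilon> * 1)"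
            unfolding abs_mult using small basis_le \<epsilon>(1)
            by (intro sum_mono mult_mono) (auto simp: less_imp_le)
          also have "\<dots> < 1" using \<epsilon>(2) by simp
          finally show ?thesis by simp
        qed
        then have "chain y = chain x" using chain_y by simp
        then show "g \<in> {motion x}" using \<pi> by (simp add: y motion_def)
      qed
    qed
    ultimately show ?thesis unfolding openin_open by blast
  qed
  have "subtopology (euclidean_group_topology d) \<Gamma> = top_of_set \<Gamma>"
    unfolding euclidean_group_topology_def subtopology_subtopology
    using sub by (simp add: inf.absorb2)
  moreover have "discrete_topology \<Gamma> = top_of_set \<Gamma>"
    unfolding discrete_topology_unique using isolated by auto
  ultimately show ?thesis unfolding discrete_subgroup_def using \<Gamma>_subgroup by simp
qed

text \<open>
  A vector is moved close to the origin by rounding the coefficients of the corresponding cycle in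
  its expansion into the cycles of loops.
\<close>

lemma \<Gamma>_uniform: "uniform_subgroup d \<Gamma>"
proof (rule uniform_subgroupI[OF \<Gamma>_subgroup])
  let ?E = "euclidean_group d"
  define B where "B = (\<Sum>k<d. \<Sum>e\<in>edges. \<bar>dot edges (b k) (real_chain (edge_loop e))\<bar>)"
  fix v A assume va: "(v, A) \<in> carrier ?E"
  define y where "y = (\<lambda>e. \<Sum>k<d. v k * b k e)"
  have y: "closed_chain y" unfolding y_def by (intro closed_chain_sum basis_closed) auto
  obtain p where p: "p \<in> PL" "chain p = (\<lambda>e'. \<Sum>e\<in>edges. \<lfloor>y e\<rfloor> * chain (edge_loop e) e')"
    using ex_PL_combination[of edges edge_loop "\<lambda>e. \<lfloor>y e\<rfloor>"] edge_loop(1) by auto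
  define q where "q = \<one>\<^bsub>L\<^esub> \<otimes>\<^bsub>L\<^esub> inv\<^bsub>L\<^esub> p"
  have q: "q \<in> PL" "chain q = (\<lambda>e. - chain p e)"
    using chain_PL_diff[OF subgroup.one_closed[OF PL_subgroup] p(1)] by (simp_all add: q_def chain_one)
  define w where "w = (\<lambda>k. coords (real_chain q) k + v k)"
  have "motion q \<otimes>\<^bsub>?E\<^esub> (v, A) = (w, A)"
    using va by (simp add: motion_PL[OF q(1)] euclidean_mult euclidean_carrier orthogonal_iff
        mat_mul_identity mat_vec_identity w_def)
  moreover have "\<bar>w k\<bar> \<le> B" if k: "k < d" for k
  proof -
    have "dot edges (b k) y = (\<Sum>l<d. v l * dot edges (b k) (b l))" by (simp only: y_def dot_right)
    also have "\<dots> = (\<Sum>l<d. if l = k then v l else 0)"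
      using orthonormal_basis k by (intro sum.cong) (auto simp: orthonormal_def)
    also have "\<dots> = v k" using k by simp
    finally have vk: "v k = dot edges (b k) y" by simp
    have "w k = dot edges (b k) (\<lambda>e'. y e' - real_chain p e')"
    proof -
      have "real_chain q = (\<lambda>e. 0 - real_chain p e)" by (simp add: q(2))
      then have "coords (real_chain q) k = 0 - dot edges (b k) (real_chain p)"
        using k by (simp only: coords_def dot_right dot_zero if_True)
      then show ?thesis by (simp add: w_def vk dot_right)
    qed
    also have "(\<lambda>e'. y e' - real_chain p e')
        = (\<lambda>e'. \<Sum>e\<in>edges. (y e - of_int \<lfloor>y e\<rfloor>) * real_chain (edge_loop e) e')"
    proof (rule ext)
      fix e'
      show "y e' - real_chain p e' = (\<Sum>e\<in>edges. (y e - of_int \<lfloor>y e\<rfloor>) * real_chain (edge_loop e) e')"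
        unfolding closed_chain_expansion[OF y, of e']
        by (simp add: p(2) left_diff_distrib sum_subtractf)
    qed
    also have "dot edges (b k) \<dots> = (\<Sum>e\<in>edges. (y e - of_int \<lfloor>y e\<rfloor>) * dot edges (b k) (real_chain (edge_loop e)))"
      by (simp only: dot_right)
    finally have "\<bar>w k\<bar> \<le> (\<Sum>e\<in>edges. \<bar>(y e - of_int \<lfloor>y e\<rfloor>) * dot edges (b k) (real_chain (edge_loop e))\<bar>)"
      using sum_abs by (simp only:)
    also have "\<dots> \<le> (\<Sum>e\<in>edges. 1 * \<bar>dot edges (b k) (real_chain (edge_loop e))\<bar>)"
      unfolding abs_mult
    proof (intro sum_mono mult_right_mono)
      fix e
      have "0 \<le> y e - of_int \<lfloor>y e\<rfloor>" "y e - of_int \<lfloor>y e\<rfloor> < 1" by linarith+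
      then show "\<bar>y e - of_int \<lfloor>y e\<rfloor>\<bar> \<le> 1" by linarith
    qed simp
    also have "\<dots> \<le> B"
      unfolding B_def using k by (simp, intro member_le_sum) (auto intro!: sum_nonneg)
    finally show ?thesis .
  qed
  ultimately show "\<exists>\<gamma>\<in>\<Gamma>. \<exists>w. \<gamma> \<otimes>\<^bsub>?E\<^esub> (v, A) = (w, A) \<and> (\<forall>k<d. \<bar>w k\<bar> \<le> B)"
    using PL_carrier[OF q(1)] by blast
qed

lemma crystallographic: "crystallographic_group d (L Mod DPL)"
  unfolding crystallographic_group_def
  using normal.factorgroup_is_group[OF DPL_normal] \<Gamma>_discrete \<Gamma>_uniform quotient_iso by blast

end

context triplet
begin

section \<open>The extension and its torsion\<close>

lemma quotient_sequence:
  "short_exact (pure_triplet_group n Mod DPL) (\<lambda>C. C) (L Mod DPL) (induced_map \<pi>) (sym_group n)"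
proof -
  let ?A = "pure_triplet_group n Mod DPL" and ?B = "L Mod DPL"
  have A: "carrier ?A = (\<lambda>x. DPL #>\<^bsub>L\<^esub> x) ` PL"
    by (simp add: carrier_FactGroup pure_triplet_group_def r_coset_def)
  have B: "carrier ?B = (\<lambda>x. DPL #>\<^bsub>L\<^esub> x) ` carrier L" by (simp add: carrier_FactGroup)
  have mult: "C \<otimes>\<^bsub>?A\<^esub> D = C \<otimes>\<^bsub>?B\<^esub> D" for C D
    by (simp add: pure_triplet_group_def set_mult_def)
  have ind: "induced_map \<pi> (DPL #>\<^bsub>L\<^esub> x) = \<pi> x" if x: "x \<in> carrier L" for x
  proof -
    have "\<pi> y = \<pi> x" if y: "y \<in> DPL #>\<^bsub>L\<^esub> x" for y
    proof -
      obtain h where h: "h \<in> DPL" "y = h \<otimes>\<^bsub>L\<^esub> x" using y unfolding r_coset_def by blast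
      then have "h \<in> PL" using DPL_subset by blast
      then show ?thesis using \<pi>.hom_mult[OF PL_carrier x] h by (simp add: PL_iff)
    qed
    moreover have "x \<in> DPL #>\<^bsub>L\<^esub> x" using L.rcos_self[OF x normal_imp_subgroup[OF DPL_normal]] .
    ultimately have "\<pi> ` (DPL #>\<^bsub>L\<^esub> x) = {\<pi> x}" by blast
    then show ?thesis by (simp add: induced_map_def)
  qed
  have groups: "group ?A" "group ?B" "group (sym_group n)"
    using normal.factorgroup_is_group[OF DPL_normal_PL] normal.factorgroup_is_group[OF DPL_normal]
      sym_group_is_group by blast+
  have sub: "carrier ?A \<subseteq> carrier ?B" unfolding A B using PL_carrier by blast
  have "(\<lambda>C. C) \<in> mon ?A ?B"
    using sub mult by (auto simp: mon_def hom_def)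
  moreover have "induced_map \<pi> \<in> epi ?B (sym_group n)"
  proof -
    have "induced_map \<pi> (C \<otimes>\<^bsub>?B\<^esub> D) = induced_map \<pi> C \<circ> induced_map \<pi> D"
      if CD: "C \<in> carrier ?B" "D \<in> carrier ?B" for C D
    proof -
      obtain x y where xy: "x \<in> carrier L" "y \<in> carrier L" "C = DPL #>\<^bsub>L\<^esub> x" "D = DPL #>\<^bsub>L\<^esub> y"
        using CD unfolding B by blast
      then have "C \<otimes>\<^bsub>?B\<^esub> D = DPL #>\<^bsub>L\<^esub> (x \<otimes>\<^bsub>L\<^esub> y)"
        using normal.rcos_sum[OF DPL_normal] by simp
      then show ?thesis using xy ind \<pi>.hom_mult[OF xy(1,2)] by simp
    qed
    moreover have "induced_map \<pi> ` carrier ?B = carrier (sym_group n)"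
    proof -
      have "induced_map \<pi> ` carrier ?B = \<pi> ` carrier L"
        unfolding B image_image using ind by (intro image_cong) auto
      also have "\<dots> = carrier (sym_group n)"
        using \<pi>_surj \<pi>_permutes by (auto simp: sym_group_carrier image_iff) metis
      finally show ?thesis .
    qed
    ultimately show ?thesis by (auto simp: epi_def hom_def)
  qed
  moreover have "kernel ?B (sym_group n) (induced_map \<pi>) = (\<lambda>C. C) ` carrier ?A"
  proof -
    have "kernel ?B (sym_group n) (induced_map \<pi>) = (\<lambda>x. DPL #>\<^bsub>L\<^esub> x) ` {x \<in> carrier L. \<pi> x = id}"
      unfolding kernel_def B using ind by auto
    also have "{x \<in> carrier L. \<pi> x = id} = PL" by (auto simp: PL_iff)
    finally show ?thesis by (simp add: A)
  qed
  ultimately show ?thesis unfolding short_exact_def using groups by blast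
qed

text \<open>
  The class of \<open>y\<^sub>1\<close> has order two, as its permutation is not the identity.
\<close>

lemma quotient_torsion: "\<not> torsion_free_group (L Mod DPL)"
proof
  assume tf: "torsion_free_group (L Mod DPL)"
  let ?B = "L Mod DPL"
  interpret B: group ?B by (rule normal.factorgroup_is_group[OF DPL_normal])
  have g: "gen 1 \<in> carrier L" "gen 1 \<otimes>\<^bsub>L\<^esub> gen 1 = \<one>\<^bsub>L\<^esub>" using n_ge_4 gen_square[of 1] by auto
  define C where "C = DPL #>\<^bsub>L\<^esub> gen 1"
  have C: "C \<in> carrier ?B" using g by (auto simp: C_def carrier_FactGroup)
  have "DPL #>\<^bsub>L\<^esub> \<one>\<^bsub>L\<^esub> = DPL" using DPL_subset PL_carrier by (intro L.coset_mult_one) blast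
  then have "C \<otimes>\<^bsub>?B\<^esub> C = \<one>\<^bsub>?B\<^esub>"
    using normal.rcos_sum[OF DPL_normal g(1) g(1)] g(2) by (simp add: C_def)
  then have "C [^]\<^bsub>?B\<^esub> (2::nat) = \<one>\<^bsub>?B\<^esub>"
    using C by (simp add: numeral_2_eq_2 del: mult_FactGroup one_FactGroup)
  then have "C = \<one>\<^bsub>?B\<^esub>" using tf C unfolding torsion_free_group_def by (meson pos2)
  then have "gen 1 \<in> DPL"
    using L.coset_join1[OF _ g(1) normal_imp_subgroup[OF DPL_normal]] by (simp add: C_def)
  then have "\<pi> (gen 1) = id" using DPL_subset PL_iff by blast
  then have "swap 1 1 = 1" using n_ge_4 \<pi>_gen[of 1] by simp
  then show False by (simp add: swap_apply)
qed

end

section \<open>The quotient is crystallographic and not Bieberbach\<close>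

theorem theorem4p12:
  fixes n :: nat
  assumes "n \<ge> 4"
  shows "short_exact
           (pure_triplet_group n Mod pure_triplet_derived n) (\<lambda>C. C)
           (triplet_group n Mod pure_triplet_derived n) (induced_map (triplet_perm n))
           (sym_group n) \<and>
         (\<exists>d::nat. real d = 1 + fact n * ((2 * real n - 7) / 6) \<and>
           crystallographic_group d (triplet_group n Mod pure_triplet_derived n)) \<and>
         \<not> bieberbach_group (triplet_group n Mod pure_triplet_derived n)"
proof -
  interpret triplet n using assms by unfold_locales
  obtain d b where d: "real d = 1 + fact n * ((2 * real n - 7) / 6)" and "orthonormal edges d b"
    "\<And>k. k < d \<Longrightarrow> closed_chain (b k)" "\<And>x e. closed_chain x \<Longrightarrow> x e = proj edges d b x e"
    using cycle_basis by blast
  then interpret triplet_basis n d b by unfold_locales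
  show ?thesis
    using quotient_sequence d crystallographic quotient_torsion by (auto simp: bieberbach_group_def)
qed

end
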